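(* Let $\mathfrak n=\mathfrak n_{\mathcal T}$ be an arbitrary nilradical in $\mathfrak g$. Then $\mathfrak n$ is square integrable if and only if $d_{\mathcal T}\le2$ and $\mathcal K_{\mathcal T}\subset\Delta_{\mathcal T}(d_{\mathcal T})=\Delta(\mathfrak z(\mathfrak n))$.
   Context: Everything is over $\mathbb C$. $\mathfrak g=\mathfrak u\oplus\mathfrak t\oplus\mathfrak u^-$ is a simple Lie algebra with a fixed triangular decomposition. $\Delta$ is the root system of $(\mathfrak g,\mathfrak t)$, $\Delta^+$ the set of roots of $\mathfrak u$, $\Pi$ the simple roots, $\theta$ the highest root, $\mathfrak g_\gamma$ the root spaces, $[\gamma:\alpha]$ the coefficient of $\alpha\in\Pi$ in $\gamma$. For nonempty $\mathcal T\subset\Pi$, $\mathfrak n_{\mathcal T}=\bigoplus\mathfrak g_\gamma$, the sum over all $\gamma\in\Delta^+$ with $[\gamma:\alpha]>0$ for some $\alpha\in\mathcal T$; these are exactly the nonzero nilradicals of standard parabolic subalgebras. Set $d_{\mathcal T}=\sum_{\alpha\in\mathcal T}[\theta:\alpha]$ and $\Delta_{\mathcal T}(i)=\{\gamma\in\Delta^+\mid\sum_{\alpha\in\mathcal T}[\gamma:\alpha]=i\}$. The centre $\mathfrak z(\mathfrak n_{\mathcal T})$ of $\mathfrak n_{\mathcal T}$ is $\bigoplus_{\gamma\in\Delta_{\mathcal T}(d_{\mathcal T})}\mathfrak g_\gamma$, and $\Delta(\mathfrak z(\mathfrak n))$ is its set of roots. Kostant cascade. For an irreducible root subsystem $\Delta'\subset\Delta$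 with highest root $\beta'$, the descendants of $\beta'$ are the highest roots of the irreducible components of $\{\gamma\in\Delta'\mid(\gamma,\beta')=0\}$. The Kostant cascade $\mathcal K\subset\Delta^+$ is obtained from $(\Delta,\theta)$ by taking $\theta$ and iteratively taking descendants. $\mathcal K_{\mathcal T}=\mathcal K\cap\Delta(\mathfrak n_{\mathcal T})$, where $\Delta(\mathfrak n_{\mathcal T})$ is the set of roots of $\mathfrak n_{\mathcal T}$. For a Lie algebra $\mathfrak q$, $\mathrm{ind}\,\mathfrak q=\min_{\xi\in\mathfrak q^*}\dim\mathfrak q^\xi$ ($\mathfrak q^\xi$ the stabiliser for the coadjoint representation). The nilradical $\mathfrak n$ is square integrable if $\mathrm{ind}\,\mathfrak n=\dim\mathfrak z(\mathfrak n)$. *)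

theory Defs
  imports Complex_Main "HOL-Library.Function_Algebras"
begin

section \<open>Complex Lie algebras\<close>

class complex_lie_algebra = ab_group_add +
  fixes scaleC :: "complex \<Rightarrow> 'a \<Rightarrow> 'a"
    and bracket :: "'a \<Rightarrow> 'a \<Rightarrow> 'a"
  assumes scaleC_add_right: "scaleC c (x + y) = scaleC c x + scaleC c y"
    and scaleC_add_left: "scaleC (c + d) x = scaleC c x + scaleC d x"
    and scaleC_scaleC: "scaleC c (scaleC d x) = scaleC (c * d) x"
    and scaleC_one: "scaleC 1 x = x"
    and bracket_add_left: "bracket (x + y) z = bracket x z + bracket y z"
    and bracket_add_right: "bracket x (y + z) = bracket x y + bracket x z"
    and bracket_scaleC_left: "bracket (scaleC c x) y = scaleC c (bracket x y)"
    and bracket_scaleC_right: "bracket x (scaleC c y) = scaleC c (bracket x y)"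
    and bracket_self: "bracket x x = 0"
    and jacobi: "bracket x (bracket y z) + bracket y (bracket z x) + bracket z (bracket x y) = 0"

global_interpretation complex_vector: vector_space "scaleC :: complex \<Rightarrow> 'a \<Rightarrow> 'a::complex_lie_algebra"
  defines csubspace = complex_vector.subspace
    and cspan = complex_vector.span
    and cdim = complex_vector.dim
    and crepresentation = complex_vector.representation
    and cextend_basis = complex_vector.extend_basis
  by unfold_locales (rule scaleC_add_right scaleC_add_left scaleC_scaleC scaleC_one)+

definition lie_subalgebra :: "'a::complex_lie_algebra set \<Rightarrow> bool" where
  "lie_subalgebra q \<longleftrightarrow> csubspace q \<and> (\<forall>x\<in>q. \<forall>y\<in>q. bracket x y \<in> q)"

definition lie_ideal :: "'a::complex_lie_algebra set \<Rightarrow> bool" where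
  "lie_ideal I \<longleftrightarrow> csubspace I \<and> (\<forall>x. \<forall>y\<in>I. bracket x y \<in> I)"

definition simple_lie_algebra :: "'a::complex_lie_algebra itself \<Rightarrow> bool" where
  "simple_lie_algebra _ \<longleftrightarrow>
     (\<exists>B :: 'a set. finite B \<and> cspan B = UNIV) \<and>
     (\<exists>x y :: 'a. bracket x y \<noteq> 0) \<and>
     (\<forall>I :: 'a set. lie_ideal I \<longrightarrow> I = {0} \<or> I = UNIV)"

definition centre :: "'a::complex_lie_algebra set \<Rightarrow> 'a set" where
  "centre q = {x \<in> q. \<forall>y\<in>q. bracket x y = 0}"

text \<open>A linear functional on a subspace \<open>q\<close> is represented by its extension by \<open>0\<close> to the
  complement of \<open>q\<close> (as a set), so that equality of functions is equality of functionals on \<open>q\<close>.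
  The extension is not linear on the whole type, but sums and multiples are the expected ones.\<close>

definition linear_dual :: "'a::complex_lie_algebra set \<Rightarrow> ('a \<Rightarrow> complex) set" where
  "linear_dual q = {\<xi>.
     (\<forall>x\<in>q. \<forall>y\<in>q. \<xi> (x + y) = \<xi> x + \<xi> y) \<and>
     (\<forall>c. \<forall>x\<in>q. \<xi> (scaleC c x) = c * \<xi> x) \<and>
     (\<forall>x. x \<notin> q \<longrightarrow> \<xi> x = 0)}"

definition coadjoint :: "'a::complex_lie_algebra set \<Rightarrow> 'a \<Rightarrow> ('a \<Rightarrow> complex) \<Rightarrow> ('a \<Rightarrow> complex)" where
  "coadjoint q x \<xi> = (\<lambda>y. if y \<in> q then - \<xi> (bracket x y) else 0)"

definition coadjoint_stabiliser :: "'a::complex_lie_algebra set \<Rightarrow> ('a \<Rightarrow> complex) \<Rightarrow> 'a set" where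
  "coadjoint_stabiliser q \<xi> = {x \<in> q. coadjoint q x \<xi> = 0}"

definition lie_index :: "'a::complex_lie_algebra set \<Rightarrow> nat" where
  "lie_index q = (LEAST k. \<exists>\<xi>\<in>linear_dual q. k = cdim (coadjoint_stabiliser q \<xi>))"

definition square_integrable :: "'a::complex_lie_algebra set \<Rightarrow> bool" where
  "square_integrable q \<longleftrightarrow> lie_index q = cdim (centre q)"

subsection \<open>Killing form\<close>

text \<open>The trace is computed in the arbitrary basis \<open>cextend_basis {}\<close> of the whole space.\<close>

definition endo_trace :: "('a::complex_lie_algebra \<Rightarrow> 'a) \<Rightarrow> complex" where
  "endo_trace f = (\<Sum>b\<in>cextend_basis {}. crepresentation (cextend_basis {}) (f b) b)"

definition killing_form :: "'a::complex_lie_algebra \<Rightarrow> 'a \<Rightarrow> complex" where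
  "killing_form x y = endo_trace (\<lambda>z. bracket x (bracket y z))"

subsection \<open>Triangular decompositions\<close>

definition ad_semisimple :: "'a::complex_lie_algebra \<Rightarrow> bool" where
  "ad_semisimple h \<longleftrightarrow> cspan {x. \<exists>c. bracket h x = scaleC c x} = UNIV"

definition toral :: "'a::complex_lie_algebra set \<Rightarrow> bool" where
  "toral t \<longleftrightarrow> lie_subalgebra t \<and> (\<forall>h\<in>t. ad_semisimple h)"

text \<open>Maximal toral subalgebras are the Cartan subalgebras of a semisimple Lie algebra.\<close>

definition cartan_subalgebra :: "'a::complex_lie_algebra set \<Rightarrow> bool" where
  "cartan_subalgebra t \<longleftrightarrow> toral t \<and> (\<forall>t'. toral t' \<and> t \<subseteq> t' \<longrightarrow> t' = t)"

definition root_space :: "'a::complex_lie_algebra set \<Rightarrow> ('a \<Rightarrow> complex) \<Rightarrow> 'a set" where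
  "root_space t \<gamma> = {x. \<forall>h\<in>t. bracket h x = scaleC (\<gamma> h) x}"

definition roots :: "'a::complex_lie_algebra set \<Rightarrow> ('a \<Rightarrow> complex) set" where
  "roots t = {\<gamma> \<in> linear_dual t. \<gamma> \<noteq> 0 \<and> root_space t \<gamma> \<noteq> {0}}"

definition roots_of :: "'a::complex_lie_algebra set \<Rightarrow> 'a set \<Rightarrow> ('a \<Rightarrow> complex) set" where
  "roots_of t m = {\<gamma> \<in> roots t. root_space t \<gamma> \<subseteq> m}"

definition positive_system :: "'a::complex_lie_algebra set \<Rightarrow> ('a \<Rightarrow> complex) set \<Rightarrow> bool" where
  "positive_system t P \<longleftrightarrow>
     P \<inter> uminus ` P = {} \<and> P \<union> uminus ` P = roots t \<and>
     (\<forall>\<gamma>\<in>P. \<forall>\<delta>\<in>P. \<gamma> + \<delta> \<in> roots t \<longrightarrow> \<gamma> + \<delta> \<in> P)"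

definition triangular_decomposition :: "'a::complex_lie_algebra set \<Rightarrow> 'a set \<Rightarrow> 'a set \<Rightarrow> bool" where
  "triangular_decomposition u t u' \<longleftrightarrow>
     cartan_subalgebra t \<and>
     positive_system t (roots_of t u) \<and>
     u = cspan (\<Union>\<gamma>\<in>roots_of t u. root_space t \<gamma>) \<and>
     u' = cspan (\<Union>\<gamma>\<in>roots_of t u. root_space t (- \<gamma>)) \<and>
     (\<forall>x. \<exists>!(a, h, b). a \<in> u \<and> h \<in> t \<and> b \<in> u' \<and> x = a + h + b)"

text \<open>In what follows \<open>t\<close> and \<open>u\<close> are the components of a triangular decomposition, and
  \<open>roots_of t u\<close> is the set of positive roots.\<close>

definition simple_roots :: "'a::complex_lie_algebra set \<Rightarrow> 'a set \<Rightarrow> ('a \<Rightarrow> complex) set" where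
  "simple_roots t u =
     {\<alpha> \<in> roots_of t u. \<not> (\<exists>\<gamma>\<in>roots_of t u. \<exists>\<delta>\<in>roots_of t u. \<alpha> = \<gamma> + \<delta>)}"

definition root_coeffs :: "'a::complex_lie_algebra set \<Rightarrow> 'a set \<Rightarrow> ('a \<Rightarrow> complex) \<Rightarrow> (('a \<Rightarrow> complex) \<Rightarrow> int)" where
  "root_coeffs t u \<gamma> = (THE c. (\<forall>\<alpha>. \<alpha> \<notin> simple_roots t u \<longrightarrow> c \<alpha> = 0) \<and>
     \<gamma> = (\<lambda>h. \<Sum>\<alpha>\<in>simple_roots t u. of_int (c \<alpha>) * \<alpha> h))"

text \<open>The highest root of a subsystem \<open>\<Phi>\<close> is the greatest element for the partial order given by
  the positive system \<open>\<Phi> \<inter> roots_of t u\<close>: subtracting any root of \<open>\<Phi>\<close> from it leaves a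
  nonnegative integral combination of positive roots of \<open>\<Phi>\<close>.\<close>

definition highest_root :: "'a::complex_lie_algebra set \<Rightarrow> 'a set \<Rightarrow> ('a \<Rightarrow> complex) set \<Rightarrow> ('a \<Rightarrow> complex)" where
  "highest_root t u \<Phi> = (THE \<beta>. \<beta> \<in> \<Phi> \<and>
     (\<forall>\<gamma>\<in>\<Phi>. \<exists>c :: ('a \<Rightarrow> complex) \<Rightarrow> nat.
        \<beta> - \<gamma> = (\<lambda>h. \<Sum>\<delta>\<in>\<Phi> \<inter> roots_of t u. of_nat (c \<delta>) * \<delta> h)))"

subsection \<open>The Kostant cascade\<close>

definition killing_dual :: "'a::complex_lie_algebra set \<Rightarrow> ('a \<Rightarrow> complex) \<Rightarrow> 'a" where
  "killing_dual t \<gamma> = (THE h. h \<in> t \<and> (\<forall>h'\<in>t. killing_form h h' = \<gamma> h'))"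

text \<open>The form on the dual of \<open>t\<close> induced by the Killing form.\<close>

definition root_form :: "'a::complex_lie_algebra set \<Rightarrow> ('a \<Rightarrow> complex) \<Rightarrow> ('a \<Rightarrow> complex) \<Rightarrow> complex" where
  "root_form t \<gamma> \<delta> = killing_form (killing_dual t \<gamma>) (killing_dual t \<delta>)"

definition irreducible_roots :: "'a::complex_lie_algebra set \<Rightarrow> ('a \<Rightarrow> complex) set \<Rightarrow> bool" where
  "irreducible_roots t \<Phi> \<longleftrightarrow> \<Phi> \<noteq> {} \<and>
     \<not> (\<exists>A B. A \<noteq> {} \<and> B \<noteq> {} \<and> A \<inter> B = {} \<and> \<Phi> = A \<union> B \<and>
          (\<forall>\<gamma>\<in>A. \<forall>\<delta>\<in>B. root_form t \<gamma> \<delta> = 0))"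

definition irreducible_component ::
  "'a::complex_lie_algebra set \<Rightarrow> ('a \<Rightarrow> complex) set \<Rightarrow> ('a \<Rightarrow> complex) set \<Rightarrow> bool" where
  "irreducible_component t \<Phi> C \<longleftrightarrow>
     C \<subseteq> \<Phi> \<and> irreducible_roots t C \<and> (\<forall>\<gamma>\<in>C. \<forall>\<delta>\<in>\<Phi> - C. root_form t \<gamma> \<delta> = 0)"

text \<open>The irreducible subsystems whose highest roots form the cascade.\<close>

inductive_set cascade_systems :: "'a::complex_lie_algebra set \<Rightarrow> 'a set \<Rightarrow> ('a \<Rightarrow> complex) set set"
  for t u :: "'a set" where
  top: "roots t \<in> cascade_systems t u"
| descendant: "\<Phi> \<in> cascade_systems t u \<Longrightarrow>
     irreducible_component t {\<gamma> \<in> \<Phi>. root_form t \<gamma> (highest_root t u \<Phi>) = 0} C \<Longrightarrow>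
     C \<in> cascade_systems t u"

definition kostant_cascade :: "'a::complex_lie_algebra set \<Rightarrow> 'a set \<Rightarrow> ('a \<Rightarrow> complex) set" where
  "kostant_cascade t u = highest_root t u ` cascade_systems t u"

subsection \<open>Standard nilradicals\<close>

definition nilradical :: "'a::complex_lie_algebra set \<Rightarrow> 'a set \<Rightarrow> ('a \<Rightarrow> complex) set \<Rightarrow> 'a set" where
  "nilradical t u T =
     cspan (\<Union>\<gamma>\<in>{\<gamma> \<in> roots_of t u. \<exists>\<alpha>\<in>T. root_coeffs t u \<gamma> \<alpha> > 0}. root_space t \<gamma>)"

definition nilradical_depth :: "'a::complex_lie_algebra set \<Rightarrow> 'a set \<Rightarrow> ('a \<Rightarrow> complex) set \<Rightarrow> int" where
  "nilradical_depth t u T = (\<Sum>\<alpha>\<in>T. root_coeffs t u (highest_root t u (roots t)) \<alpha>)"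

definition graded_roots ::
  "'a::complex_lie_algebra set \<Rightarrow> 'a set \<Rightarrow> ('a \<Rightarrow> complex) set \<Rightarrow> int \<Rightarrow> ('a \<Rightarrow> complex) set" where
  "graded_roots t u T i = {\<gamma> \<in> roots_of t u. (\<Sum>\<alpha>\<in>T. root_coeffs t u \<gamma> \<alpha>) = i}"

definition nilradical_cascade ::
  "'a::complex_lie_algebra set \<Rightarrow> 'a set \<Rightarrow> ('a \<Rightarrow> complex) set \<Rightarrow> ('a \<Rightarrow> complex) set" where
  "nilradical_cascade t u T = kostant_cascade t u \<inter> roots_of t (nilradical t u T)"

end

theory Submission
  imports Defs
begin

text \<open>The roots of \<open>n\<close> with top degree span its centre, and \<open>n\<close> is square integrable iff some functional
  \<open>\<eta>\<close> on \<open>n\<close> has the centre as its stabiliser. Let \<open>\<xi>\<close> be the sum of the coordinate functionals of the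
  cascade roots in \<open>n\<close>. Each positive root \<open>\<gamma>\<close> is a cascade root or has a unique positive partner \<open>\<beta> - \<gamma>\<close>
  with \<open>\<beta>\<close> in the cascade, so the form of \<open>\<xi>\<close> is a permutation matrix up to scalars; if the
  cascade roots of \<open>n\<close> have top degree, its radical is the centre.

  Conversely, by the same pairing, \<open>\<xi>\<close> has a dense orbit under the Borel subgroup. Infinitesimally this lets
  one extend every vector stabilising \<open>\<xi>\<close> to a formal power series stabilising \<open>\<xi> + s \<eta>\<close>; if the stabiliser
  of \<open>\<eta>\<close> is the centre, its coefficients form an infinite Jordan chain unless the vector is
  central. Root vectors of cascade roots stabilise \<open>\<xi>\<close>, hence are central, that is, of top
  degree \<open>d\<close>. Finally the product of the reflections in the cascade roots maps simple roots to negatives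
  of simple roots and preserves degrees modulo \<open>d\<close>, so \<open>d\<close> divides \<open>1\<close> or \<open>2\<close>.

  The structure theory of root spaces rests on one principle: on a sum of root spaces invariant under
  \<open>e\<close> and \<open>f\<close>, the trace of \<open>ad [e, f]\<close> vanishes.\<close>

section \<open>Root systems with a positive system\<close>

text \<open>Square integrability only provides some functional \<open>\<eta>\<close> with small
  stabiliser, while the cascade condition is read off from the particular functional
  \<open>\<xi>0\<close>. Stabilisers may grow at special points, so information has to be carried
  from \<open>\<eta>\<close> to \<open>\<xi>0\<close>; this is what an open orbit is good for.
  Groups and density arguments are avoided by keeping only the tangent statement: every functional
  on the nilradical has the form w -> \<open>\<xi>0\<close> [z, w] with z in its normaliser. It
  holds by a diagonal computation: the element of \<open>t\<close> dual to a cascade root reaches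
  the coordinate of that root, and the root vector of the partner reaches the coordinate of any
  other root. For the contradiction, let N be the operator modulo the centre with \<eta>[N x, y] =
  \<open>\<xi>0\<close> [x, y]. The coefficients of the formal solution satisfy N x_0 = 0 and N
  x_(k+1) = - x_k, which cannot go on in finite dimension unless x_0 is central. In the structure
  theory the trace argument takes the place of representations of sl2 and of Cartan's criterion: it
  gives real ratios between the values of roots on [e, f], so that a vanishing Killing form becomes
  a vanishing sum of squares.\<close>

definition cone :: "'v::comm_ring_1 set \<Rightarrow> 'v set" where
  "cone Q = {sum_list xs | xs. set xs \<subseteq> Q}"

lemma cone_zero: "0 \<in> cone Q"
  unfolding cone_def by (rule CollectI, rule exI[of _ "[]"]) simp

lemma cone_base: "x \<in> Q \<Longrightarrow> x \<in> cone Q"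
  unfolding cone_def by (rule CollectI, rule exI[of _ "[x]"]) simp

lemma cone_add:
  assumes "x \<in> cone Q" "y \<in> cone Q" shows "x + y \<in> cone Q"
proof -
  obtain xs ys where "x = sum_list xs" "set xs \<subseteq> Q" "y = sum_list ys" "set ys \<subseteq> Q"
    using assms unfolding cone_def by blast
  then have "x + y = sum_list (xs @ ys)" "set (xs @ ys) \<subseteq> Q" by auto
  then show ?thesis unfolding cone_def by blast
qed

lemma cone_of_nat: "x \<in> cone Q \<Longrightarrow> of_nat n * x \<in> cone Q"
  by (induction n) (auto simp: cone_zero algebra_simps intro: cone_add)

lemma cone_sum: "(\<And>i. i \<in> I \<Longrightarrow> f i \<in> cone Q) \<Longrightarrow> sum f I \<in> cone Q"
  by (induction I rule: infinite_finite_induct) (auto simp: cone_zero intro: cone_add)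

lemma cone_induct [consumes 1, case_names zero add]:
  assumes "x \<in> cone Q" and "Pr 0" and "\<And>x q. x \<in> cone Q \<Longrightarrow> Pr x \<Longrightarrow> q \<in> Q \<Longrightarrow> Pr (q + x)"
  shows "Pr x"
proof -
  have "set xs \<subseteq> Q \<Longrightarrow> sum_list xs \<in> cone Q \<and> Pr (sum_list xs)" for xs
    by (induction xs) (auto simp: cone_zero assms(2) intro: cone_add cone_base assms(3))
  then show ?thesis using assms(1) unfolding cone_def by blast
qed

text \<open>Bridge between sums of lists, which suit induction, and the natural number coefficients
  that occur in \<open>highest_root\<close>.\<close>

lemma cone_iff_coeffs:
  assumes "finite Q"
  shows "x \<in> cone Q \<longleftrightarrow> (\<exists>c :: 'v \<Rightarrow> nat. x = (\<Sum>q\<in>Q. of_nat (c q) * (q::'v::comm_ring_1)))"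
proof
  assume "x \<in> cone Q"
  then show "\<exists>c :: 'v \<Rightarrow> nat. x = (\<Sum>q\<in>Q. of_nat (c q) * q)"
  proof (induction rule: cone_induct)
    case zero
    show ?case by (rule exI[of _ "\<lambda>_. 0"]) simp
  next
    case (add x q)
    then obtain c where c: "x = (\<Sum>q\<in>Q. of_nat (c q) * q)" by blast
    have "(\<Sum>p\<in>Q. of_nat ((c(q := Suc (c q))) p) * p) = (\<Sum>p\<in>Q. of_nat (c p) * p + (if p = q then q else 0))"
      by (rule sum.cong) (auto simp: algebra_simps)
    also have "\<dots> = q + x"
      using assms add.hyps(2) by (simp add: sum.distrib c)
    finally show ?case by metis
  qed
next
  assume "\<exists>c :: 'v \<Rightarrow> nat. x = (\<Sum>q\<in>Q. of_nat (c q) * q)"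
  then show "x \<in> cone Q" by (auto intro: cone_sum cone_of_nat cone_base)
qed

text \<open>The ambient type is a commutative ring because functionals on \<open>t\<close> are
  complex-valued functions, among which \<open>of_int k * \<gamma>\<close> is the integer multiple
  of \<gamma>. A string is recorded by an interval from -r to q of multiples that stay in
  \<open>R\<close>, where r - q is the Cartan integer. Positivity is asked of integer combinations
  of roots only, since on arbitrary functions the intended form is degenerate.\<close>

locale root_system =
  fixes R :: "'v::comm_ring_1 set" and ip :: "'v \<Rightarrow> 'v \<Rightarrow> real"
  assumes finite_R: "finite R"
    and zero_notin_R: "0 \<notin> R"
    and minus_R: "\<gamma> \<in> R \<Longrightarrow> - \<gamma> \<in> R"
    and ip_sym: "ip x y = ip y x"
    and ip_add_left: "ip (x + y) z = ip x z + ip y z"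
    and root_string: "\<gamma> \<in> R \<Longrightarrow> \<delta> \<in> R \<Longrightarrow> \<delta> \<noteq> \<gamma> \<Longrightarrow> \<delta> \<noteq> - \<gamma> \<Longrightarrow>
      \<exists>r q :: nat. 2 * ip \<delta> \<gamma> = (real r - real q) * ip \<gamma> \<gamma> \<and>
        (\<forall>k::int. - int r \<le> k \<longrightarrow> k \<le> int q \<longrightarrow> \<delta> + of_int k * \<gamma> \<in> R)"
    and pos_def: "ip (\<Sum>\<gamma>\<in>R. of_int (c \<gamma>) * \<gamma>) (\<Sum>\<gamma>\<in>R. of_int (c \<gamma>) * \<gamma>) \<le> 0 \<Longrightarrow>
      (\<Sum>\<gamma>\<in>R. of_int (c \<gamma>) * \<gamma>) = 0"
begin

lemma ip_add_right: "ip x (y + z) = ip x y + ip x z"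
  using ip_add_left ip_sym by metis

lemma ip_zero_left [simp]: "ip 0 y = 0"
  using ip_add_left[of 0 0 y] by simp

lemma ip_zero_right [simp]: "ip x 0 = 0"
  using ip_sym[of x 0] by simp

lemma ip_minus_left [simp]: "ip (- x) y = - ip x y"
  using ip_add_left[of x "- x" y] by simp

lemma ip_minus_right [simp]: "ip x (- y) = - ip x y"
  using ip_minus_left[of y x] ip_sym[of x] by simp

lemma ip_diff_left: "ip (x - y) z = ip x z - ip y z"
  using ip_add_left[of x "- y" z] by simp

lemma ip_diff_right: "ip x (y - z) = ip x y - ip x z"
  using ip_add_right[of x y "- z"] by simp

lemma ip_of_nat_left: "ip (of_nat n * x) y = real n * ip x y"
  by (induction n) (auto simp: algebra_simps ip_add_left)

lemma ip_of_int_left: "ip (of_int n * x) y = of_int n * ip x y"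
proof (cases n)
  case (nonneg m)
  then show ?thesis using ip_of_nat_left[of m] by simp
next
  case (neg m)
  have "of_int n * x = - (of_nat (Suc m) * x)"
    using neg by (simp only: of_int_minus of_int_of_nat_eq mult_minus_left)
  then have "ip (of_int n * x) y = - (real (Suc m) * ip x y)" by (simp only: ip_minus_left ip_of_nat_left)
  moreover have "real_of_int n = - real (Suc m)" using neg by simp
  ultimately show ?thesis by (simp only: mult_minus_left)
qed

lemma ip_of_int_right: "ip x (of_int n * y) = of_int n * ip x y"
  using ip_of_int_left ip_sym by metis

lemma ip_sum_left: "ip (sum f I) y = (\<Sum>i\<in>I. ip (f i) y)"
  by (induction I rule: infinite_finite_induct) (auto simp: ip_add_left)

lemma ip_sum_right: "ip x (sum f I) = (\<Sum>i\<in>I. ip x (f i))"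
  by (induction I rule: infinite_finite_induct) (auto simp: ip_add_right)

lemma pos_def_subset:
  assumes "Q \<subseteq> R" and "ip (\<Sum>\<gamma>\<in>Q. of_int (c \<gamma>) * \<gamma>) (\<Sum>\<gamma>\<in>Q. of_int (c \<gamma>) * \<gamma>) \<le> 0"
  shows "(\<Sum>\<gamma>\<in>Q. of_int (c \<gamma>) * \<gamma>) = 0"
proof -
  have eq: "(\<Sum>\<gamma>\<in>R. of_int (if \<gamma> \<in> Q then c \<gamma> else 0) * \<gamma>) = (\<Sum>\<gamma>\<in>Q. of_int (c \<gamma>) * \<gamma>)"
    using assms(1) finite_R by (intro sum.mono_neutral_cong_right) auto
  then show ?thesis using pos_def[of "\<lambda>\<gamma>. if \<gamma> \<in> Q then c \<gamma> else 0"] assms(2) by simp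
qed

lemma ip_root_pos: "\<gamma> \<in> R \<Longrightarrow> ip \<gamma> \<gamma> > 0"
  using pos_def_subset[of "{\<gamma>}" "\<lambda>_. 1"] zero_notin_R by (cases "ip \<gamma> \<gamma> \<le> 0") auto

text \<open>A positive product forces r > q in the string of \<delta> along \<gamma>, so the string
  contains at least one step down.\<close>

lemma diff_root:
  assumes "\<gamma> \<in> R" "\<delta> \<in> R" "\<delta> \<noteq> \<gamma>" "ip \<delta> \<gamma> > 0"
  shows "\<delta> - \<gamma> \<in> R"
proof -
  have "\<delta> \<noteq> - \<gamma>" using assms(4) ip_root_pos[OF assms(1)] by auto
  from root_string[OF assms(1-3) this] obtain r q :: nat where
    *: "2 * ip \<delta> \<gamma> = (real r - real q) * ip \<gamma> \<gamma>"
    and str: "\<forall>k::int. - int r \<le> k \<longrightarrow> k \<le> int q \<longrightarrow> \<delta> + of_int k * \<gamma> \<in> R" by blast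
  have "0 < (real r - real q) * ip \<gamma> \<gamma>" using * assms(4) by linarith
  then have "r > q" using ip_root_pos[OF assms(1)] by (simp add: zero_less_mult_iff)
  then show ?thesis using str[rule_format, of "-1"] by simp
qed

lemma sum_root:
  assumes "\<gamma> \<in> R" "\<delta> \<in> R" "\<delta> \<noteq> - \<gamma>" "ip \<delta> \<gamma> < 0"
  shows "\<delta> + \<gamma> \<in> R"
  using diff_root[of "- \<gamma>" \<delta>] assms by (simp add: minus_R)

text \<open>Here r - q is positive and different from 1, so the string contains two steps
  down.\<close>

lemma double_diff_root:
  assumes "\<gamma> \<in> R" "\<delta> \<in> R" "\<delta> \<noteq> \<gamma>" "ip \<delta> \<gamma> > 0" "2 * ip \<delta> \<gamma> \<noteq> ip \<gamma> \<gamma>"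
  shows "\<delta> - 2 * \<gamma> \<in> R"
proof -
  have "\<delta> \<noteq> - \<gamma>" using assms(4) ip_root_pos[OF assms(1)] by auto
  from root_string[OF assms(1-3) this] obtain r q :: nat where
    *: "2 * ip \<delta> \<gamma> = (real r - real q) * ip \<gamma> \<gamma>"
    and str: "\<forall>k::int. - int r \<le> k \<longrightarrow> k \<le> int q \<longrightarrow> \<delta> + of_int k * \<gamma> \<in> R" by blast
  have "0 < (real r - real q) * ip \<gamma> \<gamma>" using * assms(4) by linarith
  then have "r > q" using ip_root_pos[OF assms(1)] by (simp add: zero_less_mult_iff)
  moreover have "real r - real q \<noteq> 1" using * assms(5) by auto
  ultimately have "r \<ge> 2" by linarith
  then show ?thesis using str[rule_format, of "-2"] by simp
qed

text \<open>The reflected root is the member of the string at position q - r, which lies between -r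
  and q. The roots \<gamma> and -\<gamma>, excluded from \<open>root_string\<close>, have Cartan
  integers 2 and -2.\<close>

lemma reflection_root:
  assumes "\<gamma> \<in> R" "\<delta> \<in> R"
  obtains n :: int where "2 * ip \<delta> \<gamma> = of_int n * ip \<gamma> \<gamma>" "\<delta> - of_int n * \<gamma> \<in> R"
proof (cases "\<delta> = \<gamma> \<or> \<delta> = - \<gamma>")
  case True
  then show ?thesis
  proof
    assume "\<delta> = \<gamma>"
    then show ?thesis using that[of 2] assms minus_R by (simp add: algebra_simps)
  next
    assume "\<delta> = - \<gamma>"
    then show ?thesis using that[of "-2"] assms by (simp add: algebra_simps)
  qed
next
  case False
  with root_string[OF assms(1,2)] obtain r q :: nat where
    *: "2 * ip \<delta> \<gamma> = (real r - real q) * ip \<gamma> \<gamma>"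
    and str: "\<forall>k::int. - int r \<le> k \<longrightarrow> k \<le> int q \<longrightarrow> \<delta> + of_int k * \<gamma> \<in> R" by blast
  show ?thesis
    using that[of "int r - int q"] * str[rule_format, of "int q - int r"] by (simp add: algebra_simps)
qed

text \<open>If neither \<open>\<gamma> + \<delta>\<close> nor \<open>\<gamma> + \<delta>'\<close> were a root or zero, then \<open>\<epsilon> = \<gamma> + \<delta> + \<delta>'\<close> would have
  nonpositive product with \<open>\<delta>\<close> and \<open>\<delta>'\<close>, while its product with \<open>\<delta> + \<delta>'\<close> is positive.\<close>

lemma triple_sum_root:
  assumes "\<gamma> \<in> R" "\<delta> \<in> R" "\<delta>' \<in> R" "\<delta> + \<delta>' \<in> R" "\<gamma> + \<delta> + \<delta>' \<in> R" "\<gamma> + \<delta> \<noteq> 0" "\<gamma> + \<delta>' \<noteq> 0"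
  shows "\<gamma> + \<delta> \<in> R \<or> \<gamma> + \<delta>' \<in> R"
proof (rule ccontr)
  assume no: "\<not> ?thesis"
  define \<epsilon> where "\<epsilon> = \<gamma> + \<delta> + \<delta>'"
  have "\<gamma> \<noteq> - \<delta>" "\<gamma> \<noteq> - \<delta>'" using assms(6,7) by auto
  then have g: "ip \<gamma> \<delta> \<ge> 0" "ip \<gamma> \<delta>' \<ge> 0"
    using sum_root[of \<delta> \<gamma>] sum_root[of \<delta>' \<gamma>] assms(1-3) no by force+
  have "\<epsilon> \<noteq> \<delta>" "\<epsilon> \<noteq> \<delta>'" using assms(6,7) by (auto simp: \<epsilon>_def algebra_simps)
  moreover have "\<epsilon> - \<delta> \<notin> R" "\<epsilon> - \<delta>' \<notin> R" using no by (auto simp: \<epsilon>_def algebra_simps)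
  ultimately have "ip \<epsilon> \<delta> \<le> 0" "ip \<epsilon> \<delta>' \<le> 0"
    using diff_root[of \<delta> \<epsilon>] diff_root[of \<delta>' \<epsilon>] assms(2,3,5) unfolding \<epsilon>_def by force+
  then have "ip \<epsilon> (\<delta> + \<delta>') \<le> 0" by (simp add: ip_add_right)
  moreover have "ip \<epsilon> (\<delta> + \<delta>') = ip \<gamma> \<delta> + ip \<gamma> \<delta>' + ip (\<delta> + \<delta>') (\<delta> + \<delta>')"
    by (simp add: \<epsilon>_def ip_add_left ip_add_right)
  ultimately show False using g ip_root_pos[OF assms(4)] by linarith
qed

definition irreducible :: "'v set \<Rightarrow> bool" where
  "irreducible \<Phi> \<longleftrightarrow> \<Phi> \<noteq> {} \<and> \<not> (\<exists>A B. A \<noteq> {} \<and> B \<noteq> {} \<and> A \<inter> B = {} \<and> \<Phi> = A \<union> B \<and>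
     (\<forall>\<gamma>\<in>A. \<forall>\<delta>\<in>B. ip \<gamma> \<delta> = 0))"

lemma irreducible_subset_split:
  assumes "irreducible \<Phi>" "\<Phi> \<subseteq> \<Psi>" "\<And>\<gamma> \<delta>. \<gamma> \<in> C \<Longrightarrow> \<delta> \<in> \<Psi> - C \<Longrightarrow> ip \<gamma> \<delta> = 0"
  shows "\<Phi> \<subseteq> C \<or> \<Phi> \<inter> C = {}"
proof (rule ccontr)
  assume "\<not> ?thesis"
  then have "\<Phi> \<inter> C \<noteq> {}" "\<Phi> - C \<noteq> {}" "(\<Phi> \<inter> C) \<inter> (\<Phi> - C) = {}" "\<Phi> = (\<Phi> \<inter> C) \<union> (\<Phi> - C)"
    by auto
  moreover have "\<forall>\<gamma>\<in>\<Phi> \<inter> C. \<forall>\<delta>\<in>\<Phi> - C. ip \<gamma> \<delta> = 0" using assms(2,3) by blast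
  ultimately show False using assms(1) unfolding irreducible_def by metis
qed

end

locale positive_roots = root_system R ip
  for R :: "'v::comm_ring_1 set" and ip +
  fixes P :: "'v set"
  assumes P_subset: "P \<subseteq> R"
    and P_asym: "\<gamma> \<in> P \<Longrightarrow> - \<gamma> \<notin> P"
    and P_total: "\<gamma> \<in> R \<Longrightarrow> \<gamma> \<in> P \<or> - \<gamma> \<in> P"
    and P_closed: "\<gamma> \<in> P \<Longrightarrow> \<delta> \<in> P \<Longrightarrow> \<gamma> + \<delta> \<in> R \<Longrightarrow> \<gamma> + \<delta> \<in> P"
begin

lemma finite_P: "finite P"
  using P_subset finite_R finite_subset by blast

text \<open>This stands in for a linear functional that is positive on \<open>P\<close>. In a
  vanishing sum the first member x has negative product with some other member y; then x + y is a
  positive root, and replacing both by it gives a shorter list with the same sum.\<close>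

lemma sum_list_pos_nonzero: "xs \<noteq> [] \<Longrightarrow> set xs \<subseteq> P \<Longrightarrow> sum_list xs \<noteq> 0"
proof (induction "length xs" arbitrary: xs rule: less_induct)
  case less
  then obtain x ys where xs: "xs = x # ys" by (cases xs) auto
  have x: "x \<in> P" "x \<in> R" using less.prems xs P_subset by auto
  show ?case
  proof
    assume z: "sum_list xs = 0"
    have ip_list: "ip x (sum_list zs) = (\<Sum>z\<leftarrow>zs. ip x z)" for zs
      by (induction zs) (auto simp: ip_add_right)
    have "ip x x + (\<Sum>z\<leftarrow>ys. ip x z) = 0"
      using z ip_list[of xs] xs by simp
    then have neg: "(\<Sum>z\<leftarrow>ys. ip x z) < 0" using ip_root_pos[OF x(2)] by linarith
    have "\<exists>y\<in>set ys. ip x y < 0"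
    proof (rule ccontr)
      assume "\<not> ?thesis"
      then have "(\<Sum>z\<leftarrow>ys. ip x z) \<ge> 0" by (intro sum_list_nonneg) auto
      then show False using neg by simp
    qed
    then obtain y where y: "y \<in> set ys" "ip x y < 0" by blast
    have yP: "y \<in> P" "y \<in> R" using y xs less.prems P_subset by auto
    have "x \<noteq> - y" using P_asym yP x by blast
    then have xy: "x + y \<in> P" using sum_root[of y x] x yP y P_closed by blast
    let ?zs = "(x + y) # remove1 y ys"
    have "length ?zs < length xs" using y(1) xs by (simp add: length_remove1) (metis length_pos_if_in_set Suc_pred lessI)
    moreover have "set ?zs \<subseteq> P" using xy less.prems xs set_remove1_subset[of y ys] by auto
    ultimately have "sum_list ?zs \<noteq> 0" using less.hyps by blast
    moreover have "sum_list ?zs = sum_list xs"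
      using y(1) xs sum_list_map_remove1[of y ys "\<lambda>x. x"] by (simp add: algebra_simps)
    ultimately show False using z by simp
  qed
qed

lemma cone_add_root_nonzero:
  assumes "x \<in> cone P" "\<gamma> \<in> P" shows "x + \<gamma> \<noteq> 0"
proof -
  obtain xs where "x = sum_list xs" "set xs \<subseteq> P" using assms(1) unfolding cone_def by blast
  then show ?thesis using sum_list_pos_nonzero[of "\<gamma> # xs"] assms(2) by (simp add: add.commute)
qed

lemma cone_antisym:
  assumes "x \<in> cone P" "- x \<in> cone P" shows "x = 0"
proof -
  obtain xs where xs: "x = sum_list xs" "set xs \<subseteq> P" using assms(1) unfolding cone_def by blast
  obtain ys where ys: "- x = sum_list ys" "set ys \<subseteq> P" using assms(2) unfolding cone_def by blast
  have "sum_list (xs @ ys) = x + - x" using xs ys by simp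
  then have "xs @ ys = []" using sum_list_pos_nonzero[of "xs @ ys"] xs ys by auto
  then show ?thesis using xs by simp
qed

lemma neg_notin_cone: "\<gamma> \<in> P \<Longrightarrow> - \<gamma> \<notin> cone P"
  using cone_add_root_nonzero by force

section \<open>Simple roots, coefficients and supports\<close>

definition simple :: "'v set" where
  "simple = {\<alpha> \<in> P. \<not> (\<exists>\<gamma>\<in>P. \<exists>\<delta>\<in>P. \<alpha> = \<gamma> + \<delta>)}"

lemma simple_subset: "simple \<subseteq> P" unfolding simple_def by blast

lemma finite_simple: "finite simple"
  using simple_subset finite_P finite_subset by blast

text \<open>The height of a root is not yet available, as it needs the coefficients; the measure is
  the number of positive roots below \<gamma> in the order given by the cone.\<close>

lemma positive_induct [consumes 1, case_names simple sum]:
  assumes "\<gamma> \<in> P"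
    and "\<And>\<alpha>. \<alpha> \<in> simple \<Longrightarrow> Pr \<alpha>"
    and "\<And>\<gamma> \<delta>. \<gamma> \<in> P \<Longrightarrow> \<delta> \<in> P \<Longrightarrow> \<gamma> + \<delta> \<in> P \<Longrightarrow> Pr \<gamma> \<Longrightarrow> Pr \<delta> \<Longrightarrow> Pr (\<gamma> + \<delta>)"
  shows "Pr \<gamma>"
  using assms(1)
proof (induction "card {\<delta>\<in>P. \<gamma> - \<delta> \<in> cone P}" arbitrary: \<gamma> rule: less_induct)
  case less
  show ?case
  proof (cases "\<gamma> \<in> simple")
    case False
    then obtain \<gamma>1 \<gamma>2 where d: "\<gamma>1 \<in> P" "\<gamma>2 \<in> P" "\<gamma> = \<gamma>1 + \<gamma>2"
      using less.prems unfolding simple_def by blast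
    have smaller: "card {\<delta>\<in>P. x - \<delta> \<in> cone P} < card {\<delta>\<in>P. \<gamma> - \<delta> \<in> cone P}"
      if "y \<in> P" "\<gamma> = x + y" for x y
    proof (rule psubset_card_mono)
      show "finite {\<delta>\<in>P. \<gamma> - \<delta> \<in> cone P}" using finite_P by simp
      have sub: "\<gamma> - \<delta> \<in> cone P" if "x - \<delta> \<in> cone P" for \<delta>
        using cone_add[OF that cone_base[OF \<open>y \<in> P\<close>]] \<open>\<gamma> = x + y\<close> by (simp add: algebra_simps)
      \<comment> \<open>Strictness comes from \<gamma> itself, which is below \<gamma> but not below
        a proper summand of \<gamma>.\<close>
      have "x - \<gamma> \<notin> cone P" using neg_notin_cone[OF that(1)] that(2) by simp
      moreover have "\<gamma> - \<gamma> \<in> cone P" by (simp add: cone_zero)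
      ultimately show "{\<delta>\<in>P. x - \<delta> \<in> cone P} \<subset> {\<delta>\<in>P. \<gamma> - \<delta> \<in> cone P}"
        using sub less.prems by blast
    qed
    have "Pr \<gamma>1" "Pr \<gamma>2"
      using less.hyps[OF smaller[of \<gamma>2 \<gamma>1] d(1)] less.hyps[OF smaller[of \<gamma>1 \<gamma>2] d(2)] d
      by (auto simp: algebra_simps)
    then show ?thesis using assms(3) d less.prems by blast
  qed (use assms(2) in blast)
qed

lemma simple_ip_nonpos:
  assumes "\<alpha> \<in> simple" "\<beta> \<in> simple" "\<alpha> \<noteq> \<beta>"
  shows "ip \<alpha> \<beta> \<le> 0"
proof (rule ccontr)
  assume "\<not> ?thesis"
  moreover have P: "\<alpha> \<in> P" "\<beta> \<in> P" using assms simple_subset by auto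
  ultimately have "\<alpha> - \<beta> \<in> R" using diff_root[of \<beta> \<alpha>] assms(3) P_subset by auto
  then consider "\<alpha> - \<beta> \<in> P" | "\<beta> - \<alpha> \<in> P" using P_total by fastforce
  then show False
  proof cases
    case 1
    then have "\<exists>\<gamma>\<in>P. \<exists>\<delta>\<in>P. \<alpha> = \<gamma> + \<delta>" using P by (intro bexI[of _ "\<alpha> - \<beta>"] bexI[of _ \<beta>]) auto
    then show ?thesis using assms(1) unfolding simple_def by blast
  next
    case 2
    then have "\<exists>\<gamma>\<in>P. \<exists>\<delta>\<in>P. \<beta> = \<gamma> + \<delta>" using P by (intro bexI[of _ "\<beta> - \<alpha>"] bexI[of _ \<alpha>]) auto
    then show ?thesis using assms(2) unfolding simple_def by blast
  qed
qed

text \<open>Splitting off one copy of \<beta> leaves an element of the cone, and an element of the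
  cone plus a positive root is never zero.\<close>

lemma simple_combination_nonneg_zero:
  assumes "(\<Sum>\<alpha>\<in>simple. of_int (c \<alpha>) * \<alpha>) = 0" "\<And>\<alpha>. \<alpha> \<in> simple \<Longrightarrow> c \<alpha> \<ge> 0" "\<beta> \<in> simple"
  shows "c \<beta> = 0"
proof (rule ccontr)
  assume "c \<beta> \<noteq> 0"
  then have pos: "c \<beta> \<ge> 1" using assms(2,3) by force
  have cone: "of_int n * \<alpha> \<in> cone P" if "n \<ge> 0" "\<alpha> \<in> simple" for n :: int and \<alpha>
  proof -
    have "of_nat (nat n) * \<alpha> \<in> cone P" using that simple_subset cone_base by (intro cone_of_nat) auto
    moreover have "(of_nat (nat n) :: 'v) = of_int n" using that(1) by simp
    ultimately show ?thesis by simp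
  qed
  have "(\<Sum>\<alpha>\<in>simple. of_int (c \<alpha>) * \<alpha>) =
      of_int (c \<beta>) * \<beta> + (\<Sum>\<alpha>\<in>simple - {\<beta>}. of_int (c \<alpha>) * \<alpha>)"
    using finite_simple assms(3) by (simp add: sum.remove)
  also have "\<dots> = (of_int (c \<beta> - 1) * \<beta> + (\<Sum>\<alpha>\<in>simple - {\<beta>}. of_int (c \<alpha>) * \<alpha>)) + \<beta>"
    by (simp add: algebra_simps)
  also have "\<dots> \<noteq> 0"
    using pos assms(2,3) simple_subset
    by (intro cone_add_root_nonzero cone_add cone_sum cone) auto
  finally show False using assms(1) by simp
qed

text \<open>Splitting a relation between simple roots into its positive and negative parts gives a vector
  with nonpositive square.\<close>

lemma simple_independent:
  assumes "(\<Sum>\<alpha>\<in>simple. of_int (c \<alpha>) * \<alpha>) = 0" "\<beta> \<in> simple"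
  shows "c \<beta> = 0"
proof -
  define a b where "a \<alpha> = max 0 (c \<alpha>)" and "b \<alpha> = max 0 (- c \<alpha>)" for \<alpha>
  define v where "v = (\<Sum>\<alpha>\<in>simple. of_int (a \<alpha>) * \<alpha>)"
  have c: "c \<alpha> = a \<alpha> - b \<alpha>" and ab: "a \<alpha> \<ge> 0" "b \<alpha> \<ge> 0" "a \<alpha> * b \<alpha> = 0" for \<alpha>
    by (auto simp: a_def b_def)
  have "v - (\<Sum>\<alpha>\<in>simple. of_int (b \<alpha>) * \<alpha>) = (\<Sum>\<alpha>\<in>simple. of_int (c \<alpha>) * \<alpha>)"
    by (simp add: v_def c sum_subtractf algebra_simps)
  then have v: "v = (\<Sum>\<alpha>\<in>simple. of_int (b \<alpha>) * \<alpha>)" using assms(1) by simp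
  have "ip v v = ip (\<Sum>\<alpha>\<in>simple. of_int (a \<alpha>) * \<alpha>) (\<Sum>\<alpha>\<in>simple. of_int (b \<alpha>) * \<alpha>)"
    using v by (simp add: v_def)
  also have "\<dots> = (\<Sum>\<alpha>\<in>simple. \<Sum>\<alpha>'\<in>simple. of_int (a \<alpha> * b \<alpha>') * ip \<alpha> \<alpha>')"
    unfolding ip_sum_left ip_of_int_left unfolding ip_sum_right ip_of_int_right
    by (simp add: sum_distrib_left mult.assoc)
  also have "\<dots> \<le> 0"
  proof (intro sum_nonpos)
    fix \<alpha> \<alpha>' assume "\<alpha> \<in> simple" "\<alpha>' \<in> simple"
    then show "of_int (a \<alpha> * b \<alpha>') * ip \<alpha> \<alpha>' \<le> 0"
    proof (cases "\<alpha> = \<alpha>'")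
      case True
      then show ?thesis using ab(3)[of \<alpha>] by (simp only: of_int_0 mult_zero_left order_refl)
    next
      case False
      then show ?thesis
        using simple_ip_nonpos[of \<alpha> \<alpha>'] \<open>\<alpha> \<in> simple\<close> \<open>\<alpha>' \<in> simple\<close> ab by (intro mult_nonneg_nonpos) auto
    qed
  qed
  finally have "v = 0"
    using pos_def_subset[of simple a] simple_subset P_subset unfolding v_def by blast
  then have "a \<beta> = 0" "b \<beta> = 0"
    using simple_combination_nonneg_zero[of a \<beta>] simple_combination_nonneg_zero[of b \<beta>] v ab assms(2)
    by (auto simp: v_def)
  then show ?thesis using c by simp
qed

text \<open>The value 0 outside \<open>simple\<close> makes the coefficient function unique as a
  function on the whole type, in agreement with \<open>root_coeffs\<close>.\<close>

definition coef :: "'v \<Rightarrow> 'v \<Rightarrow> int" where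
  "coef x = (THE c. (\<forall>\<alpha>. \<alpha> \<notin> simple \<longrightarrow> c \<alpha> = 0) \<and> x = (\<Sum>\<alpha>\<in>simple. of_int (c \<alpha>) * \<alpha>))"

definition lattice :: "'v set" where
  "lattice = {x. \<exists>c :: 'v \<Rightarrow> int. x = (\<Sum>\<alpha>\<in>simple. of_int (c \<alpha>) * \<alpha>)}"

lemma coef_eqI:
  assumes "x = (\<Sum>\<alpha>\<in>simple. of_int (c \<alpha>) * \<alpha>)" "\<alpha> \<in> simple"
  shows "coef x \<alpha> = c \<alpha>"
proof -
  let ?c = "\<lambda>\<alpha>. if \<alpha> \<in> simple then c \<alpha> else 0"
  have "coef x = ?c"
    unfolding coef_def
  proof (rule the_equality)
    show "(\<forall>\<alpha>. \<alpha> \<notin> simple \<longrightarrow> ?c \<alpha> = 0) \<and> x = (\<Sum>\<alpha>\<in>simple. of_int (?c \<alpha>) * \<alpha>)"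
      using assms(1) by (auto intro: sum.cong)
  next
    fix c' assume c': "(\<forall>\<alpha>. \<alpha> \<notin> simple \<longrightarrow> c' \<alpha> = 0) \<and> x = (\<Sum>\<alpha>\<in>simple. of_int (c' \<alpha>) * \<alpha>)"
    have "(\<Sum>\<alpha>\<in>simple. of_int (c' \<alpha> - c \<alpha>) * \<alpha>) = x - x"
      using assms(1) c' by (simp add: sum_subtractf left_diff_distrib)
    then have "c' \<alpha> - c \<alpha> = 0" if "\<alpha> \<in> simple" for \<alpha>
      using simple_independent[of "\<lambda>\<alpha>. c' \<alpha> - c \<alpha>"] that by simp
    then show "c' = ?c" using c' by auto
  qed
  then show ?thesis using assms(2) by simp
qed

lemma lattice_expand: "x \<in> lattice \<Longrightarrow> x = (\<Sum>\<alpha>\<in>simple. of_int (coef x \<alpha>) * \<alpha>)"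
proof -
  assume "x \<in> lattice"
  then obtain c where c: "x = (\<Sum>\<alpha>\<in>simple. of_int (c \<alpha>) * \<alpha>)" unfolding lattice_def by blast
  then show ?thesis using coef_eqI[OF c] by (metis (mono_tags, lifting) sum.cong)
qed

lemma
  assumes "x \<in> lattice" "y \<in> lattice"
  shows lattice_add: "x + y \<in> lattice"
    and coef_add: "\<alpha> \<in> simple \<Longrightarrow> coef (x + y) \<alpha> = coef x \<alpha> + coef y \<alpha>"
proof -
  have *: "x + y = (\<Sum>\<alpha>\<in>simple. of_int (coef x \<alpha> + coef y \<alpha>) * \<alpha>)"
    using lattice_expand[OF assms(1)] lattice_expand[OF assms(2)] by (simp add: distrib_right sum.distrib)
  show "x + y \<in> lattice" using * unfolding lattice_def
    by (intro CollectI exI[of _ "\<lambda>\<alpha>. coef x \<alpha> + coef y \<alpha>"])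
  show "\<alpha> \<in> simple \<Longrightarrow> coef (x + y) \<alpha> = coef x \<alpha> + coef y \<alpha>" using coef_eqI[OF *] .
qed

lemma
  assumes "x \<in> lattice"
  shows lattice_scale: "of_int n * x \<in> lattice"
    and coef_scale: "\<alpha> \<in> simple \<Longrightarrow> coef (of_int n * x) \<alpha> = n * coef x \<alpha>"
proof -
  have *: "of_int n * x = (\<Sum>\<alpha>\<in>simple. of_int (n * coef x \<alpha>) * \<alpha>)"
    by (subst lattice_expand[OF assms]) (simp add: sum_distrib_left mult.assoc)
  show "of_int n * x \<in> lattice" using * unfolding lattice_def
    by (intro CollectI exI[of _ "\<lambda>\<alpha>. n * coef x \<alpha>"])
  show "\<alpha> \<in> simple \<Longrightarrow> coef (of_int n * x) \<alpha> = n * coef x \<alpha>" using coef_eqI[OF *] .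
qed

lemma lattice_zero: "0 \<in> lattice"
  unfolding lattice_def by (intro CollectI exI[of _ "\<lambda>_. 0"]) simp

lemma coef_zero: "\<alpha> \<in> simple \<Longrightarrow> coef 0 \<alpha> = 0"
  by (rule coef_eqI[of _ "\<lambda>_. 0"]) auto

lemma lattice_minus: "x \<in> lattice \<Longrightarrow> - x \<in> lattice"
  using lattice_scale[of x "-1"] by simp

lemma coef_minus: "x \<in> lattice \<Longrightarrow> \<alpha> \<in> simple \<Longrightarrow> coef (- x) \<alpha> = - coef x \<alpha>"
  using coef_scale[of x \<alpha> "-1"] by simp

lemma
  assumes "\<alpha> \<in> simple"
  shows simple_lattice: "\<alpha> \<in> lattice"
    and coef_simple: "\<beta> \<in> simple \<Longrightarrow> coef \<alpha> \<beta> = (if \<beta> = \<alpha> then 1 else 0)"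
proof -
  have *: "\<alpha> = (\<Sum>\<beta>\<in>simple. of_int (if \<beta> = \<alpha> then 1 else 0) * \<beta>)"
    using assms finite_simple by (subst sum.remove[of _ \<alpha>]) auto
  show "\<alpha> \<in> lattice" using * unfolding lattice_def
    by (intro CollectI exI[of _ "\<lambda>\<beta>. if \<beta> = \<alpha> then 1 else 0"])
  show "\<beta> \<in> simple \<Longrightarrow> coef \<alpha> \<beta> = (if \<beta> = \<alpha> then 1 else 0)" using coef_eqI[OF *] .
qed

lemma cone_lattice: "x \<in> cone P \<Longrightarrow> x \<in> lattice \<and> (\<forall>\<alpha>\<in>simple. coef x \<alpha> \<ge> 0)"
proof (induction rule: cone_induct)
  case zero
  then show ?case by (simp add: lattice_zero coef_zero)
next
  case (add x q)
  have "q \<in> lattice \<and> (\<forall>\<alpha>\<in>simple. coef q \<alpha> \<ge> 0)"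
    using add.hyps(2)
    by (induction rule: positive_induct) (auto simp: coef_add simple_lattice coef_simple lattice_add)
  then show ?case using add.IH by (auto simp: coef_add lattice_add)
qed

lemma positive_lattice: "\<gamma> \<in> P \<Longrightarrow> \<gamma> \<in> lattice"
  and coef_nonneg: "\<gamma> \<in> P \<Longrightarrow> \<alpha> \<in> simple \<Longrightarrow> coef \<gamma> \<alpha> \<ge> 0"
  using cone_lattice[OF cone_base] by auto

lemma root_lattice: "\<gamma> \<in> R \<Longrightarrow> \<gamma> \<in> lattice"
  using P_total positive_lattice lattice_minus by fastforce

lemma lattice_coef_zero: "x \<in> lattice \<Longrightarrow> (\<And>\<alpha>. \<alpha> \<in> simple \<Longrightarrow> coef x \<alpha> = 0) \<Longrightarrow> x = 0"
  using lattice_expand[of x] by simp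

lemma ip_lattice_left: "x \<in> lattice \<Longrightarrow> ip x y = (\<Sum>\<alpha>\<in>simple. of_int (coef x \<alpha>) * ip \<alpha> y)"
  by (subst lattice_expand[of x]) (auto simp: ip_sum_left ip_of_int_left)

lemma ip_lattice_right: "x \<in> lattice \<Longrightarrow> ip y x = (\<Sum>\<alpha>\<in>simple. of_int (coef x \<alpha>) * ip y \<alpha>)"
  using ip_lattice_left[of x y] by (simp add: ip_sym[of y])

lemma orthogonal_supports_ip:
  assumes S: "simple = S1 \<union> S2" and orth: "\<And>\<alpha> \<beta>. \<alpha> \<in> S1 \<Longrightarrow> \<beta> \<in> S2 \<Longrightarrow> ip \<alpha> \<beta> = 0"
    and x: "x \<in> lattice" "\<forall>\<alpha>\<in>S2. coef x \<alpha> = 0" and y: "y \<in> lattice" "\<forall>\<alpha>\<in>S1. coef y \<alpha> = 0"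
  shows "ip x y = 0"
proof -
  have "of_int (coef x \<alpha>) * ip \<alpha> y = 0" if a: "\<alpha> \<in> simple" for \<alpha>
  proof (cases "coef x \<alpha> = 0")
    case False
    then have "\<alpha> \<in> S1" using S x(2) a by blast
    then have "of_int (coef y \<beta>) * ip \<alpha> \<beta> = 0" if "\<beta> \<in> simple" for \<beta>
      using S orth y(2) that by auto
    then show ?thesis by (subst ip_lattice_right[OF y(1)]) (simp add: sum.neutral)
  qed simp
  then show ?thesis by (subst ip_lattice_left[OF x(1)]) (simp add: sum.neutral)
qed

text \<open>The support of a positive root does not meet two orthogonal sets of simple roots. If x
  and y are supported on different sides and x + y is a root, then the Cartan integer of x + y along
  y is 2, so x - y is a root as well; but its coefficients have both signs.\<close>

lemma orthogonal_supports:
  assumes S: "simple = S1 \<union> S2" and orth: "\<And>\<alpha> \<beta>. \<alpha> \<in> S1 \<Longrightarrow> \<beta> \<in> S2 \<Longrightarrow> ip \<alpha> \<beta> = 0"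
    and disj: "S1 \<inter> S2 = {}" and "\<gamma> \<in> P"
  shows "(\<forall>\<alpha>\<in>S2. coef \<gamma> \<alpha> = 0) \<or> (\<forall>\<alpha>\<in>S1. coef \<gamma> \<alpha> = 0)"
  using \<open>\<gamma> \<in> P\<close>
proof (induction rule: positive_induct)
  case (simple \<alpha>)
  then show ?case using S disj by (auto simp: coef_simple)
next
  case (sum \<gamma> \<delta>)
  have mixed: False if xP: "x \<in> P" and yP: "y \<in> P" and xy: "x + y \<in> P"
    and x: "\<forall>\<alpha>\<in>S2. coef x \<alpha> = 0" and y: "\<forall>\<alpha>\<in>S1. coef y \<alpha> = 0" for x y
  proof -
    have 0: "ip x y = 0"
      using orthogonal_supports_ip[OF S orth] positive_lattice xP yP x y by blast
    have yy: "ip y y > 0" and xx: "ip x x > 0" using ip_root_pos xP yP P_subset by auto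
    have "x + y - 2 * y \<in> R"
    proof (rule double_diff_root)
      show "x + y \<noteq> y" using xP zero_notin_R P_subset by auto
    qed (use 0 yy xP yP xy P_subset in \<open>auto simp: ip_add_left\<close>)
    then have xmy: "x - y \<in> R" by (simp add: algebra_simps)
    have l: "x \<in> lattice" "y \<in> lattice" "- y \<in> lattice" using positive_lattice xP yP lattice_minus by auto
    have c: "coef (x - y) \<alpha> = coef x \<alpha> - coef y \<alpha>" if "\<alpha> \<in> simple" for \<alpha>
      using coef_add[OF l(1) l(3) that] coef_minus[OF l(2) that] by simp
    from P_total[OF xmy] show False
    proof
      assume *: "x - y \<in> P"
      have "coef y \<alpha> = 0" if "\<alpha> \<in> simple" for \<alpha>
        using coef_nonneg[OF * that] coef_nonneg[OF yP that] c[OF that] S x y that by force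
      then have "y = 0" using lattice_coef_zero l by blast
      then show False using yy by simp
    next
      assume *: "- (x - y) \<in> P"
      have "coef x \<alpha> = 0" if "\<alpha> \<in> simple" for \<alpha>
        using coef_nonneg[OF * that] coef_nonneg[OF xP that] c[OF that] coef_minus[OF root_lattice[OF xmy] that]
          S x y that by force
      then have "x = 0" using lattice_coef_zero l by blast
      then show False using xx by simp
    qed
  qed
  have "\<And>\<alpha>. \<alpha> \<in> simple \<Longrightarrow> coef (\<gamma> + \<delta>) \<alpha> = coef \<gamma> \<alpha> + coef \<delta> \<alpha>"
    using coef_add positive_lattice sum.hyps by blast
  then show ?case
    using sum.IH mixed[of \<gamma> \<delta>] mixed[of \<delta> \<gamma>] sum.hyps S by (auto simp: add.commute)
qed

text \<open>For a simple \<delta> missing from the support of \<beta>, the product of \<beta> with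
  \<delta> is a sum of nonpositive terms and yet nonnegative, so every term vanishes. The support is
  therefore orthogonal to its complement, and the two sides split \<open>R\<close>.\<close>

lemma dominant_full_support:
  assumes "irreducible R" "\<beta> \<in> P" "\<And>\<alpha>. \<alpha> \<in> simple \<Longrightarrow> ip \<beta> \<alpha> \<ge> 0" "\<alpha> \<in> simple"
  shows "coef \<beta> \<alpha> > 0"
proof (rule ccontr)
  assume n: "\<not> coef \<beta> \<alpha> > 0"
  define S1 where "S1 = {\<alpha>\<in>simple. coef \<beta> \<alpha> > 0}"
  define S2 where "S2 = {\<alpha>\<in>simple. coef \<beta> \<alpha> = 0}"
  have S: "simple = S1 \<union> S2" "S1 \<inter> S2 = {}"
    using coef_nonneg[OF assms(2)] unfolding S1_def S2_def by force+
  have orth: "ip \<gamma> \<delta> = 0" if g: "\<gamma> \<in> S1" and d: "\<delta> \<in> S2" for \<gamma> \<delta>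
  proof -
    have le: "of_int (coef \<beta> x) * ip x \<delta> \<le> 0" if "x \<in> simple" for x
    proof (cases "x = \<delta>")
      case True
      then show ?thesis using d by (simp add: S2_def)
    next
      case False
      have "\<delta> \<in> simple" using d by (simp add: S2_def)
      then show ?thesis
        using simple_ip_nonpos[OF that _ False] coef_nonneg[OF assms(2) that]
        by (intro mult_nonneg_nonpos) auto
    qed
    have "(\<Sum>x\<in>simple. of_int (coef \<beta> x) * ip x \<delta>) \<ge> 0"
      using assms(3)[of \<delta>] d ip_lattice_left[OF positive_lattice[OF assms(2)]] by (auto simp: S2_def)
    then have "(\<Sum>x\<in>simple. of_int (coef \<beta> x) * ip x \<delta>) = 0"
      using le sum_nonpos[of simple "\<lambda>x. of_int (coef \<beta> x) * ip x \<delta>"] by force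
    then have "\<forall>x\<in>simple. - (of_int (coef \<beta> x) * ip x \<delta>) = 0"
      using le finite_simple by (subst sum_nonneg_eq_0_iff[symmetric]) (auto simp: sum_negf)
    then show ?thesis using g by (auto simp: S1_def)
  qed
  define A where "A = {\<gamma>\<in>R. \<forall>\<alpha>\<in>S2. coef \<gamma> \<alpha> = 0}"
  define B where "B = {\<gamma>\<in>R. \<forall>\<alpha>\<in>S1. coef \<gamma> \<alpha> = 0}"
  have "\<gamma> \<in> A \<union> B" if "\<gamma> \<in> R" for \<gamma>
  proof -
    from P_total[OF that] have "(\<forall>\<alpha>\<in>S2. coef \<gamma> \<alpha> = 0) \<or> (\<forall>\<alpha>\<in>S1. coef \<gamma> \<alpha> = 0)"
    proof
      assume "\<gamma> \<in> P" then show ?thesis using orthogonal_supports[OF S(1) orth S(2)] by blast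
    next
      assume *: "- \<gamma> \<in> P"
      have "coef (- \<gamma>) \<alpha> = - coef \<gamma> \<alpha>" if "\<alpha> \<in> simple" for \<alpha>
        using coef_minus root_lattice that \<open>\<gamma> \<in> R\<close> by blast
      then show ?thesis using orthogonal_supports[OF S(1) orth S(2) *] S by force
    qed
    then show ?thesis using that unfolding A_def B_def by blast
  qed
  then have RAB: "R = A \<union> B" unfolding A_def B_def by auto
  have "\<gamma> \<notin> B" if "\<gamma> \<in> A" for \<gamma>
  proof
    assume "\<gamma> \<in> B"
    then have "\<gamma> = 0" using that S unfolding A_def B_def by (intro lattice_coef_zero root_lattice) auto
    then show False using that zero_notin_R unfolding A_def by simp
  qed
  then have AB: "A \<inter> B = {}" by blast
  have "\<beta> \<in> A" using assms(2) P_subset unfolding A_def S2_def by auto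
  moreover have "\<alpha> \<in> S2" using n assms(4) coef_nonneg[OF assms(2,4)] unfolding S2_def by auto
  then have "\<alpha> \<in> B" using simple_subset P_subset S assms(4) unfolding B_def by (auto simp: coef_simple)
  moreover have "ip \<gamma> \<delta> = 0" if "\<gamma> \<in> A" "\<delta> \<in> B" for \<gamma> \<delta>
  proof -
    have "\<gamma> \<in> lattice" "\<delta> \<in> lattice" using that root_lattice unfolding A_def B_def by auto
    then show ?thesis
      using orthogonal_supports_ip[OF S(1) orth] that unfolding A_def B_def by blast
  qed
  ultimately show False using assms(1) RAB AB unfolding irreducible_def by blast
qed

section \<open>Maximal roots and the highest root\<close>

definition maximal_root :: "'v \<Rightarrow> bool" where
  "maximal_root \<beta> \<longleftrightarrow> \<beta> \<in> P \<and> (\<forall>\<delta>\<in>P. \<beta> + \<delta> \<notin> R)"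

lemma maximal_root_ip_nonneg:
  assumes "maximal_root \<beta>" "\<delta> \<in> P" shows "ip \<beta> \<delta> \<ge> 0"
proof (rule ccontr)
  assume "\<not> ?thesis"
  moreover have "\<beta> \<noteq> - \<delta>" using assms P_asym unfolding maximal_root_def by blast
  ultimately have "\<beta> + \<delta> \<in> R"
    using sum_root[of \<delta> \<beta>] assms P_subset unfolding maximal_root_def by auto
  then show False using assms unfolding maximal_root_def by blast
qed

text \<open>Maximal roots are dominant with full support. If two of them were orthogonal, one would
  be orthogonal to all simple roots and so to itself. Hence their product is positive and their
  difference is a root, which added to one of them yields the other, against maximality.\<close>

lemma maximal_root_unique:
  assumes "irreducible R" "maximal_root \<beta>" "maximal_root \<beta>'"
  shows "\<beta> = \<beta>'"
proof (rule ccontr)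
  assume ne: "\<beta> \<noteq> \<beta>'"
  have P: "\<beta> \<in> P" "\<beta>' \<in> P" using assms unfolding maximal_root_def by auto
  have nn: "of_int (coef \<beta> \<alpha>) * ip \<alpha> \<beta>' \<ge> 0" if "\<alpha> \<in> simple" for \<alpha>
    using coef_nonneg[OF P(1) that] maximal_root_ip_nonneg[OF assms(3)] that simple_subset ip_sym
    by (intro mult_nonneg_nonneg) (auto simp: ip_sym)
  have "ip \<beta> \<beta>' \<noteq> 0"
  proof
    assume "ip \<beta> \<beta>' = 0"
    then have "\<forall>\<alpha>\<in>simple. of_int (coef \<beta> \<alpha>) * ip \<alpha> \<beta>' = 0"
      using nn finite_simple ip_lattice_left[OF positive_lattice[OF P(1)], of \<beta>']
      by (subst sum_nonneg_eq_0_iff[symmetric]) auto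
    moreover have "coef \<beta> \<alpha> > 0" if "\<alpha> \<in> simple" for \<alpha>
      using dominant_full_support[OF assms(1) P(1) _ that] maximal_root_ip_nonneg[OF assms(2)] simple_subset
      by blast
    ultimately have "ip \<alpha> \<beta>' = 0" if "\<alpha> \<in> simple" for \<alpha> using that by force
    then have "ip \<beta>' \<beta>' = 0" using ip_lattice_left[OF positive_lattice[OF P(2)], of \<beta>'] by simp
    then show False using ip_root_pos[of \<beta>'] P P_subset by auto
  qed
  then have "ip \<beta> \<beta>' > 0" using maximal_root_ip_nonneg[OF assms(2) P(2)] by simp
  then have "\<beta> - \<beta>' \<in> R" using diff_root[of \<beta>' \<beta>] P P_subset ne by auto
  then consider "\<beta> - \<beta>' \<in> P" | "\<beta>' - \<beta> \<in> P" using P_total by fastforce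
  then show False
  proof cases
    case 1
    then have "\<beta>' + (\<beta> - \<beta>') \<notin> R" using assms(3) unfolding maximal_root_def by blast
    then show ?thesis using P P_subset by auto
  next
    case 2
    then have "\<beta> + (\<beta>' - \<beta>) \<notin> R" using assms(2) unfolding maximal_root_def by blast
    then show ?thesis using P P_subset by auto
  qed
qed

lemma exists_maximal_above:
  assumes "\<gamma> \<in> P" shows "\<exists>\<beta>. maximal_root \<beta> \<and> \<beta> - \<gamma> \<in> cone P"
  using assms
proof (induction "card {\<delta>\<in>P. \<delta> - \<gamma> \<in> cone P}" arbitrary: \<gamma> rule: less_induct)
  case less
  show ?case
  proof (cases "maximal_root \<gamma>")
    case True
    then show ?thesis by (intro exI[of _ \<gamma>]) (simp add: cone_zero)
  next
    case False
    then obtain \<delta> where d: "\<delta> \<in> P" "\<gamma> + \<delta> \<in> P" using less.prems P_closed unfolding maximal_root_def by blast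
    have up: "x - \<gamma> \<in> cone P" if "x - (\<gamma> + \<delta>) \<in> cone P" for x
      using cone_add[OF that cone_base[OF d(1)]] by simp
    have "\<gamma> - (\<gamma> + \<delta>) \<notin> cone P" using neg_notin_cone[OF d(1)] by simp
    then have "{x\<in>P. x - (\<gamma> + \<delta>) \<in> cone P} \<subset> {x\<in>P. x - \<gamma> \<in> cone P}"
      using up less.prems cone_zero[of P] diff_self[of \<gamma>] by (intro psubsetI) (blast, metis (mono_tags, lifting) mem_Collect_eq)
    then have "card {x\<in>P. x - (\<gamma> + \<delta>) \<in> cone P} < card {x\<in>P. x - \<gamma> \<in> cone P}"
      using finite_P by (intro psubset_card_mono) auto
    from less.hyps[OF this d(2)] show ?thesis using up by blast
  qed
qed

definition is_highest :: "'v \<Rightarrow> bool" where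
  "is_highest \<beta> \<longleftrightarrow> \<beta> \<in> R \<and> (\<forall>\<gamma>\<in>R. \<beta> - \<gamma> \<in> cone P)"

lemma is_highest_unique: "is_highest \<beta> \<Longrightarrow> is_highest \<beta>' \<Longrightarrow> \<beta> = \<beta>'"
  unfolding is_highest_def using cone_antisym[of "\<beta> - \<beta>'"] by auto

lemma is_highest_maximal:
  assumes "is_highest \<beta>" shows "maximal_root \<beta>"
  unfolding maximal_root_def
proof (intro conjI ballI notI)
  have R: "\<beta> \<in> R" using assms unfolding is_highest_def by blast
  show "\<beta> \<in> P"
  proof (rule ccontr)
    assume n: "\<beta> \<notin> P"
    then have m: "- \<beta> \<in> P" using P_total[OF R] by blast
    have "\<beta> - (- \<beta>) \<in> cone P" using assms m P_subset unfolding is_highest_def by blast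
    then show False using cone_add_root_nonzero[OF cone_add[OF _ cone_base[OF m]] m, of "\<beta> - (- \<beta>)"] by simp
  qed
  fix \<delta> assume d: "\<delta> \<in> P" "\<beta> + \<delta> \<in> R"
  then have "\<beta> - (\<beta> + \<delta>) \<in> cone P" using assms unfolding is_highest_def by blast
  then show False using neg_notin_cone[OF d(1)] by simp
qed

lemma exists_highest:
  assumes "irreducible R" shows "\<exists>\<beta>. is_highest \<beta>"
proof -
  obtain \<gamma> where "\<gamma> \<in> R" using assms unfolding irreducible_def by blast
  then obtain \<gamma>0 where "\<gamma>0 \<in> P" using P_total by blast
  then obtain \<beta> where b: "maximal_root \<beta>" using exists_maximal_above by blast
  have below: "\<beta> - \<gamma> \<in> cone P" if "\<gamma> \<in> P" for \<gamma>
  proof -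
    from exists_maximal_above[OF that] obtain \<beta>' where "maximal_root \<beta>'" "\<beta>' - \<gamma> \<in> cone P" by blast
    then show ?thesis using maximal_root_unique[OF assms b] by simp
  qed
  have bP: "\<beta> \<in> P" using b unfolding maximal_root_def by blast
  have "\<beta> - \<gamma> \<in> cone P" if "\<gamma> \<in> R" for \<gamma>
    using P_total[OF that] below cone_add[OF cone_base[OF bP] cone_base, of "- \<gamma>"] by auto
  then show ?thesis using bP P_subset unfolding is_highest_def by blast
qed

text \<open>A Cartan integer above 1 would make \<gamma> - 2\<beta> a root, and its negative is
  \<beta> plus the positive root \<beta> - \<gamma>, lying above the highest root.\<close>

lemma highest_ip:
  assumes "is_highest \<beta>" "\<gamma> \<in> P" "\<gamma> \<noteq> \<beta>" "ip \<gamma> \<beta> > 0"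
  shows "\<beta> - \<gamma> \<in> P" "2 * ip \<gamma> \<beta> = ip \<beta> \<beta>"
proof -
  have m: "maximal_root \<beta>" using is_highest_maximal assms by blast
  then have b: "\<beta> \<in> P" unfolding maximal_root_def by blast
  have d: "\<beta> - \<gamma> \<in> R"
    using diff_root[of \<gamma> \<beta>] assms b P_subset ip_sym[of \<gamma> \<beta>] by auto
  show pos: "\<beta> - \<gamma> \<in> P"
  proof (rule ccontr)
    assume "\<beta> - \<gamma> \<notin> P"
    then have "\<gamma> - \<beta> \<in> P" using P_total[OF d] by simp
    then have "\<beta> + (\<gamma> - \<beta>) \<notin> R" using m unfolding maximal_root_def by blast
    then show False using assms(2) P_subset by auto
  qed
  show "2 * ip \<gamma> \<beta> = ip \<beta> \<beta>"
  proof (rule ccontr)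
    assume "\<not> ?thesis"
    then have "\<gamma> - 2 * \<beta> \<in> R" using double_diff_root[of \<beta> \<gamma>] assms b P_subset by auto
    then have "- (\<gamma> - 2 * \<beta>) \<in> R" by (rule minus_R)
    moreover have "- (\<gamma> - 2 * \<beta>) = \<beta> + (\<beta> - \<gamma>)" by (simp add: algebra_simps)
    ultimately show False using m pos unfolding maximal_root_def by force
  qed
qed

end

section \<open>The cascade of a root system\<close>

context positive_roots
begin

definition closed_subsystem :: "'v set \<Rightarrow> bool" where
  "closed_subsystem \<Phi> \<longleftrightarrow> \<Phi> \<subseteq> R \<and> (\<forall>\<gamma>\<in>\<Phi>. - \<gamma> \<in> \<Phi>) \<and> (\<forall>\<gamma>\<in>\<Phi>. \<forall>\<delta>\<in>\<Phi>. \<gamma> + \<delta> \<in> R \<longrightarrow> \<gamma> + \<delta> \<in> \<Phi>)"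

lemma closed_subsystem_string:
  assumes "closed_subsystem \<Phi>" "\<gamma> \<in> \<Phi>" "\<delta> \<in> \<Phi>" "\<And>j. j \<le> n \<Longrightarrow> \<delta> + of_nat j * \<gamma> \<in> R"
  shows "\<delta> + of_nat n * \<gamma> \<in> \<Phi>"
  using assms(4)
proof (induction n)
  case (Suc n)
  then have "\<delta> + of_nat n * \<gamma> \<in> \<Phi>" by simp
  moreover have "\<delta> + of_nat n * \<gamma> + \<gamma> \<in> R" using Suc.prems[of "Suc n"] by (simp add: algebra_simps)
  ultimately have "\<delta> + of_nat n * \<gamma> + \<gamma> \<in> \<Phi>" using assms(1,2) unfolding closed_subsystem_def by blast
  then show ?case by (simp add: algebra_simps)
qed (use assms(3) in simp)

text \<open>Strings are walked one step at a time from \<delta>, upwards with \<gamma> and downwards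
  with -\<gamma>; closedness keeps each step inside \<Phi>, so the same r and q serve.\<close>

lemma closed_subsystem_positive_roots:
  assumes "closed_subsystem \<Phi>"
  shows "positive_roots \<Phi> ip (\<Phi> \<inter> P)"
proof
  have sub: "\<Phi> \<subseteq> R" using assms unfolding closed_subsystem_def by blast
  show "finite \<Phi>" using sub finite_R finite_subset by blast
  show "0 \<notin> \<Phi>" using sub zero_notin_R by blast
  show "- \<gamma> \<in> \<Phi>" if "\<gamma> \<in> \<Phi>" for \<gamma> using that assms unfolding closed_subsystem_def by blast
  show "ip x y = ip y x" for x y by (rule ip_sym)
  show "ip (x + y) z = ip x z + ip y z" for x y z by (rule ip_add_left)
  show "(\<Sum>\<gamma>\<in>\<Phi>. of_int (c \<gamma>) * \<gamma>) = 0"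
    if "ip (\<Sum>\<gamma>\<in>\<Phi>. of_int (c \<gamma>) * \<gamma>) (\<Sum>\<gamma>\<in>\<Phi>. of_int (c \<gamma>) * \<gamma>) \<le> 0" for c
    using pos_def_subset[OF sub that] .
  show "\<exists>r q :: nat. 2 * ip \<delta> \<gamma> = (real r - real q) * ip \<gamma> \<gamma> \<and>
        (\<forall>k::int. - int r \<le> k \<longrightarrow> k \<le> int q \<longrightarrow> \<delta> + of_int k * \<gamma> \<in> \<Phi>)"
    if g: "\<gamma> \<in> \<Phi>" and d: "\<delta> \<in> \<Phi>" and ne: "\<delta> \<noteq> \<gamma>" "\<delta> \<noteq> - \<gamma>" for \<gamma> \<delta>
  proof -
    have gR: "\<gamma> \<in> R" "\<delta> \<in> R" using g d sub by auto
    from root_string[OF gR ne] obtain r q :: nat where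
      *: "2 * ip \<delta> \<gamma> = (real r - real q) * ip \<gamma> \<gamma>"
      and str: "\<And>k::int. - int r \<le> k \<Longrightarrow> k \<le> int q \<Longrightarrow> \<delta> + of_int k * \<gamma> \<in> R" by blast
    have "\<delta> + of_int k * \<gamma> \<in> \<Phi>" if k: "- int r \<le> k" "k \<le> int q" for k
    proof (cases "k \<ge> 0")
      case True
      have "\<delta> + of_nat j * \<gamma> \<in> R" if "j \<le> nat k" for j
        using str[of "int j"] that k True by simp
      then have "\<delta> + of_nat (nat k) * \<gamma> \<in> \<Phi>" by (rule closed_subsystem_string[OF assms g d])
      then show ?thesis using True by simp
    next
      case False
      have mg: "- \<gamma> \<in> \<Phi>" using g assms unfolding closed_subsystem_def by blast
      have "\<delta> + of_nat j * (- \<gamma>) \<in> R" if "j \<le> nat (- k)" for j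
        using str[of "- int j"] that k False by simp
      then have "\<delta> + of_nat (nat (- k)) * (- \<gamma>) \<in> \<Phi>" by (rule closed_subsystem_string[OF assms mg d])
      then show ?thesis using False by simp
    qed
    then show ?thesis using * by blast
  qed
  show "\<Phi> \<inter> P \<subseteq> \<Phi>" by blast
  show "- \<gamma> \<notin> \<Phi> \<inter> P" if "\<gamma> \<in> \<Phi> \<inter> P" for \<gamma> using that P_asym by blast
  show "\<gamma> \<in> \<Phi> \<inter> P \<or> - \<gamma> \<in> \<Phi> \<inter> P" if "\<gamma> \<in> \<Phi>" for \<gamma>
    using that P_total[of \<gamma>] assms sub unfolding closed_subsystem_def by blast
  show "\<gamma> + \<delta> \<in> \<Phi> \<inter> P" if "\<gamma> \<in> \<Phi> \<inter> P" "\<delta> \<in> \<Phi> \<inter> P" "\<gamma> + \<delta> \<in> \<Phi>" for \<gamma> \<delta>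
    using that P_closed sub by blast
qed

definition highest :: "'v set \<Rightarrow> 'v" where
  "highest \<Phi> = (THE \<beta>. \<beta> \<in> \<Phi> \<and> (\<forall>\<gamma>\<in>\<Phi>. \<beta> - \<gamma> \<in> cone (\<Phi> \<inter> P)))"

text \<open>Interpreting the locale of positive roots for \<Phi> itself transfers the results on
  highest roots to every system that occurs in the cascade.\<close>

lemma
  assumes "closed_subsystem \<Phi>" "irreducible \<Phi>"
  shows highest_mem: "highest \<Phi> \<in> \<Phi>" "highest \<Phi> \<in> P"
    and highest_above: "\<gamma> \<in> \<Phi> \<Longrightarrow> highest \<Phi> - \<gamma> \<in> cone (\<Phi> \<inter> P)"
    and highest_ip_nonneg: "\<gamma> \<in> \<Phi> \<inter> P \<Longrightarrow> ip \<gamma> (highest \<Phi>) \<ge> 0"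
    and highest_diff: "\<gamma> \<in> \<Phi> \<inter> P \<Longrightarrow> \<gamma> \<noteq> highest \<Phi> \<Longrightarrow> ip \<gamma> (highest \<Phi>) > 0 \<Longrightarrow> highest \<Phi> - \<gamma> \<in> \<Phi> \<inter> P"
    and highest_half: "\<gamma> \<in> \<Phi> \<inter> P \<Longrightarrow> \<gamma> \<noteq> highest \<Phi> \<Longrightarrow> ip \<gamma> (highest \<Phi>) > 0 \<Longrightarrow>
      2 * ip \<gamma> (highest \<Phi>) = ip (highest \<Phi>) (highest \<Phi>)"
    and highest_unique: "maximal_root \<gamma> \<Longrightarrow> \<Phi> = R \<Longrightarrow> \<gamma> = highest \<Phi>"
proof -
  interpret S: positive_roots \<Phi> ip "\<Phi> \<inter> P" by (rule closed_subsystem_positive_roots[OF assms(1)])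
  obtain \<beta> where b: "S.is_highest \<beta>" using S.exists_highest[OF assms(2)] by blast
  have eq: "highest \<Phi> = \<beta>"
    unfolding highest_def S.is_highest_def[symmetric] by (rule the_equality[of S.is_highest, OF b S.is_highest_unique[OF _ b]])
  have m: "S.maximal_root \<beta>" using S.is_highest_maximal[OF b] .
  show "highest \<Phi> \<in> \<Phi>" "highest \<Phi> \<in> P" "\<gamma> \<in> \<Phi> \<Longrightarrow> highest \<Phi> - \<gamma> \<in> cone (\<Phi> \<inter> P)"
    using b m eq unfolding S.is_highest_def S.maximal_root_def by auto
  show "\<gamma> \<in> \<Phi> \<inter> P \<Longrightarrow> ip \<gamma> (highest \<Phi>) \<ge> 0"
    using S.maximal_root_ip_nonneg[OF m, of \<gamma>] eq ip_sym[of \<gamma> \<beta>] by simp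
  show "\<gamma> \<in> \<Phi> \<inter> P \<Longrightarrow> \<gamma> \<noteq> highest \<Phi> \<Longrightarrow> ip \<gamma> (highest \<Phi>) > 0 \<Longrightarrow> highest \<Phi> - \<gamma> \<in> \<Phi> \<inter> P"
    using S.highest_ip(1)[OF b] eq by simp
  show "\<gamma> \<in> \<Phi> \<inter> P \<Longrightarrow> \<gamma> \<noteq> highest \<Phi> \<Longrightarrow> ip \<gamma> (highest \<Phi>) > 0 \<Longrightarrow>
      2 * ip \<gamma> (highest \<Phi>) = ip (highest \<Phi>) (highest \<Phi>)"
    using S.highest_ip(2)[OF b] eq by simp
  show "maximal_root \<gamma> \<Longrightarrow> \<Phi> = R \<Longrightarrow> \<gamma> = highest \<Phi>"
    using S.maximal_root_unique[OF assms(2) _ m] eq unfolding maximal_root_def S.maximal_root_def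
    by (metis P_subset inf.absorb_iff2)
qed

definition component :: "'v set \<Rightarrow> 'v set \<Rightarrow> bool" where
  "component \<Psi> C \<longleftrightarrow> C \<subseteq> \<Psi> \<and> irreducible C \<and> (\<forall>\<gamma>\<in>C. \<forall>\<delta>\<in>\<Psi> - C. ip \<gamma> \<delta> = 0)"

text \<open>A root \<gamma> + \<delta> leaving \<open>C\<close> would be orthogonal to \<gamma> and
  to \<delta>, hence to itself.\<close>

lemma component_closed:
  assumes "closed_subsystem \<Psi>" "component \<Psi> C" shows "closed_subsystem C"
  unfolding closed_subsystem_def
proof (intro conjI ballI impI)
  show "C \<subseteq> R" using assms unfolding closed_subsystem_def component_def by blast
  fix \<gamma> assume g: "\<gamma> \<in> C"
  then have gR: "\<gamma> \<in> R" "\<gamma> \<in> \<Psi>" using assms unfolding closed_subsystem_def component_def by auto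
  show "- \<gamma> \<in> C"
  proof (rule ccontr)
    assume "- \<gamma> \<notin> C"
    moreover have "- \<gamma> \<in> \<Psi>" using gR assms unfolding closed_subsystem_def by blast
    ultimately have "ip \<gamma> (- \<gamma>) = 0" using g assms unfolding component_def by blast
    then show False using ip_root_pos[OF gR(1)] by simp
  qed
  fix \<delta> assume d: "\<delta> \<in> C" "\<gamma> + \<delta> \<in> R"
  show "\<gamma> + \<delta> \<in> C"
  proof (rule ccontr)
    assume n: "\<gamma> + \<delta> \<notin> C"
    have "\<gamma> + \<delta> \<in> \<Psi>" using gR d assms unfolding closed_subsystem_def component_def by blast
    then have "ip \<gamma> (\<gamma> + \<delta>) = 0" "ip \<delta> (\<gamma> + \<delta>) = 0"
      using n g d assms unfolding component_def by auto
    then have "ip (\<gamma> + \<delta>) (\<gamma> + \<delta>) = 0" by (simp only: ip_add_left)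
    then show False using ip_root_pos[OF d(2)] by simp
  qed
qed

text \<open>The component is a smallest set that contains \<gamma> and is orthogonal to its
  complement in \<Psi>: the half of a splitting that contains \<gamma> would be smaller.\<close>

lemma exists_component:
  assumes "finite \<Psi>" "\<gamma> \<in> \<Psi>" shows "\<exists>C. component \<Psi> C \<and> \<gamma> \<in> C"
proof -
  define good where "good C \<longleftrightarrow> C \<subseteq> \<Psi> \<and> \<gamma> \<in> C \<and> (\<forall>x\<in>C. \<forall>y\<in>\<Psi> - C. ip x y = 0)" for C
  have "good \<Psi>" using assms unfolding good_def by blast
  then obtain C where C: "good C" and min: "\<And>D. good D \<Longrightarrow> card C \<le> card D"
    using ex_has_least_nat[of good \<Psi> card] by blast
  have fin: "finite C" using C assms finite_subset unfolding good_def by blast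
  have no_split: False
    if ne: "B \<noteq> {}" and d: "A \<inter> B = {}" and u: "C = A \<union> B" and orth: "\<forall>\<gamma>\<in>A. \<forall>\<delta>\<in>B. ip \<gamma> \<delta> = 0"
      and gA: "\<gamma> \<in> A" for A B
  proof -
    have "ip x y = 0" if "x \<in> A" "y \<in> \<Psi> - A" for x y
      using that C u orth unfolding good_def by (cases "y \<in> B") auto
    then have "good A" using C u gA unfolding good_def by auto
    moreover have "card A < card C" using fin u ne d by (intro psubset_card_mono) auto
    ultimately show False using min by force
  qed
  have "irreducible C"
    unfolding irreducible_def
  proof (intro conjI notI)
    assume "C = {}" then show False using C unfolding good_def by simp
  next
    assume "\<exists>A B. A \<noteq> {} \<and> B \<noteq> {} \<and> A \<inter> B = {} \<and> C = A \<union> B \<and> (\<forall>\<gamma>\<in>A. \<forall>\<delta>\<in>B. ip \<gamma> \<delta> = 0)"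
    then obtain A B where AB: "A \<noteq> {}" "B \<noteq> {}" "A \<inter> B = {}" "C = A \<union> B" "\<forall>\<gamma>\<in>A. \<forall>\<delta>\<in>B. ip \<gamma> \<delta> = 0"
      by metis
    have "\<gamma> \<in> A \<or> \<gamma> \<in> B" using C AB(4) unfolding good_def by blast
    then show False
    proof
      assume "\<gamma> \<in> A" then show False using no_split[OF AB(2-5)] by blast
    next
      assume "\<gamma> \<in> B"
      moreover have "\<forall>\<gamma>\<in>B. \<forall>\<delta>\<in>A. ip \<gamma> \<delta> = 0" using AB(5) ip_sym by metis
      ultimately show False using no_split[OF AB(1), of B] AB by (metis Int_commute Un_commute)
    qed
  qed
  then show ?thesis using C unfolding component_def good_def by blast
qed

definition perp :: "'v set \<Rightarrow> 'v set" where
  "perp \<Phi> = {\<gamma> \<in> \<Phi>. ip \<gamma> (highest \<Phi>) = 0}"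

lemma perp_closed: "closed_subsystem \<Phi> \<Longrightarrow> closed_subsystem (perp \<Phi>)"
  unfolding closed_subsystem_def perp_def by (auto simp: ip_add_left)

inductive_set cascade :: "'v set set" where
  top: "R \<in> cascade"
| descendant: "\<Phi> \<in> cascade \<Longrightarrow> component (perp \<Phi>) C \<Longrightarrow> C \<in> cascade"

section \<open>The degree attached to a set of simple roots\<close>

definition deg :: "'v set \<Rightarrow> 'v \<Rightarrow> int" where
  "deg T x = (\<Sum>\<alpha>\<in>T. coef x \<alpha>)"

lemma deg_add: "T \<subseteq> simple \<Longrightarrow> x \<in> lattice \<Longrightarrow> y \<in> lattice \<Longrightarrow> deg T (x + y) = deg T x + deg T y"
  unfolding deg_def sum.distrib[symmetric] by (intro sum.cong) (auto simp: coef_add)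

lemma deg_scale: "T \<subseteq> simple \<Longrightarrow> x \<in> lattice \<Longrightarrow> deg T (of_int n * x) = n * deg T x"
  unfolding deg_def sum_distrib_left by (intro sum.cong) (auto simp: coef_scale)

lemma deg_minus: "T \<subseteq> simple \<Longrightarrow> x \<in> lattice \<Longrightarrow> deg T (- x) = - deg T x"
  using deg_scale[of T x "-1"] by simp

lemma deg_diff: "T \<subseteq> simple \<Longrightarrow> x \<in> lattice \<Longrightarrow> y \<in> lattice \<Longrightarrow> deg T (x - y) = deg T x - deg T y"
  using deg_add[of T x "- y"] by (simp add: deg_minus lattice_minus)

lemma deg_zero: "T \<subseteq> simple \<Longrightarrow> deg T 0 = 0"
  unfolding deg_def by (intro sum.neutral) (auto simp: coef_zero)

lemma lattice_sum: "(\<And>i. i \<in> I \<Longrightarrow> f i \<in> lattice) \<Longrightarrow> sum f I \<in> lattice"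
  by (induction I rule: infinite_finite_induct) (auto simp: lattice_zero lattice_add)

lemma deg_sum:
  "T \<subseteq> simple \<Longrightarrow> (\<And>i. i \<in> I \<Longrightarrow> f i \<in> lattice) \<Longrightarrow> deg T (sum f I) = (\<Sum>i\<in>I. deg T (f i))"
  by (induction I rule: infinite_finite_induct) (auto simp: deg_zero deg_add lattice_sum)

lemma deg_cone_nonneg: "T \<subseteq> simple \<Longrightarrow> x \<in> cone P \<Longrightarrow> deg T x \<ge> 0"
  unfolding deg_def using cone_lattice by (intro sum_nonneg) auto

lemma deg_pos_iff:
  assumes "T \<subseteq> simple" "\<gamma> \<in> P" shows "deg T \<gamma> > 0 \<longleftrightarrow> (\<exists>\<alpha>\<in>T. coef \<gamma> \<alpha> > 0)"
proof -
  have fin: "finite T" using assms(1) finite_simple finite_subset by blast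
  have nn: "\<forall>\<alpha>\<in>T. coef \<gamma> \<alpha> \<ge> 0" using assms coef_nonneg by blast
  then have "deg T \<gamma> = 0 \<longleftrightarrow> (\<forall>\<alpha>\<in>T. coef \<gamma> \<alpha> = 0)"
    unfolding deg_def using fin by (intro sum_nonneg_eq_0_iff) auto
  moreover have "deg T \<gamma> \<ge> 0" using deg_cone_nonneg[OF assms(1) cone_base[OF assms(2)]] .
  ultimately show ?thesis using nn by force
qed

lemma deg_simple:
  assumes "T \<subseteq> simple" "\<alpha> \<in> simple" shows "deg T \<alpha> = (if \<alpha> \<in> T then 1 else 0)"
proof -
  have fin: "finite T" using assms(1) finite_simple finite_subset by blast
  have "deg T \<alpha> = (\<Sum>\<beta>\<in>T. if \<beta> = \<alpha> then 1 else 0)"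
    unfolding deg_def using assms by (intro sum.cong) (auto simp: coef_simple)
  then show ?thesis using fin by simp
qed

end

locale irreducible_positive_roots = positive_roots R ip P
  for R :: "'v::comm_ring_1 set" and ip and P +
  assumes irreducible: "irreducible R"
begin

lemma closed_R: "closed_subsystem R"
  unfolding closed_subsystem_def using minus_R by blast

lemma cascade_closed: "\<Phi> \<in> cascade \<Longrightarrow> closed_subsystem \<Phi>"
  and cascade_irreducible: "\<Phi> \<in> cascade \<Longrightarrow> irreducible \<Phi>"
proof (induction rule: cascade.induct)
  case top
  { case 1 show ?case by (rule closed_R) }
  { case 2 show ?case by (rule irreducible) }
next
  case (descendant \<Phi> C)
  { case 1 show ?case using component_closed[OF perp_closed] descendant by blast }
  { case 2 show ?case using descendant unfolding component_def by blast }
qed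

lemma cascade_subset: "\<Phi> \<in> cascade \<Longrightarrow> \<Phi> \<subseteq> R"
  using cascade_closed unfolding closed_subsystem_def by blast

lemmas cascade_highest = highest_mem[OF cascade_closed cascade_irreducible]
  highest_ip_nonneg[OF cascade_closed cascade_irreducible]

lemma cascade_highest_pos: "\<Phi> \<in> cascade \<Longrightarrow> ip (highest \<Phi>) (highest \<Phi>) > 0"
  using ip_root_pos cascade_highest cascade_subset by blast

text \<open>Each system of the cascade is a face of the positive roots. Products with a highest root
  are nonnegative, so orthogonality of the sum passes to both summands; and a summand outside the
  component \<open>C\<close> would be orthogonal to the sum, which forces itself or the sum to have
  length zero.\<close>

lemma cascade_face:
  assumes "\<Phi> \<in> cascade" "\<gamma> \<in> P" "\<delta> \<in> P" "\<gamma> + \<delta> \<in> \<Phi>"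
  shows "\<gamma> \<in> \<Phi> \<and> \<delta> \<in> \<Phi>"
  using assms(1,4)
proof (induction rule: cascade.induct)
  case top
  then show ?case using assms P_subset by blast
next
  case (descendant \<Phi> C)
  have C: "C \<subseteq> perp \<Phi>" and orth: "\<And>x y. x \<in> C \<Longrightarrow> y \<in> perp \<Phi> - C \<Longrightarrow> ip x y = 0"
    using descendant.hyps unfolding component_def by auto
  have sum: "\<gamma> + \<delta> \<in> perp \<Phi>" using C descendant.prems by blast
  then have in_\<Phi>: "\<gamma> \<in> \<Phi>" "\<delta> \<in> \<Phi>" using descendant.IH unfolding perp_def by auto
  have "ip \<gamma> (highest \<Phi>) + ip \<delta> (highest \<Phi>) = 0" using sum unfolding perp_def by (simp add: ip_add_left)
  moreover have "ip \<gamma> (highest \<Phi>) \<ge> 0" "ip \<delta> (highest \<Phi>) \<ge> 0"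
    using cascade_highest(3)[OF descendant.hyps(1)] descendant.hyps(1) assms in_\<Phi> by auto
  ultimately have gp: "\<gamma> \<in> perp \<Phi>" "\<delta> \<in> perp \<Phi>" using in_\<Phi> unfolding perp_def by auto
  have both: "x \<in> C" if "x \<in> perp \<Phi>" "y \<in> perp \<Phi>" "x \<in> P" "y \<in> P" "x + y \<in> C" for x y
  proof (rule ccontr)
    assume x: "x \<notin> C"
    have R: "x \<in> R" "x + y \<in> R" using that P_subset cascade_subset descendant.hyps cascade.descendant by blast+
    have 0: "ip (x + y) x = 0" using orth[OF that(5), of x] that x by blast
    show False
    proof (cases "y \<in> C")
      case True
      then have "ip y x = 0" using orth that x by blast
      then show False using 0 ip_root_pos[OF R(1)] by (simp add: ip_add_left)
    next
      case False
      then have "ip (x + y) y = 0" using orth[OF that(5), of y] that by blast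
      then have "ip (x + y) (x + y) = 0" using 0 by (simp only: ip_add_right)
      then show False using ip_root_pos[OF R(2)] by simp
    qed
  qed
  show ?case using both[of \<gamma> \<delta>] both[of \<delta> \<gamma>] gp assms descendant.prems by (simp add: add.commute)
qed

definition orthogonal :: "'v set \<Rightarrow> 'v set \<Rightarrow> bool" where
  "orthogonal A B \<longleftrightarrow> (\<forall>x\<in>A. \<forall>y\<in>B. ip x y = 0)"

text \<open>The systems of the cascade form a tree. Nested systems are nested through
  \<open>perp\<close>, so distinct systems have orthogonal highest roots in every alternative. The
  induction runs over the construction of both systems.\<close>

lemma cascade_trichotomy:
  assumes "\<Phi>1 \<in> cascade" "\<Phi>2 \<in> cascade"
  shows "\<Phi>1 = \<Phi>2 \<or> \<Phi>1 \<subseteq> perp \<Phi>2 \<or> \<Phi>2 \<subseteq> perp \<Phi>1 \<or> orthogonal \<Phi>1 \<Phi>2"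
proof -
  have perp_sub: "perp \<Phi> \<subseteq> \<Phi>" for \<Phi> unfolding perp_def by blast
  have below_top: "\<Phi> = R \<or> \<Phi> \<subseteq> perp R" if "\<Phi> \<in> cascade" for \<Phi>
    using that
  proof induction
    case (descendant \<Phi> C)
    then have "C \<subseteq> perp \<Phi>" unfolding component_def by blast
    then show ?case using descendant.IH perp_sub by blast
  qed simp
  show ?thesis using assms
  proof (induction arbitrary: \<Phi>2 rule: cascade.induct)
    case top
    then show ?case using below_top by blast
  next
    case (descendant \<Psi>1 C1)
    have C1: "C1 \<in> cascade" using cascade.descendant descendant.hyps by blast
    have c1: "C1 \<subseteq> perp \<Psi>1" "\<And>x y. x \<in> C1 \<Longrightarrow> y \<in> perp \<Psi>1 - C1 \<Longrightarrow> ip x y = 0"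
      using descendant.hyps unfolding component_def by auto
    show ?case using descendant.prems
    proof (induction rule: cascade.induct)
      case top
      then show ?case using below_top[OF C1] by blast
    next
      case inner: (descendant \<Psi>2 C2)
      have C2: "C2 \<in> cascade" using cascade.descendant inner.hyps by blast
      have c2: "C2 \<subseteq> perp \<Psi>2" "\<And>x y. x \<in> C2 \<Longrightarrow> y \<in> perp \<Psi>2 - C2 \<Longrightarrow> ip x y = 0"
        using inner.hyps unfolding component_def by auto
      have s1: "C1 \<subseteq> \<Psi>1" and s2: "C2 \<subseteq> \<Psi>2" using c1 c2 perp_sub by blast+
      have sp: "C1 \<inter> C2 = {} \<Longrightarrow> C1 \<subseteq> perp \<Psi>2 \<Longrightarrow> orthogonal C1 C2"
        unfolding orthogonal_def using c2(2) ip_sym by (metis Diff_iff disjoint_iff subsetD)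
      have sp': "C1 \<inter> C2 = {} \<Longrightarrow> C2 \<subseteq> perp \<Psi>1 \<Longrightarrow> orthogonal C1 C2"
        unfolding orthogonal_def using c1(2) by blast
      \<comment> \<open>An irreducible system inside \<open>perp\<close> of \<Psi>2 either lies in
        the component \<open>C2\<close> or misses it. The symmetric claim compares \<open>C2\<close>
        with \<Psi>1; if both end with an inclusion, the two systems are equal.\<close>
      have "orthogonal C1 C2 \<or> C2 \<subseteq> perp C1 \<or> C1 \<subseteq> C2"
        using inner.IH
      proof (elim disjE)
        assume "C1 \<subseteq> perp \<Psi>2"
        then show ?thesis
          using irreducible_subset_split[OF cascade_irreducible[OF C1] _ c2(2)] sp by blast
      next
        assume "orthogonal C1 \<Psi>2"
        then show ?thesis using s2 unfolding orthogonal_def by blast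
      qed (use c2 s2 perp_sub in blast)+
      moreover have "orthogonal C1 C2 \<or> C1 \<subseteq> perp C2 \<or> C2 \<subseteq> C1"
        using descendant.IH[OF C2]
      proof (elim disjE)
        assume "C2 \<subseteq> perp \<Psi>1"
        then show ?thesis
          using irreducible_subset_split[OF cascade_irreducible[OF C2] _ c1(2)] sp' by blast
      next
        assume "orthogonal \<Psi>1 C2"
        then show ?thesis using s1 unfolding orthogonal_def by blast
      qed (use c1 s1 perp_sub in blast)+
      ultimately show ?case by blast
    qed
  qed
qed

lemma cascade_highest_orthogonal:
  assumes "\<Phi>1 \<in> cascade" "\<Phi>2 \<in> cascade" "\<Phi>1 \<noteq> \<Phi>2"
  shows "ip (highest \<Phi>1) (highest \<Phi>2) = 0"
  using cascade_trichotomy[OF assms(1,2)] cascade_highest(1)[OF assms(1,1)] cascade_highest(1)[OF assms(2,2)]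
    assms(3) ip_sym[of "highest \<Phi>1"]
  unfolding perp_def orthogonal_def by auto

lemma cascade_unique:
  assumes "\<Phi>1 \<in> cascade" "\<Phi>2 \<in> cascade" "\<gamma> \<in> \<Phi>1" "\<gamma> \<in> \<Phi>2"
    "ip \<gamma> (highest \<Phi>1) > 0" "ip \<gamma> (highest \<Phi>2) > 0"
  shows "\<Phi>1 = \<Phi>2"
  using cascade_trichotomy[OF assms(1,2)]
proof (elim disjE)
  assume "orthogonal \<Phi>1 \<Phi>2"
  then have "ip \<gamma> \<gamma> = 0" using assms unfolding orthogonal_def by blast
  then show ?thesis using ip_root_pos assms cascade_subset by force
qed (use assms in \<open>auto simp: perp_def\<close>)

text \<open>In a smallest system of the cascade containing \<gamma>, the root cannot be orthogonal
  to the highest root, for its component in \<open>perp\<close> would be a smaller system.\<close>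

lemma exists_cascade_system:
  assumes "\<gamma> \<in> P" shows "\<exists>\<Phi>\<in>cascade. \<gamma> \<in> \<Phi> \<and> ip \<gamma> (highest \<Phi>) > 0"
proof -
  have "R \<in> cascade \<and> \<gamma> \<in> R" using assms P_subset cascade.top by blast
  then obtain \<Phi> where \<Phi>: "\<Phi> \<in> cascade" "\<gamma> \<in> \<Phi>"
    and min: "\<And>\<Psi>. \<Psi> \<in> cascade \<and> \<gamma> \<in> \<Psi> \<Longrightarrow> card \<Phi> \<le> card \<Psi>"
    using ex_has_least_nat[of "\<lambda>\<Phi>. \<Phi> \<in> cascade \<and> \<gamma> \<in> \<Phi>" R card] by blast
  have fin: "finite \<Phi>" using cascade_subset[OF \<Phi>(1)] finite_R finite_subset by blast
  have "ip \<gamma> (highest \<Phi>) \<noteq> 0"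
  proof
    assume "ip \<gamma> (highest \<Phi>) = 0"
    then have g: "\<gamma> \<in> perp \<Phi>" using \<Phi> unfolding perp_def by blast
    have "finite (perp \<Phi>)" using fin unfolding perp_def by simp
    then obtain C where C: "component (perp \<Phi>) C" "\<gamma> \<in> C" using exists_component g by blast
    have "highest \<Phi> \<in> \<Phi>" "highest \<Phi> \<notin> C"
      using cascade_highest[OF \<Phi>(1,1)] cascade_highest_pos[OF \<Phi>(1)] C unfolding component_def perp_def by auto
    then have "C \<subset> \<Phi>" using C unfolding component_def perp_def by blast
    then have "card C < card \<Phi>" using fin psubset_card_mono by blast
    moreover have "C \<in> cascade" using cascade.descendant \<Phi> C by blast
    ultimately show False using min[of C] C by simp
  qed
  moreover have "ip \<gamma> (highest \<Phi>) \<ge> 0" using cascade_highest(3)[OF \<Phi>(1,1)] \<Phi> assms by blast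
  ultimately show ?thesis using \<Phi> by force
qed

definition kcascade :: "'v set" where "kcascade = highest ` cascade"

lemma kcascade_subset: "kcascade \<subseteq> P"
  unfolding kcascade_def using cascade_highest by blast

lemma kcascade_orthogonal: "\<beta> \<in> kcascade \<Longrightarrow> \<beta>' \<in> kcascade \<Longrightarrow> \<beta> \<noteq> \<beta>' \<Longrightarrow> ip \<beta> \<beta>' = 0"
  unfolding kcascade_def using cascade_highest_orthogonal by auto

lemma exists_kcascade_above:
  assumes "\<gamma> \<in> P" shows "\<exists>\<beta>\<in>kcascade. \<gamma> = \<beta> \<or> \<beta> - \<gamma> \<in> P"
proof -
  obtain \<Phi> where \<Phi>: "\<Phi> \<in> cascade" "\<gamma> \<in> \<Phi>" "ip \<gamma> (highest \<Phi>) > 0"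
    using exists_cascade_system[OF assms] by blast
  then have "\<gamma> \<noteq> highest \<Phi> \<Longrightarrow> highest \<Phi> - \<gamma> \<in> P"
    using highest_diff[OF cascade_closed[OF \<Phi>(1)] cascade_irreducible[OF \<Phi>(1)], of \<gamma>] assms by blast
  moreover have "highest \<Phi> \<in> kcascade" using \<Phi> unfolding kcascade_def by blast
  ultimately show ?thesis by blast
qed

text \<open>If \<gamma> had product zero with the highest root, the whole length of the highest root
  would come from \<delta>; but a positive root with positive product, other than the highest one,
  carries exactly half of it.\<close>

lemma kcascade_summand:
  assumes "\<Phi> \<in> cascade" "\<gamma> \<in> P" "\<delta> \<in> P" "\<gamma> + \<delta> = highest \<Phi>"
  shows "\<gamma> \<in> \<Phi>" "ip \<gamma> (highest \<Phi>) > 0"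
proof -
  have "\<gamma> + \<delta> \<in> \<Phi>" using assms(4) cascade_highest(1)[OF assms(1,1)] by simp
  then have in_\<Phi>: "\<gamma> \<in> \<Phi>" "\<delta> \<in> \<Phi>" using cascade_face[OF assms(1-3)] by auto
  then show "\<gamma> \<in> \<Phi>" by blast
  have nn: "ip \<gamma> (highest \<Phi>) \<ge> 0" using cascade_highest(3)[OF assms(1,1)] in_\<Phi> assms by blast
  have s: "ip \<gamma> (highest \<Phi>) + ip \<delta> (highest \<Phi>) = ip (highest \<Phi>) (highest \<Phi>)"
    using assms(4) by (metis ip_add_left)
  have ne: "\<delta> \<noteq> highest \<Phi>"
  proof
    assume "\<delta> = highest \<Phi>"
    then have "\<gamma> = 0" using assms(4) by simp
    then show False using assms(2) P_subset zero_notin_R by blast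
  qed
  have p: "ip (highest \<Phi>) (highest \<Phi>) > 0" using cascade_highest_pos[OF assms(1)] .
  show "ip \<gamma> (highest \<Phi>) > 0"
  proof (rule ccontr)
    assume "\<not> ?thesis"
    then have "ip \<delta> (highest \<Phi>) = ip (highest \<Phi>) (highest \<Phi>)" using nn s by simp
    moreover have "2 * ip \<delta> (highest \<Phi>) = ip (highest \<Phi>) (highest \<Phi>)"
      using highest_half[OF cascade_closed[OF assms(1)] cascade_irreducible[OF assms(1)], of \<delta>] in_\<Phi> assms ne p
        calculation by auto
    ultimately show False using p by simp
  qed
qed

text \<open>A positive root determines the system in which it has positive product with the highest
  root, hence the cascade root it is a summand of, hence the other summand.\<close>

lemma kcascade_partner_unique:
  assumes "\<gamma> \<in> P" "\<delta> \<in> P" "\<delta>' \<in> P" "\<gamma> + \<delta> \<in> kcascade" "\<gamma> + \<delta>' \<in> kcascade"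
  shows "\<delta> = \<delta>'"
proof -
  obtain \<Phi> \<Phi>' where \<Phi>: "\<Phi> \<in> cascade" "\<gamma> + \<delta> = highest \<Phi>" "\<Phi>' \<in> cascade" "\<gamma> + \<delta>' = highest \<Phi>'"
    using assms unfolding kcascade_def by blast
  then have "\<Phi> = \<Phi>'" using cascade_unique kcascade_summand assms by metis
  then show ?thesis using \<Phi> by (metis add_left_cancel)
qed

text \<open>As a summand \<beta> would have positive product with another cascade root, against
  orthogonality. This is why root vectors of cascade roots will stabilise
  \<open>\<xi>0\<close>.\<close>

lemma kcascade_not_summand:
  assumes "\<beta> \<in> kcascade" "\<delta> \<in> P" shows "\<beta> + \<delta> \<notin> kcascade"
proof
  assume "\<beta> + \<delta> \<in> kcascade"
  then obtain \<Phi>' where \<Phi>': "\<Phi>' \<in> cascade" "\<beta> + \<delta> = highest \<Phi>'" unfolding kcascade_def by blast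
  have bP: "\<beta> \<in> P" using assms kcascade_subset by blast
  have "ip \<beta> (highest \<Phi>') > 0" using kcascade_summand[OF \<Phi>'(1) bP assms(2) \<Phi>'(2)] by blast
  moreover have "\<beta> \<noteq> highest \<Phi>'" using \<Phi>'(2) assms(2) P_subset zero_notin_R by force
  ultimately show False using kcascade_orthogonal[OF assms(1), of "highest \<Phi>'"] \<Phi>' unfolding kcascade_def by auto
qed

lemma finite_kcascade: "finite kcascade"
  using kcascade_subset finite_P finite_subset by blast

section \<open>The product of the reflections in the cascade\<close>

definition cartan_int :: "'v \<Rightarrow> 'v \<Rightarrow> int" where
  "cartan_int \<gamma> \<beta> = \<lfloor>2 * ip \<gamma> \<beta> / ip \<beta> \<beta>\<rfloor>"

lemma cartan_int_eqI: "\<beta> \<in> R \<Longrightarrow> 2 * ip \<gamma> \<beta> = of_int n * ip \<beta> \<beta> \<Longrightarrow> cartan_int \<gamma> \<beta> = n"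
  unfolding cartan_int_def using ip_root_pos[of \<beta>] by simp

text \<open>Between roots the quotient is an integer, so the floor in the definition loses
  nothing.\<close>

lemma cartan_int: "\<beta> \<in> R \<Longrightarrow> \<gamma> \<in> R \<Longrightarrow> 2 * ip \<gamma> \<beta> = of_int (cartan_int \<gamma> \<beta>) * ip \<beta> \<beta>"
  using reflection_root[of \<beta> \<gamma>] cartan_int_eqI by metis

lemma cartan_int_add:
  assumes "\<beta> \<in> R" "\<gamma> \<in> R" "\<delta> \<in> R"
  shows "cartan_int (\<gamma> + \<delta>) \<beta> = cartan_int \<gamma> \<beta> + cartan_int \<delta> \<beta>"
  using assms cartan_int[of \<beta> \<gamma>] cartan_int[of \<beta> \<delta>]
  by (intro cartan_int_eqI) (auto simp: ip_add_left algebra_simps)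

lemma cartan_int_minus:
  assumes "\<beta> \<in> R" "\<gamma> \<in> R"
  shows "cartan_int (- \<gamma>) \<beta> = - cartan_int \<gamma> \<beta>"
  using assms cartan_int[of \<beta> \<gamma>] by (intro cartan_int_eqI) auto

text \<open>The product of the commuting reflections in the roots of the cascade.\<close>

definition cascade_reflection :: "'v \<Rightarrow> 'v" where
  "cascade_reflection \<gamma> = \<gamma> - (\<Sum>\<beta>\<in>kcascade. of_int (cartan_int \<gamma> \<beta>) * \<beta>)"

text \<open>Subtracting several multiples at once is the same as reflecting step by step: by
  orthogonality the earlier reflections leave the product with the next \<beta> unchanged.\<close>

lemma partial_reflection:
  assumes \<Phi>: "\<Phi> \<in> cascade" and "\<gamma> \<in> \<Phi>" and "finite F" "F \<subseteq> kcascade \<inter> \<Phi>"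
  shows "\<gamma> - (\<Sum>\<beta>\<in>F. of_int (cartan_int \<gamma> \<beta>) * \<beta>) \<in> \<Phi>"
  using assms(3,4)
proof (induction rule: finite_induct)
  case empty
  then show ?case using assms by simp
next
  case (insert \<beta> F)
  interpret S: positive_roots \<Phi> ip "\<Phi> \<inter> P" by (rule closed_subsystem_positive_roots[OF cascade_closed[OF \<Phi>]])
  define x where "x = \<gamma> - (\<Sum>\<beta>\<in>F. of_int (cartan_int \<gamma> \<beta>) * \<beta>)"
  have x: "x \<in> \<Phi>" using insert unfolding x_def by blast
  have b: "\<beta> \<in> \<Phi>" "\<beta> \<in> R" using insert cascade_subset[OF \<Phi>] by auto
  have "ip (\<Sum>\<beta>\<in>F. of_int (cartan_int \<gamma> \<beta>) * \<beta>) \<beta> = 0"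
    unfolding ip_sum_left ip_of_int_left
    using insert kcascade_orthogonal by (intro sum.neutral ballI) auto
  then have ipx: "ip x \<beta> = ip \<gamma> \<beta>" unfolding x_def ip_diff_left by simp
  obtain n where n: "2 * ip x \<beta> = of_int n * ip \<beta> \<beta>" "x - of_int n * \<beta> \<in> \<Phi>"
    using S.reflection_root[OF b(1) x] by blast
  have "cartan_int \<gamma> \<beta> = n" using cartan_int_eqI[OF b(2)] n ipx by simp
  then show ?case using n(2) insert.hyps unfolding x_def by (simp add: algebra_simps)
qed

text \<open>By the trichotomy a cascade root outside \<Phi> is orthogonal to all of \<Phi>, so only
  reflections in members of \<Phi> contribute.\<close>

lemma cascade_reflection_mem:
  assumes \<Phi>: "\<Phi> \<in> cascade" and "\<gamma> \<in> \<Phi>" shows "cascade_reflection \<gamma> \<in> \<Phi>"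
proof -
  have "cartan_int \<gamma> \<beta> = 0" if "\<beta> \<in> kcascade - \<Phi>" for \<beta>
  proof -
    obtain \<Phi>' where \<Phi>': "\<Phi>' \<in> cascade" "\<beta> = highest \<Phi>'" using \<open>\<beta> \<in> kcascade - \<Phi>\<close> unfolding kcascade_def by blast
    have "highest \<Phi>' \<in> \<Phi>'" using cascade_highest \<Phi>' by blast
    then have "ip \<gamma> \<beta> = 0"
      using cascade_trichotomy[OF \<Phi> \<Phi>'(1)] that \<Phi>' assms unfolding perp_def orthogonal_def by auto
    then show ?thesis by (simp add: cartan_int_def)
  qed
  then have "(\<Sum>\<beta>\<in>kcascade. of_int (cartan_int \<gamma> \<beta>) * \<beta>) = (\<Sum>\<beta>\<in>kcascade \<inter> \<Phi>. of_int (cartan_int \<gamma> \<beta>) * \<beta>)"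
    using finite_kcascade by (intro sum.mono_neutral_right) auto
  then show ?thesis
    unfolding cascade_reflection_def using partial_reflection[OF assms, of "kcascade \<inter> \<Phi>"] finite_kcascade by simp
qed

lemma cascade_reflection_root: "\<gamma> \<in> R \<Longrightarrow> cascade_reflection \<gamma> \<in> R"
  using cascade_reflection_mem[OF cascade.top] .

lemma cascade_reflection_ip:
  assumes "\<gamma> \<in> R" "\<beta> \<in> kcascade" shows "ip (cascade_reflection \<gamma>) \<beta> = - ip \<gamma> \<beta>"
proof -
  have "ip (\<Sum>\<beta>\<in>kcascade. of_int (cartan_int \<gamma> \<beta>) * \<beta>) \<beta> = of_int (cartan_int \<gamma> \<beta>) * ip \<beta> \<beta>"
    unfolding ip_sum_left ip_of_int_left
    using finite_kcascade assms(2) kcascade_orthogonal by (subst sum.remove[of _ \<beta>]) (auto intro!: sum.neutral)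
  moreover have "\<beta> \<in> R" using assms kcascade_subset P_subset by blast
  ultimately show ?thesis
    unfolding cascade_reflection_def ip_diff_left using cartan_int assms(1) by simp
qed

text \<open>The image stays in the system attached to \<gamma>, whose highest root detects the sign:
  its product with \<gamma> is positive and gets negated. The map is thus the longest element of the
  Weyl group.\<close>

lemma cascade_reflection_neg:
  assumes "\<gamma> \<in> P" shows "- cascade_reflection \<gamma> \<in> P"
proof -
  obtain \<Phi> where \<Phi>: "\<Phi> \<in> cascade" "\<gamma> \<in> \<Phi>" "ip \<gamma> (highest \<Phi>) > 0"
    using exists_cascade_system[OF assms] by blast
  have "ip (cascade_reflection \<gamma>) (highest \<Phi>) < 0"
    using cascade_reflection_ip[of \<gamma> "highest \<Phi>"] \<Phi> assms P_subset unfolding kcascade_def by auto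
  then have "cascade_reflection \<gamma> \<notin> P"
    using cascade_highest(3)[OF \<Phi>(1,1)] cascade_reflection_mem[OF \<Phi>(1,2)] by force
  then show ?thesis using P_total cascade_reflection_root assms P_subset by blast
qed

lemma cascade_reflection_minus: "\<gamma> \<in> R \<Longrightarrow> cascade_reflection (- \<gamma>) = - cascade_reflection \<gamma>"
proof -
  assume "\<gamma> \<in> R"
  then have "(\<Sum>\<beta>\<in>kcascade. of_int (cartan_int (- \<gamma>) \<beta>) * \<beta>) = (\<Sum>\<beta>\<in>kcascade. - (of_int (cartan_int \<gamma> \<beta>) * \<beta>))"
    using kcascade_subset P_subset by (intro sum.cong) (auto simp: cartan_int_minus)
  then show ?thesis unfolding cascade_reflection_def by (simp add: sum_negf)
qed

lemma cascade_reflection_add: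
  assumes "\<gamma> \<in> R" "\<delta> \<in> R"
  shows "cascade_reflection (\<gamma> + \<delta>) = cascade_reflection \<gamma> + cascade_reflection \<delta>"
proof -
  have "(\<Sum>\<beta>\<in>kcascade. of_int (cartan_int (\<gamma> + \<delta>) \<beta>) * \<beta>) =
      (\<Sum>\<beta>\<in>kcascade. of_int (cartan_int \<gamma> \<beta>) * \<beta> + of_int (cartan_int \<delta> \<beta>) * \<beta>)"
    using kcascade_subset P_subset assms by (intro sum.cong) (auto simp: cartan_int_add algebra_simps)
  then show ?thesis unfolding cascade_reflection_def by (simp add: sum.distrib)
qed

lemma cascade_reflection_involution:
  assumes "\<gamma> \<in> R" shows "cascade_reflection (cascade_reflection \<gamma>) = \<gamma>"
proof -
  have "cartan_int (cascade_reflection \<gamma>) \<beta> = - cartan_int \<gamma> \<beta>" if "\<beta> \<in> kcascade" for \<beta>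
  proof -
    have "\<beta> \<in> R" using that kcascade_subset P_subset by blast
    then show ?thesis
      using cascade_reflection_ip[OF assms that] cartan_int[of \<beta> \<gamma>] assms by (intro cartan_int_eqI) auto
  qed
  then have "(\<Sum>\<beta>\<in>kcascade. of_int (cartan_int (cascade_reflection \<gamma>) \<beta>) * \<beta>) =
      (\<Sum>\<beta>\<in>kcascade. - (of_int (cartan_int \<gamma> \<beta>) * \<beta>))"
    by (intro sum.cong) auto
  then show ?thesis
    unfolding cascade_reflection_def[of "cascade_reflection \<gamma>"] by (simp add: cascade_reflection_def sum_negf)
qed

text \<open>The map is an additive involution on roots that exchanges positive and negative roots,
  so a decomposition of the image would pull back to one of \<alpha>.\<close>

lemma cascade_reflection_simple:
  assumes "\<alpha> \<in> simple" shows "- cascade_reflection \<alpha> \<in> simple"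
proof -
  have aP: "\<alpha> \<in> P" "\<alpha> \<in> R" using assms simple_subset P_subset by auto
  have "- cascade_reflection \<alpha> \<noteq> \<gamma> + \<delta>" if gd: "\<gamma> \<in> P" "\<delta> \<in> P" for \<gamma> \<delta>
  proof
    assume eq: "- cascade_reflection \<alpha> = \<gamma> + \<delta>"
    have "- \<alpha> = cascade_reflection (- cascade_reflection \<alpha>)"
      using cascade_reflection_minus[OF cascade_reflection_root[OF aP(2)]] cascade_reflection_involution[OF aP(2)]
      by simp
    also have "\<dots> = cascade_reflection \<gamma> + cascade_reflection \<delta>"
      using eq cascade_reflection_add gd P_subset by auto
    finally have "- (- \<alpha>) = - (cascade_reflection \<gamma> + cascade_reflection \<delta>)" by (rule arg_cong)
    then have "\<alpha> = - cascade_reflection \<gamma> + - cascade_reflection \<delta>" by simp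
    then show False using cascade_reflection_neg gd assms unfolding simple_def by blast
  qed
  then show ?thesis using cascade_reflection_neg[OF aP(1)] unfolding simple_def by blast
qed

text \<open>The cascade reflection sends a simple root of degree \<open>1\<close> to the negative of a simple root, hence
  of degree \<open>0\<close> or \<open>1\<close>, while it does not change degrees modulo \<open>d\<close>.\<close>

lemma kcascade_degree_le_2:
  assumes T: "T \<noteq> {}" "T \<subseteq> simple" and d: "\<And>\<beta>. \<beta> \<in> kcascade \<Longrightarrow> deg T \<beta> > 0 \<Longrightarrow> deg T \<beta> = d"
  shows "d \<le> 2"
proof -
  obtain \<alpha> where a: "\<alpha> \<in> T" "\<alpha> \<in> simple" using T by blast
  have K: "\<beta> \<in> lattice" "d dvd deg T \<beta>" if "\<beta> \<in> kcascade" for \<beta>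
  proof -
    have b: "\<beta> \<in> P" using that kcascade_subset by blast
    then show "\<beta> \<in> lattice" by (rule positive_lattice)
    have "deg T \<beta> \<ge> 0" using deg_cone_nonneg[OF T(2) cone_base[OF b]] .
    \<comment> \<open>The remaining cascade roots have degree 0, which \<open>d\<close> divides
      too.\<close>
    then show "d dvd deg T \<beta>" using d[OF that] by (cases "deg T \<beta> > 0") auto
  qed
  define \<eta> where "\<eta> = - cascade_reflection \<alpha>"
  have e: "\<eta> \<in> simple" using cascade_reflection_simple[OF a(2)] unfolding \<eta>_def .
  define s where "s = (\<Sum>\<beta>\<in>kcascade. of_int (cartan_int \<alpha> \<beta>) * \<beta>)"
  have s: "s = \<eta> + \<alpha>" unfolding \<eta>_def cascade_reflection_def s_def by simp
  have "deg T s = (\<Sum>\<beta>\<in>kcascade. cartan_int \<alpha> \<beta> * deg T \<beta>)"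
    unfolding s_def using K(1) by (subst deg_sum[OF T(2)]) (auto simp: lattice_scale deg_scale[OF T(2)])
  then have "d dvd deg T s" using K(2) by (auto intro!: dvd_sum dvd_mult)
  moreover have "deg T s = deg T \<eta> + 1"
    using s deg_add[OF T(2) simple_lattice[OF e] simple_lattice[OF a(2)]] deg_simple[OF T(2) a(2)] a by simp
  moreover have "deg T \<eta> \<in> {0, 1}" using deg_simple[OF T(2) e] by simp
  ultimately have "d dvd 1 \<or> d dvd 2" by auto
  then show ?thesis using zdvd_imp_le[of d] by fastforce
qed

section \<open>Roots below the top degree\<close>

lemma deg_le_highest: "T \<subseteq> simple \<Longrightarrow> \<gamma> \<in> R \<Longrightarrow> deg T \<gamma> \<le> deg T (highest R)"
  using highest_above[OF closed_R irreducible, of \<gamma>] highest_mem[OF closed_R irreducible]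
    deg_diff[of T "highest R" \<gamma>] deg_cone_nonneg[of T "highest R - \<gamma>"] root_lattice P_subset
  by (simp add: inf.absorb2)

text \<open>This is the combinatorial side of computing the centre. Some positive \<delta> can be
  added to \<gamma>. If \<delta> has degree 0, induction gives a root \<delta>' of positive degree
  that can be added to \<gamma> + \<delta>, and \<open>triple_sum_root\<close> shows that \<delta>'
  or \<delta>' + \<delta> can be added to \<gamma> directly.\<close>

lemma extend_to_top_degree:
  assumes T: "T \<subseteq> simple" and "\<gamma> \<in> P" "0 < deg T \<gamma>" "deg T \<gamma> < deg T (highest R)"
  shows "\<exists>\<delta>\<in>P. deg T \<delta> > 0 \<and> \<gamma> + \<delta> \<in> R"
  using assms(2-4)
proof (induction "card {x\<in>P. x - \<gamma> \<in> cone P}" arbitrary: \<gamma> rule: less_induct)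
  case less
  have "\<gamma> \<noteq> highest R" using less.prems by auto
  then have "\<not> maximal_root \<gamma>" using highest_unique[OF closed_R irreducible] by blast
  then obtain \<delta> where d: "\<delta> \<in> P" "\<gamma> + \<delta> \<in> P" using less.prems P_closed unfolding maximal_root_def by blast
  show ?case
  proof (cases "deg T \<delta> > 0")
    case True
    then show ?thesis using d P_subset by blast
  next
    case False
    then have "deg T \<delta> = 0" using deg_cone_nonneg[OF T cone_base[OF d(1)]] by simp
    then have deg: "deg T (\<gamma> + \<delta>) = deg T \<gamma>" using deg_add[OF T] positive_lattice d less.prems by simp
    have up: "x - \<gamma> \<in> cone P" if "x - (\<gamma> + \<delta>) \<in> cone P" for x
      using cone_add[OF that cone_base[OF d(1)]] by simp
    have "\<gamma> - (\<gamma> + \<delta>) \<notin> cone P" using neg_notin_cone[OF d(1)] by simp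
    then have "{x\<in>P. x - (\<gamma> + \<delta>) \<in> cone P} \<subset> {x\<in>P. x - \<gamma> \<in> cone P}"
      using up less.prems cone_zero[of P] diff_self[of \<gamma>]
      by (intro psubsetI) (blast, metis (mono_tags, lifting) mem_Collect_eq)
    then have "card {x\<in>P. x - (\<gamma> + \<delta>) \<in> cone P} < card {x\<in>P. x - \<gamma> \<in> cone P}"
      using finite_P by (intro psubset_card_mono) auto
    then obtain \<delta>' where d': "\<delta>' \<in> P" "deg T \<delta>' > 0" "\<gamma> + \<delta> + \<delta>' \<in> R"
      using less.hyps[of "\<gamma> + \<delta>"] d less.prems deg by auto
    have nz: "x + y \<noteq> 0" if "x \<in> P" "y \<in> P" for x y
      using cone_add_root_nonzero[OF cone_base] that by blast
    have "\<delta>' + \<gamma> \<in> R \<or> \<delta>' + \<delta> \<in> R"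
      using triple_sum_root[of \<delta>' \<gamma> \<delta>] nz d d' less.prems P_subset by (auto simp: algebra_simps)
    then show ?thesis
    proof
      assume "\<delta>' + \<gamma> \<in> R"
      then show ?thesis using d' by (auto simp: add.commute)
    next
      assume *: "\<delta>' + \<delta> \<in> R"
      then have "\<delta>' + \<delta> \<in> P" using P_closed d d' by blast
      moreover have "deg T (\<delta>' + \<delta>) > 0" using deg_add[OF T] positive_lattice d d' \<open>deg T \<delta> = 0\<close> by simp
      ultimately show ?thesis using d' by (intro bexI[of _ "\<delta>' + \<delta>"]) (auto simp: algebra_simps)
    qed
  qed
qed

end

section \<open>Traces and weight spaces\<close>

lemma bracket_zero_left [simp]: "bracket 0 y = (0::'a::complex_lie_algebra)"
  using bracket_add_left[of 0 0 y] by simp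

lemma bracket_zero_right [simp]: "bracket x 0 = (0::'a::complex_lie_algebra)"
  using bracket_add_right[of x 0 0] by simp

lemma bracket_minus_left [simp]: "bracket (- x) y = - bracket x (y::'a::complex_lie_algebra)"
  using bracket_add_left[of x "- x" y] by (simp add: eq_neg_iff_add_eq_0 add.commute)

lemma bracket_minus_right [simp]: "bracket x (- y) = - bracket x (y::'a::complex_lie_algebra)"
  using bracket_add_right[of x y "- y"] by (simp add: eq_neg_iff_add_eq_0 add.commute)

lemma bracket_diff_right: "bracket x (y - z) = bracket x y - bracket x (z::'a::complex_lie_algebra)"
  using bracket_add_right[of x y "- z"] by simp

lemma bracket_sum_left: "bracket (sum f I) y = (\<Sum>i\<in>I. bracket (f i) (y::'a::complex_lie_algebra))"
  by (induction I rule: infinite_finite_induct) (auto simp: bracket_add_left)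

lemma bracket_sum_right: "bracket y (sum f I) = (\<Sum>i\<in>I. bracket (y::'a::complex_lie_algebra) (f i))"
  by (induction I rule: infinite_finite_induct) (auto simp: bracket_add_right)

lemma bracket_skew: "bracket x y = - bracket y (x::'a::complex_lie_algebra)"
proof -
  have "bracket (x + y) (x + y) = bracket x y + bracket y x"
    unfolding bracket_add_left bracket_add_right by (simp add: bracket_self)
  then show ?thesis by (simp add: bracket_self eq_neg_iff_add_eq_0)
qed

lemma bracket_bracket:
  "bracket (bracket x y) z = bracket x (bracket y z) - bracket y (bracket x (z::'a::complex_lie_algebra))"
  using jacobi[of x y z] bracket_skew[of z "bracket x y"] bracket_skew[of z x]
  by (simp add: algebra_simps)

section \<open>Endomorphisms and traces\<close>

definition endo :: "('a::complex_lie_algebra \<Rightarrow> 'a) \<Rightarrow> bool" where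
  "endo f \<longleftrightarrow> (\<forall>x y. f (x + y) = f x + f y) \<and> (\<forall>c x. f (scaleC c x) = scaleC c (f x))"

lemma endo_add: "endo f \<Longrightarrow> f (x + y) = f x + f y"
  and endo_scale: "endo f \<Longrightarrow> f (scaleC c x) = scaleC c (f x)"
  unfolding endo_def by auto

lemma endo_zero: "endo f \<Longrightarrow> f 0 = 0"
  using endo_add[of f 0 0] by simp

lemma endo_sum: "endo f \<Longrightarrow> f (sum g I) = (\<Sum>i\<in>I. f (g i))"
  by (induction I rule: infinite_finite_induct) (auto simp: endo_add endo_zero)

lemma endo_bracket: "endo (bracket x)"
  unfolding endo_def by (auto simp: bracket_add_right bracket_scaleC_right)

lemma endo_comp: "endo f \<Longrightarrow> endo g \<Longrightarrow> endo (\<lambda>x. f (g x))"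
  unfolding endo_def by auto

lemma finite_extend_basis:
  assumes "finite B" "cspan B = (UNIV :: 'a::complex_lie_algebra set)"
  shows "finite (cextend_basis {} :: 'a set)"
proof -
  have "complex_vector.independent (cextend_basis {} :: 'a set)"
    by (rule complex_vector.independent_extend_basis[OF complex_vector.independent_empty])
  then show ?thesis using complex_vector.independent_span_bound[OF assms(1)] assms(2) by auto
qed

lemma endo_trace_add: "endo_trace (\<lambda>x. f x + g x) = endo_trace f + endo_trace (g :: 'a::complex_lie_algebra \<Rightarrow> 'a)"
  unfolding endo_trace_def
  by (simp add: complex_vector.representation_add complex_vector.independent_extend_basis
      complex_vector.independent_empty complex_vector.span_extend_basis sum.distrib)

lemma endo_trace_scale: "endo_trace (\<lambda>x. scaleC c (f x)) = c * endo_trace (f :: 'a::complex_lie_algebra \<Rightarrow> 'a)"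
  unfolding endo_trace_def
  by (simp add: complex_vector.representation_scale complex_vector.independent_extend_basis
      complex_vector.independent_empty complex_vector.span_extend_basis sum_distrib_left)

lemma endo_trace_zero: "endo_trace (\<lambda>x. 0) = 0"
  using endo_trace_add[of "\<lambda>x. 0" "\<lambda>x. 0"] by simp

lemma endo_trace_diff: "endo_trace (\<lambda>x. f x - g x) = endo_trace f - endo_trace (g :: 'a::complex_lie_algebra \<Rightarrow> 'a)"
  using endo_trace_add[of "\<lambda>x. f x - g x" g] by simp

lemma endo_trace_sum:
  "endo_trace (\<lambda>x. \<Sum>i\<in>I. f i x) = (\<Sum>i\<in>I. endo_trace (f i :: 'a::complex_lie_algebra \<Rightarrow> 'a))"
  by (induction I rule: infinite_finite_induct) (auto simp: endo_trace_zero endo_trace_add)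

lemma extend_basis_expand:
  assumes "finite (cextend_basis {} :: 'a::complex_lie_algebra set)"
  shows "(\<Sum>b\<in>cextend_basis {}. scaleC (crepresentation (cextend_basis {}) x b) b) = (x::'a)"
  by (rule complex_vector.sum_representation_eq)
    (auto simp: assms complex_vector.independent_extend_basis complex_vector.independent_empty
      complex_vector.span_extend_basis)

lemma extend_basis_representation_sum:
  "crepresentation (cextend_basis {} :: 'a::complex_lie_algebra set) (\<Sum>i\<in>I. scaleC (c i) (v i)) b =
    (\<Sum>i\<in>I. c i * crepresentation (cextend_basis {}) (v i) b)"
  by (simp add: complex_vector.representation_sum complex_vector.representation_scale
      complex_vector.independent_extend_basis complex_vector.independent_empty complex_vector.span_extend_basis)

lemma endo_trace_comm:
  fixes f g :: "'a::complex_lie_algebra \<Rightarrow> 'a"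
  assumes fin: "finite (cextend_basis {} :: 'a set)" and "endo f" "endo g"
  shows "endo_trace (\<lambda>x. f (g x)) = endo_trace (\<lambda>x. g (f x))"
proof -
  let ?B = "cextend_basis {} :: 'a set"
  let ?r = "crepresentation ?B"
  have *: "endo_trace (\<lambda>x. f (g x)) = (\<Sum>b\<in>?B. \<Sum>c\<in>?B. ?r (g b) c * ?r (f c) b)" if "endo f" for f g
  proof -
    have "?r (f (g b)) b = (\<Sum>c\<in>?B. ?r (g b) c * ?r (f c) b)" for b
    proof -
      have "f (g b) = f (\<Sum>c\<in>?B. scaleC (?r (g b) c) c)" by (simp add: extend_basis_expand[OF fin])
      also have "\<dots> = (\<Sum>c\<in>?B. scaleC (?r (g b) c) (f c))" by (simp add: endo_sum[OF that] endo_scale[OF that])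
      finally show ?thesis by (simp add: extend_basis_representation_sum)
    qed
    then show ?thesis unfolding endo_trace_def by simp
  qed
  show ?thesis
    unfolding *[OF assms(2)] *[OF assms(3)] by (subst sum.swap) (simp add: mult.commute)
qed

text \<open>Makes traces independent of the arbitrary basis: an operator written as a sum of rank
  one maps in any convenient basis can be evaluated term by term.\<close>

lemma endo_trace_rank_one:
  fixes v :: "'a::complex_lie_algebra"
  assumes fin: "finite (cextend_basis {} :: 'a set)"
    and \<phi>: "\<And>x y. \<phi> (x + y) = \<phi> x + \<phi> y" "\<And>c x. \<phi> (scaleC c x) = c * \<phi> x"
  shows "endo_trace (\<lambda>x. scaleC (\<phi> x) v) = \<phi> v"
proof -
  let ?B = "cextend_basis {} :: 'a set"
  let ?r = "crepresentation ?B"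
  have 0: "\<phi> 0 = 0" using \<phi>(1)[of 0 0] by simp
  have sum: "\<phi> (sum g I) = (\<Sum>i\<in>I. \<phi> (g i))" for g :: "'a \<Rightarrow> 'a" and I
    by (induction I rule: infinite_finite_induct) (auto simp: \<phi> 0)
  have "endo_trace (\<lambda>x. scaleC (\<phi> x) v) = (\<Sum>b\<in>?B. \<phi> b * ?r v b)"
    unfolding endo_trace_def
    by (simp add: complex_vector.representation_scale complex_vector.independent_extend_basis
      complex_vector.independent_empty complex_vector.span_extend_basis)
  also have "\<dots> = \<phi> (\<Sum>b\<in>?B. scaleC (?r v b) b)" by (simp add: sum \<phi> mult.commute)
  finally show ?thesis by (simp add: extend_basis_expand[OF fin])
qed

lemma endo_trace_projection:
  fixes p :: "'a::complex_lie_algebra \<Rightarrow> 'a"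
  assumes fin: "finite (cextend_basis {} :: 'a set)" and p: "endo p" "\<And>x. p x \<in> V" "\<And>x. x \<in> V \<Longrightarrow> p x = x"
    and V: "csubspace V"
  shows "endo_trace p = of_nat (cdim V)"
proof -
  obtain B where B: "B \<subseteq> V" "complex_vector.independent B" "V \<subseteq> cspan B" "card B = cdim V"
    using complex_vector.basis_exists by blast
  have finB: "finite B"
    using complex_vector.independent_span_bound[OF fin B(2)]
    by (simp add: complex_vector.span_extend_basis complex_vector.independent_empty)
  have in_span: "p x \<in> cspan B" for x using p(2) B(3) by blast
  let ?r = "crepresentation B"
  have "p = (\<lambda>x. \<Sum>b\<in>B. scaleC (?r (p x) b) b)"
    using complex_vector.sum_representation_eq[OF B(2) in_span finB] by auto
  then have "endo_trace p = (\<Sum>b\<in>B. endo_trace (\<lambda>x. scaleC (?r (p x) b) b))"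
    using endo_trace_sum[of "\<lambda>b x. scaleC (?r (p x) b) b" B] by simp
  also have "\<dots> = (\<Sum>b\<in>B. ?r (p b) b)"
    by (intro sum.cong refl endo_trace_rank_one[OF fin])
      (auto simp: endo_add[OF p(1)] endo_scale[OF p(1)] complex_vector.representation_add[OF B(2)]
        complex_vector.representation_scale[OF B(2)] in_span)
  also have "\<dots> = (\<Sum>b\<in>B. 1)"
    using B(1) p(3) complex_vector.representation_basis[OF B(2)] by (intro sum.cong) auto
  finally show ?thesis using B(4) by simp
qed

text \<open>For a projection \<open>p\<close> the two conditions say that its image is invariant
  under \<open>e\<close> and \<open>f\<close>, and the trace is that of ad [e, f] on the image.
  There ad [e, f] is the commutator of two endomorphisms.\<close>

lemma endo_trace_commutator_zero:
  fixes p :: "'a::complex_lie_algebra \<Rightarrow> 'a"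
  assumes fin: "finite (cextend_basis {} :: 'a set)" and p: "endo p"
    and e: "\<And>x. p (bracket e (p x)) = bracket e (p x)" and f: "\<And>x. p (bracket f (p x)) = bracket f (p x)"
  shows "endo_trace (\<lambda>x. bracket (bracket e f) (p x)) = 0"
proof -
  have ep: "endo (\<lambda>x. bracket e (p x))" and fp: "endo (\<lambda>x. bracket f (p x))"
    using endo_comp[OF endo_bracket p] by auto
  have "endo_trace (\<lambda>x. bracket (bracket e f) (p x)) =
      endo_trace (\<lambda>x. bracket e (p (bracket f (p x)))) - endo_trace (\<lambda>x. bracket f (p (bracket e (p x))))"
    unfolding bracket_bracket endo_trace_diff e f by simp
  then show ?thesis using endo_trace_comm[OF fin ep fp] by simp
qed

section \<open>Invariance and bilinearity of the Killing form\<close>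

lemma killing_form_sym:
  assumes "finite (cextend_basis {} :: 'a::complex_lie_algebra set)"
  shows "killing_form x y = killing_form y (x::'a)"
  unfolding killing_form_def by (rule endo_trace_comm[OF assms endo_bracket endo_bracket])

lemma killing_form_invariant:
  fixes x y z :: "'a::complex_lie_algebra"
  assumes "finite (cextend_basis {} :: 'a set)"
  shows "killing_form (bracket x y) z = killing_form x (bracket y z)"
proof -
  have "endo_trace (\<lambda>v. bracket y (bracket x (bracket z v))) = endo_trace (\<lambda>v. bracket x (bracket z (bracket y v)))"
    using endo_trace_comm[OF assms endo_bracket endo_comp[OF endo_bracket endo_bracket], of y x z] .
  then show ?thesis unfolding killing_form_def bracket_bracket bracket_diff_right endo_trace_diff by simp
qed

lemma killing_form_add_left: "killing_form (x + y) z = killing_form x z + killing_form y z"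
  unfolding killing_form_def bracket_add_left by (rule endo_trace_add)

lemma killing_form_scale_left: "killing_form (scaleC c x) z = c * killing_form x z"
  unfolding killing_form_def bracket_scaleC_left by (rule endo_trace_scale)

lemma killing_form_add_right: "killing_form z (x + y) = killing_form z x + killing_form z y"
  unfolding killing_form_def bracket_add_left bracket_add_right by (rule endo_trace_add)

lemma killing_form_scale_right: "killing_form z (scaleC c x) = c * killing_form z x"
  unfolding killing_form_def bracket_scaleC_left bracket_scaleC_right by (rule endo_trace_scale)

section \<open>Weight spaces\<close>

lemma root_space_subspace: "csubspace (root_space t \<gamma>)"
  unfolding complex_vector.subspace_def root_space_def
  by (auto simp: bracket_add_right bracket_scaleC_right scaleC_add_right scaleC_scaleC mult.commute)

lemma root_space_zero: "0 \<in> root_space t \<gamma>"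
  using root_space_subspace complex_vector.subspace_0 by blast

lemma root_space_add: "x \<in> root_space t \<gamma> \<Longrightarrow> y \<in> root_space t \<gamma> \<Longrightarrow> x + y \<in> root_space t \<gamma>"
  by (rule complex_vector.subspace_add[OF root_space_subspace])

lemma root_space_scale: "x \<in> root_space t \<gamma> \<Longrightarrow> scaleC c x \<in> root_space t \<gamma>"
  by (rule complex_vector.subspace_scale[OF root_space_subspace])

lemma root_space_bracket:
  assumes "x \<in> root_space t \<gamma>" "y \<in> root_space t \<delta>"
  shows "bracket x y \<in> root_space t (\<gamma> + \<delta>)"
proof -
  have "bracket h (bracket x y) = scaleC ((\<gamma> + \<delta>) h) (bracket x y)" if "h \<in> t" for h
  proof -
    have "bracket h (bracket x y) = bracket (bracket h x) y + bracket x (bracket h y)"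
      by (simp add: bracket_bracket)
    also have "\<dots> = scaleC ((\<gamma> + \<delta>) h) (bracket x y)"
      using assms that unfolding root_space_def by (simp add: bracket_scaleC_left bracket_scaleC_right scaleC_add_left)
    finally show ?thesis .
  qed
  then show ?thesis unfolding root_space_def by blast
qed

text \<open>Applying ad h - \<gamma>(h) with h separating two weights removes one term of the
  relation and rescales the others. The set \<open>t\<close> is arbitrary, so that eigenvectors of
  one element are covered by taking a singleton.\<close>

lemma weight_vectors_independent:
  assumes "finite G" "\<And>\<gamma>. \<gamma> \<in> G \<Longrightarrow> x \<gamma> \<in> root_space t \<gamma>"
    and "\<And>\<gamma> \<delta>. \<gamma> \<in> G \<Longrightarrow> \<delta> \<in> G \<Longrightarrow> \<gamma> \<noteq> \<delta> \<Longrightarrow> \<exists>h\<in>t. \<gamma> h \<noteq> \<delta> h"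
    and "(\<Sum>\<gamma>\<in>G. x \<gamma>) = 0"
  shows "\<forall>\<gamma>\<in>G. x \<gamma> = 0"
  using assms
proof (induction arbitrary: x rule: finite_induct)
  case (insert \<gamma> G)
  have sum0: "x \<gamma> + (\<Sum>\<delta>\<in>G. x \<delta>) = 0" using insert.prems(3) insert.hyps by simp
  have x0: "x \<delta>0 = 0" if d0: "\<delta>0 \<in> G" for \<delta>0
  proof -
    have "\<gamma> \<noteq> \<delta>0" using insert.hyps(2) d0 by blast
    then obtain h where h: "h \<in> t" "\<gamma> h \<noteq> \<delta>0 h" using insert.prems(2)[of \<gamma> \<delta>0] d0 by auto
    let ?y = "\<lambda>\<delta>. scaleC (\<delta> h - \<gamma> h) (x \<delta>)"
    have w: "bracket h (x \<delta>) = scaleC (\<delta> h) (x \<delta>)" if "\<delta> \<in> insert \<gamma> G" for \<delta>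
      using insert.prems(1)[OF that] h unfolding root_space_def by blast
    have "bracket h (x \<gamma> + (\<Sum>\<delta>\<in>G. x \<delta>)) = scaleC (\<gamma> h) (x \<gamma>) + (\<Sum>\<delta>\<in>G. scaleC (\<delta> h) (x \<delta>))"
      unfolding bracket_add_right bracket_sum_right using w by (intro arg_cong2[of _ _ _ _ "(+)"] sum.cong) auto
    moreover have "scaleC (\<gamma> h) (x \<gamma> + (\<Sum>\<delta>\<in>G. x \<delta>)) = scaleC (\<gamma> h) (x \<gamma>) + (\<Sum>\<delta>\<in>G. scaleC (\<gamma> h) (x \<delta>))"
      by (simp add: scaleC_add_right complex_vector.scale_sum_right)
    ultimately have "(\<Sum>\<delta>\<in>G. scaleC (\<delta> h) (x \<delta>)) = (\<Sum>\<delta>\<in>G. scaleC (\<gamma> h) (x \<delta>))"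
      unfolding sum0 by (simp add: add_eq_0_iff)
    then have "(\<Sum>\<delta>\<in>G. ?y \<delta>) = 0"
      by (simp add: complex_vector.scale_left_diff_distrib sum_subtractf)
    moreover have "?y \<delta> \<in> root_space t \<delta>" if "\<delta> \<in> G" for \<delta>
      using root_space_scale insert.prems(1) that by blast
    ultimately have "\<forall>\<delta>\<in>G. ?y \<delta> = 0" using insert.prems(2) by (intro insert.IH) auto
    then show ?thesis using d0 h by (auto simp: complex_vector.scale_eq_0_iff)
  qed
  then show ?case using sum0 by auto
qed simp

lemma span_Union_weight_spaces:
  assumes "x \<in> cspan (\<Union>\<gamma>\<in>G. root_space t \<gamma>)" "finite G"
  shows "\<exists>f. (\<forall>\<gamma>\<in>G. f \<gamma> \<in> root_space t \<gamma>) \<and> x = (\<Sum>\<gamma>\<in>G. f \<gamma>)"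
proof -
  let ?W = "{x. \<exists>f. (\<forall>\<gamma>\<in>G. f \<gamma> \<in> root_space t \<gamma>) \<and> x = (\<Sum>\<gamma>\<in>G. f \<gamma>)}"
  have sub: "csubspace ?W"
    unfolding complex_vector.subspace_def
  proof (intro conjI ballI allI)
    show "0 \<in> ?W" using root_space_zero by (intro CollectI exI[of _ "\<lambda>_. 0"]) auto
  next
    fix x y assume "x \<in> ?W" "y \<in> ?W"
    then obtain f g where "\<forall>\<gamma>\<in>G. f \<gamma> \<in> root_space t \<gamma>" "x = sum f G" "\<forall>\<gamma>\<in>G. g \<gamma> \<in> root_space t \<gamma>" "y = sum g G"
      by blast
    then show "x + y \<in> ?W"
      by (intro CollectI exI[of _ "\<lambda>\<gamma>. f \<gamma> + g \<gamma>"]) (auto simp: sum.distrib root_space_add)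
  next
    fix c x assume "x \<in> ?W"
    then obtain f where "\<forall>\<gamma>\<in>G. f \<gamma> \<in> root_space t \<gamma>" "x = sum f G" by blast
    then show "scaleC c x \<in> ?W"
      by (intro CollectI exI[of _ "\<lambda>\<gamma>. scaleC c (f \<gamma>)"])
        (auto simp: complex_vector.scale_sum_right root_space_scale)
  qed
  have "(\<Union>\<gamma>\<in>G. root_space t \<gamma>) \<subseteq> ?W"
  proof
    fix y assume "y \<in> (\<Union>\<gamma>\<in>G. root_space t \<gamma>)"
    then obtain \<gamma> where g: "\<gamma> \<in> G" "y \<in> root_space t \<gamma>" by blast
    then show "y \<in> ?W"
      using assms(2) by (intro CollectI exI[of _ "\<lambda>\<delta>. if \<delta> = \<gamma> then y else 0"]) (auto simp: root_space_zero)
  qed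
  then have "cspan (\<Union>\<gamma>\<in>G. root_space t \<gamma>) \<subseteq> ?W" using sub by (rule complex_vector.span_minimal)
  then show ?thesis using assms(1) by blast
qed

text \<open>A diagonalisable operator has no nilpotent part: in the eigenvector expansion of x, a
  vanishing c^2 x_c gives a vanishing c x_c.\<close>

lemma ad_semisimple_square_zero:
  assumes "ad_semisimple h" "bracket h (bracket h x) = 0"
  shows "bracket h x = 0"
proof -
  \<comment> \<open>Eigenspaces are written as weight spaces of \<open>{h}\<close> for constant
    functions, which makes the lemmas on weight spaces applicable.\<close>
  let ?E = "\<lambda>c::complex. root_space {h} (\<lambda>_. c)"
  have E: "{x. \<exists>c. bracket h x = scaleC c x} = (\<Union>c. ?E c)" unfolding root_space_def by auto
  then have "x \<in> cspan (\<Union>c. ?E c)" using assms(1) unfolding ad_semisimple_def by simp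
  then obtain S r where S: "finite S" "S \<subseteq> (\<Union>c. ?E c)" "x = (\<Sum>v\<in>S. scaleC (r v) v)"
    unfolding complex_vector.span_explicit by blast
  have "\<forall>v\<in>S. \<exists>c. v \<in> ?E c" using S(2) by blast
  then obtain c where c: "\<forall>v\<in>S. v \<in> ?E (c v)" by (rule bchoice[THEN exE])
  let ?G = "(\<lambda>v _. c v) ` S :: ('a \<Rightarrow> complex) set"
  have "v \<in> cspan (\<Union>\<gamma>\<in>?G. root_space {h} \<gamma>)" if "v \<in> S" for v
    using c that by (intro complex_vector.span_base UN_I[of "\<lambda>_. c v"]) auto
  then have "x \<in> cspan (\<Union>\<gamma>\<in>?G. root_space {h} \<gamma>)"
    unfolding S(3) by (intro complex_vector.span_sum complex_vector.span_scale)
  then obtain f where f: "\<forall>\<gamma>\<in>?G. f \<gamma> \<in> root_space {h} \<gamma>" "x = (\<Sum>\<gamma>\<in>?G. f \<gamma>)"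
    using span_Union_weight_spaces[of x "{h}" ?G] S(1) by (metis (no_types, lifting) finite_imageI)
  have b: "bracket h (f \<gamma>) = scaleC (\<gamma> h) (f \<gamma>)" if "\<gamma> \<in> ?G" for \<gamma>
    using f(1) that unfolding root_space_def by blast
  have bx: "bracket h x = (\<Sum>\<gamma>\<in>?G. scaleC (\<gamma> h) (f \<gamma>))"
    unfolding f(2) bracket_sum_right using b by (intro sum.cong) auto
  have "(\<Sum>\<gamma>\<in>?G. scaleC (\<gamma> h) (scaleC (\<gamma> h) (f \<gamma>))) = bracket h (bracket h x)"
    unfolding bx bracket_sum_right using b by (intro sum.cong) (auto simp: bracket_scaleC_right)
  also have "\<dots> = 0" by (rule assms(2))
  finally have 0: "(\<Sum>\<gamma>\<in>?G. scaleC (\<gamma> h) (scaleC (\<gamma> h) (f \<gamma>))) = 0" .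
  have "\<forall>\<gamma>\<in>?G. scaleC (\<gamma> h) (scaleC (\<gamma> h) (f \<gamma>)) = 0"
    by (rule weight_vectors_independent[where t = "{h}", OF _ _ _ 0])
      (use S(1) f(1) in \<open>auto simp: root_space_scale\<close>)
  then have "scaleC (\<gamma> h) (f \<gamma>) = 0" if "\<gamma> \<in> ?G" for \<gamma>
    using that by (auto simp: complex_vector.scale_eq_0_iff)
  then show ?thesis unfolding bx by (intro sum.neutral) blast
qed

section \<open>Functionals on a subspace\<close>

lemma linear_dual_add: "\<gamma> \<in> linear_dual t \<Longrightarrow> \<delta> \<in> linear_dual t \<Longrightarrow> \<gamma> + \<delta> \<in> linear_dual t"
  unfolding linear_dual_def by (auto simp: algebra_simps)

lemma linear_dual_minus: "\<gamma> \<in> linear_dual t \<Longrightarrow> - \<gamma> \<in> linear_dual t"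
  unfolding linear_dual_def by auto

lemma linear_dual_zero: "0 \<in> linear_dual t"
  unfolding linear_dual_def by auto

lemma of_int_fun: "(of_int n :: 'a \<Rightarrow> complex) h = of_int n"
proof (cases n)
  case (nonneg m)
  have "(of_nat m :: 'a \<Rightarrow> complex) h = of_nat m" by (induction m) auto
  then show ?thesis using nonneg by simp
next
  case (neg m)
  have "(of_nat m :: 'a \<Rightarrow> complex) h = of_nat m" for m by (induction m) auto
  then show ?thesis using neg by (metis of_int_minus of_int_of_nat_eq uminus_apply)
qed

lemma linear_dual_scale: "\<gamma> \<in> linear_dual t \<Longrightarrow> of_int n * \<gamma> \<in> linear_dual t"
  unfolding linear_dual_def by (auto simp: of_int_fun algebra_simps)

lemma linear_dual_eqI: "\<gamma> \<in> linear_dual t \<Longrightarrow> \<delta> \<in> linear_dual t \<Longrightarrow> (\<And>h. h \<in> t \<Longrightarrow> \<gamma> h = \<delta> h) \<Longrightarrow> \<gamma> = \<delta>"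
  unfolding linear_dual_def by (rule ext) (metis (mono_tags, lifting) mem_Collect_eq)

section \<open>Weight decomposition and Killing form\<close>

lemma root_space_diff: "x \<in> root_space t \<gamma> \<Longrightarrow> y \<in> root_space t \<gamma> \<Longrightarrow> x - y \<in> root_space t \<gamma>"
  by (rule complex_vector.subspace_diff[OF root_space_subspace])

locale simple_triangular =
  fixes u t u' :: "'g::complex_lie_algebra set"
  assumes simple_g: "simple_lie_algebra TYPE('g)"
    and triangular: "triangular_decomposition u t u'"
begin

abbreviation "\<Delta> \<equiv> roots t"
abbreviation "\<Delta>p \<equiv> roots_of t u"
abbreviation "V \<equiv> root_space t"
abbreviation "\<Gamma> \<equiv> insert 0 (roots t)"

lemma finite_basis: "finite (cextend_basis {} :: 'g set)"
  using simple_g finite_extend_basis unfolding simple_lie_algebra_def by blast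

lemma nonabelian: "\<exists>x y :: 'g. bracket x y \<noteq> 0"
  using simple_g unfolding simple_lie_algebra_def by blast

lemma ideal_trivial: "lie_ideal (I :: 'g set) \<Longrightarrow> I = {0} \<or> I = UNIV"
  using simple_g unfolding simple_lie_algebra_def by blast

lemma t_subspace: "csubspace t"
  and t_bracket_closed: "x \<in> t \<Longrightarrow> y \<in> t \<Longrightarrow> bracket x y \<in> t"
  and t_semisimple: "h \<in> t \<Longrightarrow> ad_semisimple h"
  using triangular
  unfolding triangular_decomposition_def cartan_subalgebra_def toral_def lie_subalgebra_def by auto

lemma t_add: "x \<in> t \<Longrightarrow> y \<in> t \<Longrightarrow> x + y \<in> t"
  and t_scale: "x \<in> t \<Longrightarrow> scaleC c x \<in> t"
  and t_zero: "0 \<in> t"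
  using t_subspace complex_vector.subspace_add complex_vector.subspace_scale complex_vector.subspace_0 by blast+

lemma t_diff: "x \<in> t \<Longrightarrow> y \<in> t \<Longrightarrow> x - y \<in> t"
  using t_subspace complex_vector.subspace_diff by blast

lemma positive: "positive_system t \<Delta>p"
  and u_def: "u = cspan (\<Union>\<gamma>\<in>\<Delta>p. V \<gamma>)"
  and u'_def: "u' = cspan (\<Union>\<gamma>\<in>\<Delta>p. V (- \<gamma>))"
  using triangular unfolding triangular_decomposition_def by auto

lemma decompose: obtains a h b where "a \<in> u" "h \<in> t" "b \<in> u'" "x = a + h + b"
proof -
  have "\<exists>!(a, h, b). a \<in> u \<and> h \<in> t \<and> b \<in> u' \<and> x = a + h + b"
    using triangular unfolding triangular_decomposition_def by (elim conjE) (rule spec)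
  then obtain p where "case p of (a, h, b) \<Rightarrow> a \<in> u \<and> h \<in> t \<and> b \<in> u' \<and> x = a + h + b"
    by (rule ex1E)
  then show ?thesis using that by (cases p) auto
qed

lemma root_dual: "\<gamma> \<in> \<Delta> \<Longrightarrow> \<gamma> \<in> linear_dual t"
  and root_nonzero: "\<gamma> \<in> \<Delta> \<Longrightarrow> \<gamma> \<noteq> 0"
  and zero_notin_roots: "0 \<notin> \<Delta>"
  unfolding roots_def by auto

lemma \<Gamma>_dual: "\<gamma> \<in> \<Gamma> \<Longrightarrow> \<gamma> \<in> linear_dual t"
  using root_dual linear_dual_zero by auto

lemma dual_add: "\<gamma> \<in> linear_dual t \<Longrightarrow> x \<in> t \<Longrightarrow> y \<in> t \<Longrightarrow> \<gamma> (x + y) = \<gamma> x + \<gamma> y"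
  and dual_scale: "\<gamma> \<in> linear_dual t \<Longrightarrow> x \<in> t \<Longrightarrow> \<gamma> (scaleC c x) = c * \<gamma> x"
  unfolding linear_dual_def by auto

lemma dual_zero: "\<gamma> \<in> linear_dual t \<Longrightarrow> \<gamma> 0 = 0"
  using dual_scale[of \<gamma> 0 0] t_zero by simp

lemma dual_separate:
  assumes "\<gamma> \<in> linear_dual t" "\<delta> \<in> linear_dual t" "\<gamma> \<noteq> \<delta>" shows "\<exists>h\<in>t. \<gamma> h \<noteq> \<delta> h"
  using linear_dual_eqI[OF assms(1,2)] assms(3) by blast

lemma root_vector_exists: "\<gamma> \<in> \<Delta> \<Longrightarrow> \<exists>e\<in>V \<gamma>. e \<noteq> 0"
  using root_space_zero[of t \<gamma>] unfolding roots_def by fast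

lemma root_space_trivial: "\<gamma> \<in> linear_dual t \<Longrightarrow> \<gamma> \<notin> \<Gamma> \<Longrightarrow> x \<in> V \<gamma> \<Longrightarrow> x = 0"
  unfolding roots_def by blast

lemma root_space_act: "x \<in> V \<gamma> \<Longrightarrow> h \<in> t \<Longrightarrow> bracket h x = scaleC (\<gamma> h) x"
  unfolding root_space_def by blast

lemma positive_union: "\<Delta>p \<union> uminus ` \<Delta>p = \<Delta>"
  using positive unfolding positive_system_def by (elim conjE)

lemma root_cases:
  assumes "\<gamma> \<in> \<Delta>" shows "\<gamma> \<in> \<Delta>p \<or> - \<gamma> \<in> \<Delta>p"
proof -
  have "\<gamma> \<in> \<Delta>p \<union> uminus ` \<Delta>p" unfolding positive_union by (rule assms)
  then show ?thesis
  proof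
    assume "\<gamma> \<in> uminus ` \<Delta>p"
    then obtain \<delta> where "\<delta> \<in> \<Delta>p" "\<gamma> = - \<delta>" by (rule imageE)
    then show ?thesis by (simp only: minus_minus simp_thms)
  qed (rule disjI1)
qed

lemma minus_root:
  assumes "\<gamma> \<in> \<Delta>" shows "- \<gamma> \<in> \<Delta>"
proof -
  have "- \<gamma> \<in> \<Delta>p \<union> uminus ` \<Delta>p"
    using root_cases[OF assms]
  proof
    assume "\<gamma> \<in> \<Delta>p" then show ?thesis by (intro UnI2 imageI)
  qed (rule UnI1)
  then show ?thesis unfolding positive_union .
qed

lemma positive_subset: "\<Delta>p \<subseteq> \<Delta>"
  unfolding roots_of_def by blast

lemma weights_independent:
  assumes "finite G" "G \<subseteq> \<Gamma>" "\<And>\<gamma>. \<gamma> \<in> G \<Longrightarrow> f \<gamma> \<in> V \<gamma>" "(\<Sum>\<gamma>\<in>G. f \<gamma>) = 0" "\<gamma> \<in> G"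
  shows "f \<gamma> = 0"
proof -
  have sep: "\<exists>h\<in>t. \<gamma> h \<noteq> \<delta> h" if "\<gamma> \<in> G" "\<delta> \<in> G" "\<gamma> \<noteq> \<delta>" for \<gamma> \<delta>
    using that assms(2) by (intro dual_separate \<Gamma>_dual) auto
  have "\<forall>\<gamma>\<in>G. f \<gamma> = 0" by (rule weight_vectors_independent[of G f t, OF assms(1) assms(3) sep assms(4)])
  then show ?thesis using assms(5) by blast
qed

lemma finite_roots: "finite \<Delta>"
proof (rule ccontr)
  assume inf: "infinite \<Delta>"
  let ?B = "cextend_basis {} :: 'g set"
  obtain F where F: "F \<subseteq> \<Delta>" "finite F" "card F = Suc (card ?B)"
    using infinite_arbitrarily_large[OF inf] by blast
  have "\<forall>\<gamma>\<in>\<Delta>. \<exists>e. e \<in> V \<gamma> \<and> e \<noteq> 0" using root_vector_exists by blast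
  then obtain e where e: "\<forall>\<gamma>\<in>\<Delta>. e \<gamma> \<in> V \<gamma> \<and> e \<gamma> \<noteq> 0" by (rule bchoice[THEN exE])
  have inj: "inj_on e F"
  proof (rule inj_onI, rule ccontr)
    fix \<gamma> \<delta> assume *: "\<gamma> \<in> F" "\<delta> \<in> F" "e \<gamma> = e \<delta>" "\<gamma> \<noteq> \<delta>"
    then have "\<gamma> \<in> \<Delta>" "\<delta> \<in> \<Delta>" using F by auto
    then have ee: "e \<gamma> \<in> V \<gamma>" "e \<gamma> \<in> V \<delta>" "e \<gamma> \<noteq> 0" using e *(3) by (auto dest: bspec)
    obtain h where h: "h \<in> t" "\<gamma> h \<noteq> \<delta> h" using dual_separate[of \<gamma> \<delta>] root_dual * F by blast
    have "scaleC (\<gamma> h) (e \<gamma>) = scaleC (\<delta> h) (e \<gamma>)"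
      using root_space_act[OF ee(1) h(1)] root_space_act[OF ee(2) h(1)] by (rule subst)
    then show False using h(2) ee(3) by (simp only: complex_vector.scale_cancel_right) simp
  qed
  have "complex_vector.independent (e ` F)"
  proof (rule complex_vector.independent_if_scalars_zero)
    show "finite (e ` F)" using F by simp
    fix c x assume s: "(\<Sum>x\<in>e ` F. scaleC (c x) x) = 0" and x: "x \<in> e ` F"
    then obtain \<gamma> where \<gamma>: "\<gamma> \<in> F" "x = e \<gamma>" by blast
    have "(\<Sum>\<gamma>\<in>F. scaleC (c (e \<gamma>)) (e \<gamma>)) = 0" using s by (simp add: sum.reindex[OF inj])
    then have "scaleC (c (e \<gamma>)) (e \<gamma>) = 0"
      using F e \<gamma> by (intro weights_independent[of F "\<lambda>\<gamma>. scaleC (c (e \<gamma>)) (e \<gamma>)"] root_space_scale) auto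
    then show "c x = 0" using e \<gamma> F by (auto simp: complex_vector.scale_eq_0_iff)
  qed
  then have "card (e ` F) \<le> card ?B"
    using complex_vector.independent_span_bound[OF finite_basis]
    by (simp add: complex_vector.span_extend_basis complex_vector.independent_empty)
  then show False using F by (simp add: card_image[OF inj])
qed

lemma finite_\<Gamma>: "finite \<Gamma>"
  using finite_roots by simp

lemma bracket_root_space_u:
  assumes "x \<in> u \<or> x \<in> u'" "z \<in> t" "\<And>\<gamma>. \<gamma> \<in> \<Delta> \<Longrightarrow> \<gamma> z = 0" shows "bracket x z = 0"
proof -
  have sub: "csubspace {x. bracket x z = 0}"
    unfolding complex_vector.subspace_def by (auto simp: bracket_add_left bracket_scaleC_left)
  have k: "bracket y z = 0" if "y \<in> V \<gamma>" "\<gamma> \<in> \<Delta>" for y \<gamma>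
    using root_space_act[OF that(1) assms(2)] assms(3)[OF that(2)] bracket_skew[of y z] by simp
  have "u \<subseteq> {x. bracket x z = 0}"
    using k positive_subset by (intro ord_eq_le_trans[OF u_def] complex_vector.span_minimal[OF _ sub]) auto
  moreover have "u' \<subseteq> {x. bracket x z = 0}"
    unfolding u'_def using k positive_subset minus_root by (intro complex_vector.span_minimal[OF _ sub]) auto
  ultimately  show ?thesis using assms(1) by blast
qed

lemma root_bracket_t: "\<gamma> \<in> \<Delta> \<Longrightarrow> x \<in> t \<Longrightarrow> y \<in> t \<Longrightarrow> \<gamma> (bracket x y) = 0"
proof -
  assume a: "\<gamma> \<in> \<Delta>" "x \<in> t" "y \<in> t"
  obtain e where e: "e \<in> V \<gamma>" "e \<noteq> 0" using root_vector_exists a by blast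
  have "scaleC (\<gamma> (bracket x y)) e = bracket (bracket x y) e"
    using root_space_act[OF e(1)] t_bracket_closed a by simp
  also have "\<dots> = 0"
    using root_space_act[OF e(1)] a by (simp add: bracket_bracket bracket_scaleC_right scaleC_scaleC mult.commute)
  finally show ?thesis using e(2) by (simp add: complex_vector.scale_eq_0_iff)
qed

text \<open>The common kernel of the roots commutes with \<open>u\<close> and \<open>u'\<close>. At
  this stage \<open>t\<close> is only known to be a subalgebra, so brackets with \<open>t\<close>
  are handled by the vanishing of roots on brackets; commutativity of \<open>t\<close> is a
  consequence.\<close>

lemma annihilated_ideal: "lie_ideal {z\<in>t. \<forall>\<gamma>\<in>\<Delta>. \<gamma> z = 0}" (is "lie_ideal ?I")
  unfolding lie_ideal_def
proof (intro conjI allI ballI)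
  show "csubspace ?I"
    unfolding complex_vector.subspace_def
    using root_dual by (auto simp: t_zero t_add t_scale dual_zero dual_add dual_scale)
  fix x z assume z: "z \<in> ?I"
  obtain a h b where x: "a \<in> u" "h \<in> t" "b \<in> u'" "x = a + h + b" by (rule decompose)
  have "bracket x z = bracket h z"
    using bracket_root_space_u[of a z] bracket_root_space_u[of b z] x z by (simp add: bracket_add_left)
  then show "bracket x z \<in> ?I" using x(2) z root_bracket_t t_bracket_closed by auto
qed

text \<open>In a Lie algebra all of whose elements are ad-semisimple, \<open>[x, y] = c y\<close> forces
  \<open>[y, [y, x]] = 0\<close> and hence \<open>[x, y] = 0\<close>.\<close>

lemma annihilated_zero:
  assumes "z \<in> t" "\<And>\<gamma>. \<gamma> \<in> \<Delta> \<Longrightarrow> \<gamma> z = 0" shows "z = 0"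
proof -
  have "{z\<in>t. \<forall>\<gamma>\<in>\<Delta>. \<gamma> z = 0} \<noteq> UNIV"
  proof
    assume *: "{z\<in>t. \<forall>\<gamma>\<in>\<Delta>. \<gamma> z = 0} = UNIV"
    then have t: "t = UNIV" by blast
    have "bracket x y = 0" for x y :: 'g
    proof -
      have "bracket x y = 0" if "bracket x y = scaleC c y" for y c
      proof -
        have "bracket y (bracket y x) = 0"
          using that bracket_skew[of y x] by (simp add: bracket_scaleC_right bracket_self)
        moreover have "ad_semisimple y" using t_semisimple[of y] t by simp
        ultimately have "bracket y x = 0" using ad_semisimple_square_zero by blast
        then show ?thesis using bracket_skew[of x y] by simp
      qed
      then have "{y. \<exists>c. bracket x y = scaleC c y} \<subseteq> {y. bracket x y = 0}" by blast
      moreover have "csubspace {y. bracket x y = 0}"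
        unfolding complex_vector.subspace_def by (auto simp: bracket_add_right bracket_scaleC_right)
      ultimately have "cspan {y. \<exists>c. bracket x y = scaleC c y} \<subseteq> {y. bracket x y = 0}"
        by (rule complex_vector.span_minimal)
      moreover have "cspan {y. \<exists>c. bracket x y = scaleC c y} = UNIV"
        using t_semisimple[of x] t unfolding ad_semisimple_def by simp
      ultimately show ?thesis by blast
    qed
    then show False using nonabelian by blast
  qed
  then have "{z\<in>t. \<forall>\<gamma>\<in>\<Delta>. \<gamma> z = 0} = {0}" using ideal_trivial[OF annihilated_ideal] by blast
  then show ?thesis using assms by blast
qed

lemma t_abelian: "x \<in> t \<Longrightarrow> y \<in> t \<Longrightarrow> bracket x y = 0"
  by (rule annihilated_zero[of "bracket x y"], rule t_bracket_closed, assumption+, rule root_bracket_t)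

lemma t_in_V0: "t \<subseteq> V 0"
  unfolding root_space_def using t_abelian by auto

lemma u_in_span: "a \<in> u \<Longrightarrow> a \<in> cspan (\<Union>\<gamma>\<in>\<Delta>. V \<gamma>)"
proof -
  have "(\<Union>\<gamma>\<in>\<Delta>p. V \<gamma>) \<subseteq> (\<Union>\<gamma>\<in>\<Delta>. V \<gamma>)" using positive_subset by (rule UN_mono) simp
  from ord_eq_le_trans[OF u_def complex_vector.span_mono[OF this]] show "a \<in> u \<Longrightarrow> ?thesis" by (rule subsetD)
qed

lemma u'_in_span: "b \<in> u' \<Longrightarrow> b \<in> cspan (\<Union>\<gamma>\<in>\<Delta>. V \<gamma>)"
proof -
  have "(\<Union>\<gamma>\<in>\<Delta>p. V (- \<gamma>)) \<subseteq> (\<Union>\<gamma>\<in>\<Delta>. V \<gamma>)" using positive_subset minus_root by fast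
  from ord_eq_le_trans[OF u'_def complex_vector.span_mono[OF this]] show "b \<in> u' \<Longrightarrow> ?thesis" by (rule subsetD)
qed

text \<open>The Cartan subalgebra is its own centraliser: comparing an element of weight 0 with its
  triangular decomposition leaves only the part in \<open>t\<close>.\<close>

lemma V0: "V 0 = t"
proof
  show "V 0 \<subseteq> t"
  proof
    fix x assume x: "x \<in> V 0"
    obtain a h b where d: "a \<in> u" "h \<in> t" "b \<in> u'" "x = a + h + b" by (rule decompose)
    have "a + b \<in> cspan (\<Union>\<gamma>\<in>\<Delta>. V \<gamma>)"
      by (rule complex_vector.span_add[OF u_in_span[OF d(1)] u'_in_span[OF d(3)]])
    then obtain f where f: "\<forall>\<gamma>\<in>\<Delta>. f \<gamma> \<in> V \<gamma>" "a + b = (\<Sum>\<gamma>\<in>\<Delta>. f \<gamma>)"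
      using span_Union_weight_spaces[OF _ finite_roots] by blast
    \<comment> \<open>The equation x = a + h + b becomes a relation between weight vectors with h -
      x at weight 0.\<close>
    let ?g = "\<lambda>\<gamma>. if \<gamma> = 0 then h - x else f \<gamma>"
    have "(\<Sum>\<gamma>\<in>\<Delta>. ?g \<gamma>) = (\<Sum>\<gamma>\<in>\<Delta>. f \<gamma>)" using zero_notin_roots by (intro sum.cong) auto
    then have "(\<Sum>\<gamma>\<in>\<Gamma>. ?g \<gamma>) = 0"
      using d(4) f(2) finite_roots zero_notin_roots by (simp add: algebra_simps)
    moreover have "h - x \<in> V 0"
      using x d(2) t_in_V0 by (intro root_space_diff) auto
    ultimately have "?g 0 = 0" using f(1) finite_\<Gamma> by (intro weights_independent[of \<Gamma> ?g]) auto
    then show "x \<in> t" using d(2) by simp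
  qed
qed (rule t_in_V0)

lemma weight_decomposition: "\<exists>f. (\<forall>\<gamma>\<in>\<Gamma>. f \<gamma> \<in> V \<gamma>) \<and> x = (\<Sum>\<gamma>\<in>\<Gamma>. f \<gamma>)"
proof -
  obtain a h b where d: "a \<in> u" "h \<in> t" "b \<in> u'" "x = a + h + b" by (rule decompose)
  let ?S = "cspan (\<Union>\<gamma>\<in>\<Gamma>. V \<gamma>)"
  have sub: "cspan (\<Union>\<gamma>\<in>\<Delta>. V \<gamma>) \<subseteq> ?S" by (rule complex_vector.span_mono, rule UN_mono) auto
  have "a \<in> ?S" "b \<in> ?S"
    by (rule subsetD[OF sub u_in_span[OF d(1)]], rule subsetD[OF sub u'_in_span[OF d(3)]])
  moreover have "h \<in> ?S"
    using subsetD[OF t_in_V0 d(2)] by (intro complex_vector.span_base UN_I[of 0] insertI1)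
  ultimately have "x \<in> ?S" unfolding d(4) by (intro complex_vector.span_add)
  then show ?thesis by (rule span_Union_weight_spaces[OF _ finite_\<Gamma>])
qed

section \<open>Projections onto the weight spaces\<close>

definition pr :: "('g \<Rightarrow> complex) \<Rightarrow> 'g \<Rightarrow> 'g" where
  "pr \<gamma> x = (if \<gamma> \<in> \<Gamma> then (SOME f. (\<forall>\<gamma>\<in>\<Gamma>. f \<gamma> \<in> V \<gamma>) \<and> x = (\<Sum>\<gamma>\<in>\<Gamma>. f \<gamma>)) \<gamma> else 0)"

lemma pr_decomposition: "(\<forall>\<gamma>\<in>\<Gamma>. pr \<gamma> x \<in> V \<gamma>) \<and> x = (\<Sum>\<gamma>\<in>\<Gamma>. pr \<gamma> x)"
proof -
  define f where "f = (SOME f. (\<forall>\<gamma>\<in>\<Gamma>. f \<gamma> \<in> V \<gamma>) \<and> x = (\<Sum>\<gamma>\<in>\<Gamma>. f \<gamma>))"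
  have f: "(\<forall>\<gamma>\<in>\<Gamma>. f \<gamma> \<in> V \<gamma>) \<and> x = (\<Sum>\<gamma>\<in>\<Gamma>. f \<gamma>)"
    unfolding f_def using someI_ex[OF weight_decomposition] .
  have eq: "pr \<gamma> x = f \<gamma>" if "\<gamma> \<in> \<Gamma>" for \<gamma> unfolding pr_def f_def[symmetric] if_P[OF that] ..
  have "(\<Sum>\<gamma>\<in>\<Gamma>. pr \<gamma> x) = (\<Sum>\<gamma>\<in>\<Gamma>. f \<gamma>)" by (rule sum.cong[OF refl eq])
  then have "x = (\<Sum>\<gamma>\<in>\<Gamma>. pr \<gamma> x)" using f[THEN conjunct2] by (rule trans[OF _ sym, rotated])
  moreover have "\<forall>\<gamma>\<in>\<Gamma>. pr \<gamma> x \<in> V \<gamma>"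
  proof
    fix \<gamma> assume g: "\<gamma> \<in> \<Gamma>"
    show "pr \<gamma> x \<in> V \<gamma>" unfolding eq[OF g] by (rule bspec[OF f[THEN conjunct1] g])
  qed
  ultimately show ?thesis by (intro conjI)
qed

lemma pr_mem: "pr \<gamma> x \<in> V \<gamma>"
proof (cases "\<gamma> \<in> \<Gamma>")
  case True
  then show ?thesis by (rule bspec[OF pr_decomposition[THEN conjunct1]])
next
  case False
  then show ?thesis unfolding pr_def using root_space_zero by (simp only: if_False)
qed

lemma pr_sum: "(\<Sum>\<gamma>\<in>\<Gamma>. pr \<gamma> x) = x"
  by (rule pr_decomposition[THEN conjunct2, symmetric])

lemma pr_outside: "\<gamma> \<notin> \<Gamma> \<Longrightarrow> pr \<gamma> x = 0"
  by (simp only: pr_def if_False)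

lemma pr_unique:
  assumes "\<And>\<gamma>. \<gamma> \<in> \<Gamma> \<Longrightarrow> f \<gamma> \<in> V \<gamma>" "x = (\<Sum>\<gamma>\<in>\<Gamma>. f \<gamma>)" "\<gamma> \<in> \<Gamma>"
  shows "pr \<gamma> x = f \<gamma>"
proof -
  have 0: "(\<Sum>\<gamma>\<in>\<Gamma>. pr \<gamma> x - f \<gamma>) = 0"
    unfolding sum_subtractf pr_sum using assms(2) by (simp only: diff_self)
  have "pr \<gamma> x - f \<gamma> = 0"
    by (rule weights_independent[of \<Gamma> "\<lambda>\<gamma>. pr \<gamma> x - f \<gamma>", OF finite_\<Gamma> order_refl root_space_diff[OF pr_mem assms(1)] 0 assms(3)])
  then show ?thesis by simp
qed

lemma endo_pr: "endo (pr \<gamma>)"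
proof (cases "\<gamma> \<in> \<Gamma>")
  case True
  have "pr \<gamma> (x + y) = pr \<gamma> x + pr \<gamma> y" for x y
  proof (rule pr_unique[of "\<lambda>\<gamma>. pr \<gamma> x + pr \<gamma> y", OF _ _ True])
    show "x + y = (\<Sum>\<gamma>\<in>\<Gamma>. pr \<gamma> x + pr \<gamma> y)"
      by (simp only: sum.distrib pr_sum)
  qed (intro root_space_add pr_mem)
  moreover have "pr \<gamma> (scaleC c x) = scaleC c (pr \<gamma> x)" for c x
  proof (rule pr_unique[of "\<lambda>\<gamma>. scaleC c (pr \<gamma> x)", OF _ _ True])
    show "scaleC c x = (\<Sum>\<gamma>\<in>\<Gamma>. scaleC c (pr \<gamma> x))"
      by (simp only: complex_vector.scale_sum_right[symmetric] pr_sum)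
  qed (intro root_space_scale pr_mem)
  ultimately show ?thesis unfolding endo_def by blast
next
  case False
  then show ?thesis unfolding endo_def by (simp add: pr_outside)
qed

lemma pr_V:
  assumes "x \<in> V \<delta>" "\<delta> \<in> linear_dual t" shows "pr \<gamma> x = (if \<gamma> = \<delta> then x else 0)"
proof (cases "\<delta> \<in> \<Gamma>")
  case True
  show ?thesis
  proof (cases "\<gamma> \<in> \<Gamma>")
    case g: True
    show ?thesis
    proof (rule pr_unique[of "\<lambda>\<gamma>. if \<gamma> = \<delta> then x else 0", OF _ _ g])
      show "x = (\<Sum>\<gamma>\<in>\<Gamma>. if \<gamma> = \<delta> then x else 0)" by (subst sum.delta[OF finite_\<Gamma>], subst if_P[OF True], rule refl)
    qed (use assms(1) root_space_zero in auto)
  qed (use True pr_outside in auto)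
next
  case False
  then have "x = 0" using root_space_trivial assms by blast
  then show ?thesis using endo_zero[OF endo_pr] by simp
qed

lemma pr_bracket:
  assumes "y \<in> V \<delta>" "\<delta> \<in> linear_dual t" "\<epsilon> \<in> linear_dual t"
  shows "pr \<epsilon> (bracket x y) = bracket (pr (\<epsilon> - \<delta>) x) y"
proof -
  have "bracket x y = (\<Sum>\<gamma>\<in>\<Gamma>. bracket (pr \<gamma> x) y)"
    by (simp only: bracket_sum_left[symmetric] pr_sum)
  then have "pr \<epsilon> (bracket x y) = (\<Sum>\<gamma>\<in>\<Gamma>. pr \<epsilon> (bracket (pr \<gamma> x) y))" by (simp only: endo_sum[OF endo_pr])
  also have "\<dots> = (\<Sum>\<gamma>\<in>\<Gamma>. if \<gamma> = \<epsilon> - \<delta> then bracket (pr (\<epsilon> - \<delta>) x) y else 0)"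
  proof (rule sum.cong[OF refl])
    fix \<gamma> assume g: "\<gamma> \<in> \<Gamma>"
    have "pr \<epsilon> (bracket (pr \<gamma> x) y) = (if \<epsilon> = \<gamma> + \<delta> then bracket (pr \<gamma> x) y else 0)"
      using root_space_bracket[OF pr_mem assms(1)] linear_dual_add[OF \<Gamma>_dual[OF g] assms(2)] by (rule pr_V)
    moreover have "\<epsilon> = \<gamma> + \<delta> \<longleftrightarrow> \<gamma> = \<epsilon> - \<delta>" by (auto simp: algebra_simps)
    ultimately show "pr \<epsilon> (bracket (pr \<gamma> x) y) = (if \<gamma> = \<epsilon> - \<delta> then bracket (pr (\<epsilon> - \<delta>) x) y else 0)"
      by (cases "\<gamma> = \<epsilon> - \<delta>") (simp_all only: if_True if_False)
  qed
  also have "\<dots> = bracket (pr (\<epsilon> - \<delta>) x) y"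
    unfolding sum.delta[OF finite_\<Gamma>] using pr_outside[of "\<epsilon> - \<delta>" x]
    by (cases "\<epsilon> - \<delta> \<in> \<Gamma>") (simp_all only: if_True if_False bracket_zero_left simp_thms)
  finally show ?thesis .
qed

definition mult :: "('g \<Rightarrow> complex) \<Rightarrow> nat" where
  "mult \<gamma> = cdim (V \<gamma>)"

lemma endo_trace_pr: "\<gamma> \<in> \<Gamma> \<Longrightarrow> endo_trace (pr \<gamma>) = of_nat (mult \<gamma>)"
  unfolding mult_def
proof (rule endo_trace_projection[OF finite_basis endo_pr pr_mem _ root_space_subspace])
  fix x assume "\<gamma> \<in> \<Gamma>" "x \<in> V \<gamma>"
  then have "pr \<gamma> x = (if \<gamma> = \<gamma> then x else 0)" by (intro pr_V \<Gamma>_dual)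
  then show "pr \<gamma> x = x" by simp
qed

lemma endo_trace_diagonal:
  "G \<subseteq> \<Gamma> \<Longrightarrow> endo_trace (\<lambda>x. \<Sum>\<gamma>\<in>G. scaleC (c \<gamma>) (pr \<gamma> x)) = (\<Sum>\<gamma>\<in>G. c \<gamma> * of_nat (mult \<gamma>))"
  unfolding endo_trace_sum using endo_trace_pr by (intro sum.cong refl) (auto simp: endo_trace_scale)

lemma mult_pos: "\<gamma> \<in> \<Delta> \<Longrightarrow> mult \<gamma> > 0"
proof -
  assume g: "\<gamma> \<in> \<Delta>"
  obtain e where e: "e \<in> V \<gamma>" "e \<noteq> 0" using root_vector_exists[OF g] by blast
  obtain B where B: "B \<subseteq> V \<gamma>" "complex_vector.independent B" "V \<gamma> \<subseteq> cspan B" "card B = cdim (V \<gamma>)"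
    using complex_vector.basis_exists by blast
  have "finite B" using complex_vector.independent_span_bound[OF finite_basis B(2)]
    by (simp add: complex_vector.span_extend_basis complex_vector.independent_empty)
  moreover have "B \<noteq> {}" using B(3) e by auto
  ultimately show ?thesis unfolding mult_def B(4)[symmetric] by (simp add: card_gt_0_iff)
qed

lemma act_pr: "h \<in> t \<Longrightarrow> bracket h x = (\<Sum>\<gamma>\<in>\<Gamma>. scaleC (\<gamma> h) (pr \<gamma> x))"
proof -
  assume h: "h \<in> t"
  have "bracket h x = (\<Sum>\<gamma>\<in>\<Gamma>. bracket h (pr \<gamma> x))"
    by (simp only: bracket_sum_right[symmetric] pr_sum)
  also have "\<dots> = (\<Sum>\<gamma>\<in>\<Gamma>. scaleC (\<gamma> h) (pr \<gamma> x))"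
    using root_space_act[OF pr_mem h] by (intro sum.cong) auto
  finally show ?thesis .
qed

section \<open>Traces over sums of root spaces and nondegeneracy of the Killing form\<close>

lemma killing_form_t:
  assumes "h \<in> t" "h' \<in> t"
  shows "killing_form h h' = (\<Sum>\<gamma>\<in>\<Delta>. of_nat (mult \<gamma>) * (\<gamma> h * \<gamma> h'))"
proof -
  have "bracket h (bracket h' x) = (\<Sum>\<gamma>\<in>\<Gamma>. scaleC (\<gamma> h * \<gamma> h') (pr \<gamma> x))" for x
  proof -
    have "bracket h (bracket h' x) = (\<Sum>\<gamma>\<in>\<Gamma>. scaleC (\<gamma> h') (bracket h (pr \<gamma> x)))"
      unfolding act_pr[OF assms(2)] bracket_sum_right bracket_scaleC_right ..
    also have "\<dots> = (\<Sum>\<gamma>\<in>\<Gamma>. scaleC (\<gamma> h * \<gamma> h') (pr \<gamma> x))"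
      using root_space_act[OF pr_mem assms(1)] by (intro sum.cong) (auto simp: scaleC_scaleC mult.commute)
    finally show ?thesis .
  qed
  then have "killing_form h h' = (\<Sum>\<gamma>\<in>\<Gamma>. \<gamma> h * \<gamma> h' * of_nat (mult \<gamma>))"
    unfolding killing_form_def using endo_trace_diagonal[of \<Gamma> "\<lambda>\<gamma>. \<gamma> h * \<gamma> h'"] by simp
  then show ?thesis using finite_roots zero_notin_roots by (simp add: mult.commute)
qed

text \<open>The element [e, f] lies in \<open>t\<close> and acts on \<open>V \<delta>\<close> by a
  scalar, so the vanishing trace becomes a linear relation between the values of roots. A step out
  of \<open>G\<close> is harmless if the bracket is zero anyway; this allows truncated
  strings.\<close>

lemma string_trace:
  assumes "G \<subseteq> \<Gamma>" and e: "e \<in> V \<alpha>" and f: "f \<in> V (- \<alpha>)" and \<alpha>: "\<alpha> \<in> linear_dual t"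
    and Ge: "\<And>\<delta> x. \<delta> \<in> G \<Longrightarrow> x \<in> V \<delta> \<Longrightarrow> \<delta> + \<alpha> \<in> G \<or> bracket e x = 0"
    and Gf: "\<And>\<delta> x. \<delta> \<in> G \<Longrightarrow> x \<in> V \<delta> \<Longrightarrow> \<delta> - \<alpha> \<in> G \<or> bracket f x = 0"
  shows "(\<Sum>\<delta>\<in>G. of_nat (mult \<delta>) * \<delta> (bracket e f)) = 0"
proof -
  define p where "p x = (\<Sum>\<gamma>\<in>G. pr \<gamma> x)" for x
  have finG: "finite G" using assms(1) finite_\<Gamma> finite_subset by blast
  have p: "endo p" unfolding endo_def p_def
    by (simp add: endo_add[OF endo_pr] endo_scale[OF endo_pr] sum.distrib complex_vector.scale_sum_right)
  have pV: "p y = y" if "y \<in> V \<gamma>" "\<gamma> \<in> G" for y \<gamma>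
  proof -
    have "\<gamma> \<in> linear_dual t" using \<Gamma>_dual assms(1) that(2) by blast
    from pr_V[OF that(1) this] have "p y = (\<Sum>\<epsilon>\<in>G. if \<epsilon> = \<gamma> then y else 0)" unfolding p_def by (rule sum.cong[OF refl])
    then show ?thesis using that(2) finG by simp
  qed
  have stable: "p (bracket z (p x)) = bracket z (p x)"
    if z: "\<And>\<delta> x. \<delta> \<in> G \<Longrightarrow> x \<in> V \<delta> \<Longrightarrow> (\<exists>\<epsilon>\<in>G. bracket z x \<in> V \<epsilon>) \<or> bracket z x = 0" for x z
  proof -
    have b: "bracket z (p x) = (\<Sum>\<gamma>\<in>G. bracket z (pr \<gamma> x))" unfolding p_def bracket_sum_right ..
    have "p (bracket z (pr \<gamma> x)) = bracket z (pr \<gamma> x)" if "\<gamma> \<in> G" for \<gamma>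
      using z[OF that pr_mem, of x] pV endo_zero[OF p] by auto
    then show ?thesis unfolding b endo_sum[OF p] by (rule sum.cong[OF refl])
  qed
  have "endo_trace (\<lambda>x. bracket (bracket e f) (p x)) = 0"
  proof (rule endo_trace_commutator_zero[OF finite_basis p]; rule stable)
    fix \<delta> x assume "\<delta> \<in> G" "x \<in> V \<delta>"
    then show "(\<exists>\<epsilon>\<in>G. bracket e x \<in> V \<epsilon>) \<or> bracket e x = 0"
      using Ge[of \<delta> x] root_space_bracket[OF e, of x \<delta>] by (auto simp: add.commute)
  next
    fix \<delta> x assume "\<delta> \<in> G" "x \<in> V \<delta>"
    then show "(\<exists>\<epsilon>\<in>G. bracket f x \<in> V \<epsilon>) \<or> bracket f x = 0"
      using Gf[of \<delta> x] root_space_bracket[OF f, of x \<delta>] by auto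
  qed
  moreover have "bracket (bracket e f) (p x) = (\<Sum>\<gamma>\<in>G. scaleC (\<gamma> (bracket e f)) (pr \<gamma> x))" for x
  proof -
    have "bracket e f \<in> t" using root_space_bracket[OF e f] V0 by simp
    then show ?thesis
      unfolding p_def bracket_sum_right using root_space_act[OF pr_mem] by (intro sum.cong) auto
  qed
  ultimately show ?thesis using endo_trace_diagonal[OF assms(1)] by (simp add: mult.commute)
qed

lemma bracket_in_t: "e \<in> V \<alpha> \<Longrightarrow> f \<in> V (- \<alpha>) \<Longrightarrow> bracket e f \<in> t"
  using root_space_bracket[of e t \<alpha> f "- \<alpha>"] V0 by simp

lemma bracket_trivial: "x \<in> V \<gamma> \<Longrightarrow> y \<in> V \<delta> \<Longrightarrow> \<gamma> + \<delta> \<notin> \<Gamma> \<Longrightarrow> \<gamma> \<in> linear_dual t \<Longrightarrow> \<delta> \<in> linear_dual t \<Longrightarrow> bracket x y = 0"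
  using root_space_bracket root_space_trivial linear_dual_add by blast

text \<open>The trace over the whole string of \<delta> along \<alpha> reads M \<delta>(h) + N
  \<alpha>(h) = 0 for h = [e, f], where M is the total multiplicity and N the multiplicity weighted
  by the position. Since \<delta> itself belongs to the string, M > 0 and the ratio is - N /
  M.\<close>

lemma real_ratio:
  assumes "\<alpha> \<in> \<Delta>" "\<delta> \<in> \<Delta>" "e \<in> V \<alpha>" "f \<in> V (- \<alpha>)"
  shows "\<exists>q::real. \<delta> (bracket e f) = of_real q * \<alpha> (bracket e f)"
proof -
  define G where "G = {\<gamma>\<in>\<Gamma>. \<exists>k::int. \<gamma> = \<delta> + of_int k * \<alpha>}"
  define h where "h = bracket e f"
  have "\<forall>\<gamma>\<in>G. \<exists>k::int. \<gamma> = \<delta> + of_int k * \<alpha>" unfolding G_def by blast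
  then obtain k where k: "\<forall>\<gamma>\<in>G. \<gamma> = \<delta> + of_int (k \<gamma>) * \<alpha>" by (rule bchoice[THEN exE])
  have finG: "finite G" using finite_roots unfolding G_def by auto
  have step: "\<gamma> + \<alpha> = \<delta> + of_int (k + 1) * \<alpha>" "\<gamma> - \<alpha> = \<delta> + of_int (k - 1) * \<alpha>"
    if "\<gamma> = \<delta> + of_int k * \<alpha>" for \<gamma> and k :: int using that by (auto simp: algebra_simps)
  have tr: "(\<Sum>\<gamma>\<in>G. of_nat (mult \<gamma>) * \<gamma> h) = 0"
    unfolding h_def
  proof (rule string_trace[OF _ assms(3,4)])
    show "G \<subseteq> \<Gamma>" unfolding G_def by blast
    show "\<alpha> \<in> linear_dual t" using assms root_dual by blast
    fix \<gamma> x assume g: "\<gamma> \<in> G" "x \<in> V \<gamma>"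
    then have gd: "\<gamma> \<in> linear_dual t" using \<Gamma>_dual unfolding G_def by blast
    have ad: "\<alpha> \<in> linear_dual t" "- \<alpha> \<in> linear_dual t" using assms root_dual linear_dual_minus by auto
    have \<gamma>k: "\<gamma> = \<delta> + of_int (k \<gamma>) * \<alpha>" using k g(1) by blast
    show "\<gamma> + \<alpha> \<in> G \<or> bracket e x = 0"
    proof (cases "\<gamma> + \<alpha> \<in> \<Gamma>")
      case True
      then show ?thesis using step(1)[OF \<gamma>k] unfolding G_def by blast
    next
      case False
      then have "\<alpha> + \<gamma> \<notin> \<Gamma>" by (simp only: add.commute[of \<alpha>] not_False_eq_True)
      then have "bracket e x = 0" by (intro bracket_trivial[OF assms(3) g(2) _ ad(1) gd])
      then show ?thesis ..
    qed
    show "\<gamma> - \<alpha> \<in> G \<or> bracket f x = 0"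
    proof (cases "\<gamma> - \<alpha> \<in> \<Gamma>")
      case True
      then show ?thesis using step(2)[OF \<gamma>k] unfolding G_def by blast
    next
      case False
      then have "- \<alpha> + \<gamma> \<notin> \<Gamma>" by simp
      then have "bracket f x = 0" by (intro bracket_trivial[OF assms(4) g(2) _ ad(2) gd])
      then show ?thesis ..
    qed
  qed
  define M N where "M = (\<Sum>\<gamma>\<in>G. mult \<gamma>)" and "N = (\<Sum>\<gamma>\<in>G. int (mult \<gamma>) * k \<gamma>)"
  have "(\<Sum>\<gamma>\<in>G. of_nat (mult \<gamma>) * \<gamma> h) = (\<Sum>\<gamma>\<in>G. of_nat (mult \<gamma>) * \<delta> h + of_int (int (mult \<gamma>) * k \<gamma>) * \<alpha> h)"
  proof (rule sum.cong[OF refl])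
    fix \<gamma> assume "\<gamma> \<in> G"
    then have "\<gamma> = \<delta> + of_int (k \<gamma>) * \<alpha>" using k by blast
    then have "\<gamma> h = \<delta> h + of_int (k \<gamma>) * \<alpha> h" by (metis of_int_fun plus_fun_apply times_fun_apply)
    then show "of_nat (mult \<gamma>) * \<gamma> h = of_nat (mult \<gamma>) * \<delta> h + of_int (int (mult \<gamma>) * k \<gamma>) * \<alpha> h"
      by (simp add: algebra_simps)
  qed
  also have "\<dots> = of_nat M * \<delta> h + of_int N * \<alpha> h"
    unfolding M_def N_def by (simp add: sum.distrib sum_distrib_right)
  finally have eq: "of_nat M * \<delta> h = - of_int N * \<alpha> h" using tr by (simp add: eq_neg_iff_add_eq_0)
  have "\<delta> \<in> G" unfolding G_def using assms(2) by (auto intro: exI[of _ 0])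
  then have "M > 0" unfolding M_def using finG mult_pos[OF assms(2)] by (intro sum_pos2) auto
  then have "\<delta> h = of_real (- real_of_int N / real M) * \<alpha> h" using eq by (simp add: field_simps)
  then show ?thesis unfolding h_def by blast
qed

lemma bracket_zero_if_root_zero:
  assumes "\<alpha> \<in> \<Delta>" "e \<in> V \<alpha>" "f \<in> V (- \<alpha>)" "\<alpha> (bracket e f) = 0"
  shows "bracket e f = 0"
  using real_ratio[OF assms(1) _ assms(2,3)] assms(4) bracket_in_t[OF assms(2,3)]
  by (intro annihilated_zero) force+

text \<open>For h = [e, f] the value of the form at (h, h) is \<gamma>(h)^2 times a sum of squares
  of real ratios, including the ratio 1 of \<gamma> itself. If the form vanishes, so does
  \<gamma>(h), and with it every bracket of opposite root vectors; this contradicts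
  simplicity.\<close>

lemma killing_form_nonzero: "\<exists>x y :: 'g. killing_form x y \<noteq> 0"
proof (rule ccontr)
  assume "\<not> ?thesis"
  then have z: "killing_form x y = 0" for x y :: 'g by blast
  have ef: "bracket e f = 0" if g: "\<gamma> \<in> \<Delta>" and e: "e \<in> V \<gamma>" and f: "f \<in> V (- \<gamma>)" for \<gamma> e f
  proof (rule bracket_zero_if_root_zero[OF g e f], rule ccontr)
    let ?h = "bracket e f"
    assume nz: "\<gamma> ?h \<noteq> 0"
    have "\<forall>\<delta>\<in>\<Delta>. \<exists>q::real. \<delta> ?h = of_real q * \<gamma> ?h" using real_ratio[OF g _ e f] by blast
    then obtain q :: "('g \<Rightarrow> complex) \<Rightarrow> real" where q: "\<forall>\<delta>\<in>\<Delta>. \<delta> ?h = of_real (q \<delta>) * \<gamma> ?h"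
      by (rule bchoice[THEN exE])
    have "killing_form ?h ?h = (\<Sum>\<delta>\<in>\<Delta>. of_nat (mult \<delta>) * (\<delta> ?h * \<delta> ?h))"
      using killing_form_t[OF bracket_in_t[OF e f] bracket_in_t[OF e f]] .
    also have "\<dots> = (\<Sum>\<delta>\<in>\<Delta>. of_real (real (mult \<delta>) * (q \<delta>)\<^sup>2) * (\<gamma> ?h)\<^sup>2)"
    proof (rule sum.cong[OF refl])
      fix \<delta> assume "\<delta> \<in> \<Delta>"
      then have "\<delta> ?h = of_real (q \<delta>) * \<gamma> ?h" using q by blast
      then show "of_nat (mult \<delta>) * (\<delta> ?h * \<delta> ?h) = of_real (real (mult \<delta>) * (q \<delta>)\<^sup>2) * (\<gamma> ?h)\<^sup>2"
        by (simp only:) (simp add: power2_eq_square)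
    qed
    also have "\<dots> = of_real (\<Sum>\<delta>\<in>\<Delta>. real (mult \<delta>) * (q \<delta>)\<^sup>2) * (\<gamma> ?h)\<^sup>2"
      by (simp only: of_real_sum sum_distrib_right)
    finally have "of_real (\<Sum>\<delta>\<in>\<Delta>. real (mult \<delta>) * (q \<delta>)\<^sup>2) * (\<gamma> ?h)\<^sup>2 = 0" unfolding z by (rule sym)
    then have "complex_of_real (\<Sum>\<delta>\<in>\<Delta>. real (mult \<delta>) * (q \<delta>)\<^sup>2) = 0"
      using nz unfolding mult_eq_0_iff power_eq_0_iff by blast
    then have "(\<Sum>\<delta>\<in>\<Delta>. real (mult \<delta>) * (q \<delta>)\<^sup>2) = 0" unfolding of_real_eq_0_iff .
    then have "real (mult \<gamma>) * (q \<gamma>)\<^sup>2 = 0" using finite_roots g by (simp add: sum_nonneg_eq_0_iff)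
    then have "q \<gamma> = 0" using mult_pos[OF g] by simp
    then show False using q g nz by force
  qed
  \<comment> \<open>A component of weight 0 could only come from opposite roots or from two elements
    of \<open>t\<close>, and both kinds of bracket are zero.\<close>
  have pr0: "pr 0 (bracket x y) = 0" for x y
  proof -
    have "bracket x y = (\<Sum>\<gamma>\<in>\<Gamma>. bracket x (pr \<gamma> y))"
      by (simp only: bracket_sum_right[symmetric] pr_sum)
    then have "pr 0 (bracket x y) = (\<Sum>\<gamma>\<in>\<Gamma>. pr 0 (bracket x (pr \<gamma> y)))" by (simp only: endo_sum[OF endo_pr])
    also have "\<dots> = 0"
    proof (intro sum.neutral ballI)
      fix \<gamma> assume g: "\<gamma> \<in> \<Gamma>"
      have "pr 0 (bracket x (pr \<gamma> y)) = bracket (pr (0 - \<gamma>) x) (pr \<gamma> y)"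
        using pr_bracket[OF pr_mem \<Gamma>_dual[OF g] linear_dual_zero] .
      also have "\<dots> = 0"
      proof (cases "\<gamma> = 0")
        case True
        then show ?thesis using t_abelian[of "pr 0 x" "pr 0 y"] pr_mem[of 0] V0 by simp
      next
        case False
        then have "- \<gamma> \<in> \<Delta>" using g minus_root by simp
        then show ?thesis using ef[of "- \<gamma>" "pr (- \<gamma>) x" "pr \<gamma> y"] pr_mem[of "- \<gamma>"] pr_mem[of \<gamma>] by simp
      qed
      finally show "pr 0 (bracket x (pr \<gamma> y)) = 0" .
    qed
    finally show ?thesis .
  qed
  \<comment> \<open>The derived algebra is a nonzero ideal, hence everything; so the projection to
    \<open>t\<close> is zero, \<open>t\<close> is trivial and there are no roots.\<close>
  let ?D = "cspan {bracket x y | x y :: 'g. True}"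
  have "lie_ideal ?D"
    unfolding lie_ideal_def
  proof (intro conjI allI ballI)
    show "csubspace ?D" by (rule complex_vector.subspace_span)
    show "bracket x y \<in> ?D" for x y by (rule complex_vector.span_base) blast
  qed
  moreover have "?D \<noteq> {0}"
  proof
    assume "?D = {0}"
    moreover have "bracket x y \<in> ?D" for x y :: 'g by (rule complex_vector.span_base) blast
    ultimately show False using nonabelian by auto
  qed
  ultimately have D: "?D = UNIV" using ideal_trivial by blast
  have "csubspace {x. pr 0 x = 0}"
    unfolding complex_vector.subspace_def
    by (auto simp: endo_zero[OF endo_pr] endo_add[OF endo_pr] endo_scale[OF endo_pr])
  then have "?D \<subseteq> {x. pr 0 x = 0}" using pr0 by (intro complex_vector.span_minimal) auto
  then have p0: "pr 0 x = 0" for x using D by blast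
  have t0: "h = 0" if "h \<in> t" for h
    using p0[of h] pr_V[of h 0 0, OF _ linear_dual_zero] that V0 by simp
  have "\<Delta> = {}"
  proof (rule ccontr)
    assume "\<Delta> \<noteq> {}"
    then obtain \<gamma> where g: "\<gamma> \<in> \<Delta>" by blast
    have "\<gamma> = 0"
    proof (rule linear_dual_eqI[OF root_dual[OF g] linear_dual_zero])
      fix h assume "h \<in> t"
      then show "\<gamma> h = 0 h" using t0[of h] dual_zero[OF root_dual[OF g]] by simp
    qed
    then show False using root_nonzero[OF g] by blast
  qed
  then have "x = 0" for x :: 'g by (subst pr_sum[of x, symmetric]) (simp add: p0)
  then show False using nonabelian by blast
qed

lemma killing_form_nondegenerate:
  fixes x :: 'g
  assumes "\<And>y. killing_form x y = 0" shows "x = 0"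
proof -
  have zero: "killing_form 0 y = 0" for y :: 'g using killing_form_scale_left[of 0 0 y] by simp
  have neg: "killing_form (- x) y = - killing_form x y" for x y :: 'g
    using killing_form_scale_left[of "-1" x y] by (simp add: complex_vector.scale_minus_left scaleC_one)
  let ?I = "{x :: 'g. \<forall>y. killing_form x y = 0}"
  have "lie_ideal ?I"
    unfolding lie_ideal_def
  proof (intro conjI allI ballI)
    show "csubspace ?I"
      unfolding complex_vector.subspace_def by (auto simp: zero killing_form_add_left killing_form_scale_left)
    fix z x :: 'g assume "x \<in> ?I"
    then show "bracket z x \<in> ?I"
      using killing_form_invariant[OF finite_basis, of x z] neg bracket_skew[of z x] by simp
  qed
  moreover have "?I \<noteq> UNIV" using killing_form_nonzero by blast
  ultimately have "?I = {0}" using ideal_trivial by blast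
  then show ?thesis using assms by blast
qed

lemma killing_form_orthogonal:
  assumes "x \<in> V \<gamma>" "y \<in> V \<delta>" "\<gamma> \<in> linear_dual t" "\<delta> \<in> linear_dual t" "\<gamma> + \<delta> \<noteq> 0"
  shows "killing_form x y = 0"
proof -
  obtain h where h: "h \<in> t" "(\<gamma> + \<delta>) h \<noteq> 0 h"
    using dual_separate[OF linear_dual_add[OF assms(3,4)] linear_dual_zero assms(5)] by blast
  have "bracket x h = scaleC (- \<gamma> h) x"
    using root_space_act[OF assms(1) h(1)] bracket_skew[of x h] by (simp add: complex_vector.scale_minus_left)
  then have "- \<gamma> h * killing_form x y = \<delta> h * killing_form x y"
    using killing_form_invariant[OF finite_basis, of x h y] root_space_act[OF assms(2) h(1)]
    by (simp only: killing_form_scale_left killing_form_scale_right)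
  moreover have "(\<gamma> h + \<delta> h) * killing_form x y = \<delta> h * killing_form x y - (- \<gamma> h * killing_form x y)"
    by (simp add: algebra_simps)
  ultimately have "(\<gamma> h + \<delta> h) * killing_form x y = 0" by (simp only: diff_self)
  then show ?thesis using h(2) by simp
qed

lemma killing_form_sum_right: "killing_form (x::'g) (sum f I) = (\<Sum>i\<in>I. killing_form x (f i))"
proof (induction I rule: infinite_finite_induct)
  case empty
  show ?case using killing_form_scale_right[of x 0 0] by simp
next
  case (infinite I)
  then show ?case using killing_form_scale_right[of x 0 0] by simp
qed (simp add: killing_form_add_right)

lemma killing_form_pr:
  assumes "x \<in> V \<gamma>" "\<gamma> \<in> linear_dual t" shows "killing_form x y = killing_form x (pr (- \<gamma>) y)"
proof -
  have k0: "killing_form x 0 = 0" using killing_form_scale_right[of x 0 0] by simp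
  have "killing_form x y = (\<Sum>\<delta>\<in>\<Gamma>. killing_form x (pr \<delta> y))"
    by (simp only: killing_form_sum_right[symmetric] pr_sum)
  also have "\<dots> = (\<Sum>\<delta>\<in>\<Gamma>. if \<delta> = - \<gamma> then killing_form x (pr (- \<gamma>) y) else 0)"
  proof (rule sum.cong[OF refl])
    fix \<delta> assume "\<delta> \<in> \<Gamma>"
    then show "killing_form x (pr \<delta> y) = (if \<delta> = - \<gamma> then killing_form x (pr (- \<gamma>) y) else 0)"
      using killing_form_orthogonal[OF assms(1) pr_mem assms(2) \<Gamma>_dual, of \<delta> y]
      by (auto simp: add_eq_0_iff)
  qed
  also have "\<dots> = killing_form x (pr (- \<gamma>) y)"
    unfolding sum.delta[OF finite_\<Gamma>] using pr_outside[of "- \<gamma>" y] k0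
    by (cases "- \<gamma> \<in> \<Gamma>") (simp_all only: if_True if_False simp_thms)
  finally show ?thesis .
qed

lemma killing_partner:
  assumes "e \<in> V \<gamma>" "e \<noteq> 0" "\<gamma> \<in> linear_dual t" shows "\<exists>f\<in>V (- \<gamma>). killing_form e f = 1"
proof -
  obtain y where y: "killing_form e y \<noteq> 0" using killing_form_nondegenerate assms(2) by blast
  let ?f = "scaleC (inverse (killing_form e y)) (pr (- \<gamma>) y)"
  have "killing_form e ?f = 1"
    using killing_form_pr[OF assms(1,3), of y] y by (simp add: killing_form_scale_right)
  then show ?thesis using root_space_scale[OF pr_mem] by blast
qed

lemma killing_form_t_nondegenerate:
  assumes "h \<in> t" "\<And>h'. h' \<in> t \<Longrightarrow> killing_form h h' = 0" shows "h = 0"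
proof (rule killing_form_nondegenerate)
  fix y
  have "killing_form h y = killing_form h (pr 0 y)"
    using killing_form_pr[of h 0 y, OF _ linear_dual_zero] assms(1) V0 by simp
  then show "killing_form h y = 0" using assms(2)[of "pr 0 y"] pr_mem[of 0 y] V0 by simp
qed

section \<open>Elements of \<open>t\<close> dual to the roots\<close>

abbreviation "tvec \<equiv> killing_dual t"

lemma killing_dual_eqI:
  assumes "h \<in> t" "\<And>h'. h' \<in> t \<Longrightarrow> killing_form h h' = \<gamma> h'" shows "tvec \<gamma> = h"
  unfolding killing_dual_def
proof (rule the_equality)
  fix k assume k: "k \<in> t \<and> (\<forall>h'\<in>t. killing_form k h' = \<gamma> h')"
  have "killing_form (k - h) h' = 0" if "h' \<in> t" for h'
    using k assms that killing_form_add_left[of "k - h" h h'] by simp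
  then show "k = h" using killing_form_t_nondegenerate[of "k - h"] k assms t_diff by auto
qed (use assms in blast)

lemma bracket_tvec:
  assumes "\<gamma> \<in> \<Delta>" "e \<in> V \<gamma>" "f \<in> V (- \<gamma>)" "killing_form e f = 1"
  shows "tvec \<gamma> = bracket e f"
proof (rule killing_dual_eqI)
  show "bracket e f \<in> t" using bracket_in_t assms by blast
  fix h' assume h: "h' \<in> t"
  have "bracket f h' = scaleC (\<gamma> h') f"
    using root_space_act[OF assms(3) h] bracket_skew[of f h'] by (simp add: complex_vector.scale_minus_left)
  then show "killing_form (bracket e f) h' = \<gamma> h'"
    using killing_form_invariant[OF finite_basis, of e f h'] assms(4) by (simp add: killing_form_scale_right)
qed

lemma sl2_triple:
  assumes "\<gamma> \<in> \<Delta>"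
  obtains e f where "e \<in> V \<gamma>" "f \<in> V (- \<gamma>)" "killing_form e f = 1" "bracket e f = tvec \<gamma>" "e \<noteq> 0"
proof -
  obtain e where e: "e \<in> V \<gamma>" "e \<noteq> 0" using root_vector_exists assms by blast
  obtain f where f: "f \<in> V (- \<gamma>)" "killing_form e f = 1"
    using killing_partner[OF e root_dual[OF assms]] by blast
  show ?thesis using that[OF e(1) f bracket_tvec[OF assms e(1) f, symmetric] e(2)] .
qed

lemma tvec_mem: "\<gamma> \<in> \<Delta> \<Longrightarrow> tvec \<gamma> \<in> t"
  by (metis sl2_triple bracket_in_t)

lemma killing_form_tvec: "\<gamma> \<in> \<Delta> \<Longrightarrow> h \<in> t \<Longrightarrow> killing_form (tvec \<gamma>) h = \<gamma> h"
proof -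
  assume g: "\<gamma> \<in> \<Delta>" and h: "h \<in> t"
  obtain e f where ef: "e \<in> V \<gamma>" "f \<in> V (- \<gamma>)" "killing_form e f = 1" "bracket e f = tvec \<gamma>"
    using sl2_triple[OF g] by metis
  have "bracket f h = scaleC (\<gamma> h) f"
    using root_space_act[OF ef(2) h] bracket_skew[of f h] by (simp add: complex_vector.scale_minus_left)
  then show ?thesis
    using killing_form_invariant[OF finite_basis, of e f h] ef by (simp add: killing_form_scale_right)
qed

lemma root_form_eq: "\<gamma> \<in> \<Delta> \<Longrightarrow> \<delta> \<in> \<Delta> \<Longrightarrow> root_form t \<gamma> \<delta> = \<gamma> (tvec \<delta>)"
  unfolding root_form_def using killing_form_tvec tvec_mem by blast

lemma root_tvec_nonzero:
  assumes "\<gamma> \<in> \<Delta>" shows "\<gamma> (tvec \<gamma>) \<noteq> 0"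
proof
  assume z: "\<gamma> (tvec \<gamma>) = 0"
  obtain e f where ef: "e \<in> V \<gamma>" "f \<in> V (- \<gamma>)" "killing_form e f = 1" "bracket e f = tvec \<gamma>"
    using sl2_triple[OF assms] by metis
  then have "tvec \<gamma> = 0" using bracket_zero_if_root_zero[OF assms ef(1,2)] z by simp
  then have "\<gamma> h = 0" if "h \<in> t" for h
    using killing_form_tvec[OF assms that] killing_form_scale_left[of 0 0 h] by simp
  then have "\<gamma> = 0" using linear_dual_eqI[OF root_dual[OF assms] linear_dual_zero] by simp
  then show False using root_nonzero[OF assms] by blast
qed

end

section \<open>Root strings\<close>

context simple_triangular
begin

lemma root_scale_inj:
  assumes "\<gamma> \<in> \<Delta>" "of_int a * \<gamma> = of_int b * \<gamma>" shows "a = b"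
proof -
  obtain h where h: "\<gamma> h \<noteq> 0 h" using dual_separate[OF root_dual[OF assms(1)] linear_dual_zero root_nonzero[OF assms(1)]] by blast
  have "(of_int a * \<gamma>) h = (of_int b * \<gamma>) h" by (simp only: assms(2))
  then have "of_int a * \<gamma> h = of_int b * \<gamma> h" by (simp only: times_fun_apply of_int_fun)
  then show ?thesis using h by simp
qed

text \<open>The trace of \<open>ad [e, f]\<close> on \<open>\<complex>f \<oplus> t \<oplus> V \<gamma> \<oplus> V (2\<gamma>) \<oplus> \<dots>\<close> vanishes, so
  \<open>dim V \<gamma> + 2 dim V (2\<gamma>) + \<dots> = 1\<close>.\<close>

lemma mult_multiples:
  assumes g: "\<gamma> \<in> \<Delta>"
  defines "W \<equiv> {\<delta>\<in>\<Gamma>. \<exists>k\<ge>0::int. \<delta> = of_int k * \<gamma>}"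
  assumes k: "\<And>\<delta>. \<delta> \<in> W \<Longrightarrow> 0 \<le> k \<delta> \<and> \<delta> = of_int (k \<delta>) * \<gamma>"
  shows "(\<Sum>\<delta>\<in>W. int (mult \<delta>) * k \<delta>) = 1"
proof -
  obtain e f where ef: "e \<in> V \<gamma>" "f \<in> V (- \<gamma>)" "killing_form e f = 1" "bracket e f = tvec \<gamma>"
    using sl2_triple[OF g] by metis
  define h where "h = tvec \<gamma>"
  have h: "h \<in> t" "bracket e f = h" "\<gamma> h \<noteq> 0" using tvec_mem g ef root_tvec_nonzero unfolding h_def by auto
  have gd: "\<gamma> \<in> linear_dual t" "- \<gamma> \<in> linear_dual t" using root_dual[OF g] linear_dual_minus by auto
  have W: "W \<subseteq> \<Gamma>" "finite W" using finite_roots unfolding W_def by auto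
  have Wd: "\<delta> \<in> linear_dual t" if "\<delta> \<in> W" for \<delta> using W(1) that \<Gamma>_dual by blast
  have ng: "\<gamma> + \<delta> \<noteq> 0" if "\<delta> \<in> W" for \<delta>
  proof
    assume "\<gamma> + \<delta> = 0"
    then have "of_int (1 + k \<delta>) * \<gamma> = of_int 0 * \<gamma>" using k[OF that] by (simp add: algebra_simps)
    then have "1 + k \<delta> = 0" by (rule root_scale_inj[OF g])
    then show False using k[OF that] by simp
  qed
  \<comment> \<open>Projection onto the line of \<open>f\<close> plus the weight spaces in
    \<open>W\<close>: the functional \<open>killing_form e\<close> is 1 on \<open>f\<close> and
    vanishes on \<open>V \<delta>\<close> for \<delta> in \<open>W\<close>, because \<gamma> +
    \<delta> is not zero. Only the line of \<open>f\<close> is taken from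
    \<open>V (- \<gamma>)\<close>; it is invariant under \<open>t\<close>.\<close>
  define p where "p x = scaleC (killing_form e x) f + (\<Sum>\<delta>\<in>W. pr \<delta> x)" for x
  have p: "endo p" unfolding endo_def p_def
    by (simp add: endo_add[OF endo_pr] endo_scale[OF endo_pr] sum.distrib complex_vector.scale_sum_right
        killing_form_add_right killing_form_scale_right scaleC_add_left scaleC_add_right scaleC_scaleC algebra_simps)
  have pf: "p f = f"
  proof -
    have "pr \<delta> f = 0" if "\<delta> \<in> W" for \<delta>
      using pr_V[OF ef(2) gd(2), of \<delta>] ng[OF that] by (auto simp: add_eq_0_iff)
    then show ?thesis unfolding p_def ef(3) by (simp add: scaleC_one)
  qed
  have pV: "p y = y" if "y \<in> V \<delta>" "\<delta> \<in> W" for y \<delta>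
  proof -
    have "killing_form e y = 0" using killing_form_orthogonal[OF ef(1) that(1) gd(1) Wd ng] that by blast
    moreover have "(\<Sum>\<epsilon>\<in>W. pr \<epsilon> y) = (\<Sum>\<epsilon>\<in>W. if \<epsilon> = \<delta> then y else 0)"
      by (rule sum.cong[OF refl pr_V[OF that(1) Wd[OF that(2)]]])
    ultimately show ?thesis unfolding p_def using that(2) W(2) by simp
  qed
  have p0: "p 0 = 0" by (rule endo_zero[OF p])
  have zW: "0 \<in> W" unfolding W_def by (auto intro: exI[of _ 0])
  have fix_bracket: "p (bracket z (p x)) = bracket z (p x)"
    if zf: "p (bracket z f) = bracket z f"
      and zV: "\<And>\<delta> y. \<delta> \<in> W \<Longrightarrow> y \<in> V \<delta> \<Longrightarrow> p (bracket z y) = bracket z y" for z x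
  proof -
    have b: "bracket z (p x) = scaleC (killing_form e x) (bracket z f) + (\<Sum>\<delta>\<in>W. bracket z (pr \<delta> x))"
      unfolding p_def bracket_add_right bracket_sum_right bracket_scaleC_right ..
    have "p (bracket z (pr \<delta> x)) = bracket z (pr \<delta> x)" if "\<delta> \<in> W" for \<delta>
      by (rule zV[OF that pr_mem])
    then have "(\<Sum>\<delta>\<in>W. p (bracket z (pr \<delta> x))) = (\<Sum>\<delta>\<in>W. bracket z (pr \<delta> x))" by (rule sum.cong[OF refl])
    then show ?thesis unfolding b endo_add[OF p] endo_sum[OF p] endo_scale[OF p] zf by (rule arg_cong)
  qed
  have in_W: "\<delta> + of_int c * \<gamma> \<in> W" if "\<delta> \<in> W" "\<delta> + of_int c * \<gamma> \<in> \<Gamma>" "k \<delta> + c \<ge> 0" for \<delta> c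
  proof -
    have "\<delta> + of_int c * \<gamma> = of_int (k \<delta> + c) * \<gamma>" using k[OF that(1)] by (simp add: algebra_simps)
    then show ?thesis unfolding W_def using that(2,3) by blast
  qed
  have ef0: "bracket e f \<in> V 0" using bracket_in_t[OF ef(1,2)] V0 by simp
  have "endo_trace (\<lambda>x. bracket (bracket e f) (p x)) = 0"
  proof (rule endo_trace_commutator_zero[OF finite_basis p]; rule fix_bracket)
    show "p (bracket e f) = bracket e f" by (rule pV[OF ef0 zW])
    show "p (bracket f f) = bracket f f" by (simp only: bracket_self p0)
  next
    fix \<delta> y assume d: "\<delta> \<in> W" "y \<in> V \<delta>"
    show "p (bracket e y) = bracket e y"
    proof (cases "\<delta> + of_int 1 * \<gamma> \<in> \<Gamma>")
      case True
      have "\<delta> + of_int 1 * \<gamma> \<in> W" using in_W[OF d(1) True] k[OF d(1)] by simp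
      then have "\<gamma> + \<delta> \<in> W" by (simp add: add.commute)
      then show ?thesis by (rule pV[OF root_space_bracket[OF ef(1) d(2)]])
    next
      case False
      then have "\<gamma> + \<delta> \<notin> \<Gamma>" by (simp add: add.commute)
      then have "bracket e y = 0" using bracket_trivial[OF ef(1) d(2) _ gd(1) Wd[OF d(1)]] by blast
      then show ?thesis by (simp only: p0)
    qed
    show "p (bracket f y) = bracket f y"
    proof (cases "k \<delta> = 0")
      case True
      then have "\<delta> = 0" using k[OF d(1)] by simp
      then have "y \<in> t" using d(2) V0 by simp
      then have "bracket f y = scaleC (\<gamma> y) f"
        using root_space_act[OF ef(2), of y] bracket_skew[of f y] by (simp add: complex_vector.scale_minus_left)
      then show ?thesis by (simp only: endo_scale[OF p] pf)
    next
      case k0: False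
      show ?thesis
      proof (cases "\<delta> + of_int (-1) * \<gamma> \<in> \<Gamma>")
        case True
        have "\<delta> + of_int (-1) * \<gamma> \<in> W" using in_W[OF d(1) True] k[OF d(1)] k0 by simp
        then have "- \<gamma> + \<delta> \<in> W" by (simp add: add.commute)
        then show ?thesis by (rule pV[OF root_space_bracket[OF ef(2) d(2)]])
      next
        case False
        then have "- \<gamma> + \<delta> \<notin> \<Gamma>" by (simp add: add.commute)
        then have "bracket f y = 0" using bracket_trivial[OF ef(2) d(2) _ gd(2) Wd[OF d(1)]] by blast
        then show ?thesis by (simp only: p0)
      qed
    qed
  qed
  moreover have "bracket (bracket e f) (p x) =
      scaleC (killing_form e x) (scaleC (- \<gamma> h) f) + (\<Sum>\<delta>\<in>W. scaleC (\<delta> h) (pr \<delta> x))" for x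
  proof -
    have "bracket h f = scaleC (- \<gamma> h) f" using root_space_act[OF ef(2) h(1)] by simp
    moreover have "(\<Sum>\<delta>\<in>W. bracket h (pr \<delta> x)) = (\<Sum>\<delta>\<in>W. scaleC (\<delta> h) (pr \<delta> x))"
      by (rule sum.cong[OF refl root_space_act[OF pr_mem h(1)]])
    ultimately show ?thesis unfolding p_def bracket_add_right bracket_sum_right bracket_scaleC_right h(2) by simp
  qed
  ultimately have "endo_trace (\<lambda>x. scaleC (killing_form e x) (scaleC (- \<gamma> h) f)) +
      (\<Sum>\<delta>\<in>W. \<delta> h * of_nat (mult \<delta>)) = 0"
    by (simp only: endo_trace_add endo_trace_diagonal[OF W(1)])
  moreover have "endo_trace (\<lambda>x. scaleC (killing_form e x) (scaleC (- \<gamma> h) f)) = - \<gamma> h"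
    by (subst endo_trace_rank_one[OF finite_basis killing_form_add_right killing_form_scale_right])
      (simp only: killing_form_scale_right ef(3) mult_1_right)
  moreover have "(\<Sum>\<delta>\<in>W. \<delta> h * of_nat (mult \<delta>)) = of_int (\<Sum>\<delta>\<in>W. int (mult \<delta>) * k \<delta>) * \<gamma> h"
  proof -
    have "\<delta> h * of_nat (mult \<delta>) = of_int (int (mult \<delta>) * k \<delta>) * \<gamma> h" if "\<delta> \<in> W" for \<delta>
    proof -
      have "\<delta> h = (of_int (k \<delta>) * \<gamma>) h" using k[OF that] by (rule arg_cong[OF conjunct2])
      then have "\<delta> h = of_int (k \<delta>) * \<gamma> h" by (simp only: times_fun_apply of_int_fun)
      then show ?thesis by simp
    qed
    then show ?thesis unfolding of_int_sum sum_distrib_right by (rule sum.cong[OF refl])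
  qed
  ultimately have "of_int (\<Sum>\<delta>\<in>W. int (mult \<delta>) * k \<delta>) * \<gamma> h = 1 * \<gamma> h" by simp
  then have "(of_int (\<Sum>\<delta>\<in>W. int (mult \<delta>) * k \<delta>) :: complex) = 1" using h(3) by (simp only: mult_cancel_right) simp
  then show ?thesis by (simp only: of_int_eq_1_iff)
qed

text \<open>In a sum of nonnegative integers equal to 1, the root \<gamma> contributes its positive
  multiplicity. So that multiplicity is 1 and all higher multiples contribute nothing.\<close>

lemma
  assumes g: "\<gamma> \<in> \<Delta>"
  shows mult_one: "mult \<gamma> = 1" and multiple_not_root: "j \<ge> 2 \<Longrightarrow> of_int j * \<gamma> \<notin> \<Delta>"
proof -
  define W where "W = {\<delta>\<in>\<Gamma>. \<exists>k\<ge>0::int. \<delta> = of_int k * \<gamma>}"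
  have "\<forall>\<delta>\<in>W. \<exists>k::int. 0 \<le> k \<and> \<delta> = of_int k * \<gamma>" unfolding W_def by blast
  then obtain k where k: "\<forall>\<delta>\<in>W. 0 \<le> k \<delta> \<and> \<delta> = of_int (k \<delta>) * \<gamma>" by (rule bchoice[THEN exE])
  have sum: "(\<Sum>\<delta>\<in>W. int (mult \<delta>) * k \<delta>) = 1"
    by (rule mult_multiples[OF g, folded W_def]) (rule bspec[OF k])
  have fin: "finite W" using finite_roots unfolding W_def by auto
  have nn: "int (mult \<delta>) * k \<delta> \<ge> 0" if "\<delta> \<in> W" for \<delta> using k that by simp
  have gW: "\<gamma> \<in> W" using g unfolding W_def by (auto intro!: exI[of _ 1])
  have "of_int (k \<gamma>) * \<gamma> = of_int 1 * \<gamma>" using k gW by simp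
  then have kg: "k \<gamma> = 1" by (rule root_scale_inj[OF g])
  have split: "int (mult \<gamma>) + (\<Sum>\<delta>\<in>W - {\<gamma>}. int (mult \<delta>) * k \<delta>) = 1"
    using sum sum.remove[OF fin gW, of "\<lambda>\<delta>. int (mult \<delta>) * k \<delta>"] kg by simp
  have rest: "(\<Sum>\<delta>\<in>W - {\<gamma>}. int (mult \<delta>) * k \<delta>) \<ge> 0" using nn by (intro sum_nonneg) auto
  then show m: "mult \<gamma> = 1" using split mult_pos[OF g] by simp
  show "of_int j * \<gamma> \<notin> \<Delta>" if j: "j \<ge> 2"
  proof
    assume r: "of_int j * \<gamma> \<in> \<Delta>"
    define \<delta> where "\<delta> = of_int j * \<gamma>"
    have d: "\<delta> \<in> \<Delta>" using r unfolding \<delta>_def .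
    have "\<exists>k\<ge>0. \<delta> = of_int k * \<gamma>" using j unfolding \<delta>_def by (intro exI[of _ j] conjI refl) simp
    then have dW: "\<delta> \<in> W" using d unfolding W_def by blast
    have "of_int (k \<delta>) * \<gamma> = of_int j * \<gamma>" using bspec[OF k dW] unfolding \<delta>_def[symmetric] by (elim conjE) (rule sym)
    then have kd: "k \<delta> = j" by (rule root_scale_inj[OF g])
    have ne: "\<delta> \<noteq> \<gamma>"
    proof
      assume "\<delta> = \<gamma>"
      then have "k \<delta> = k \<gamma>" by (rule arg_cong)
      then show False using kd kg j by simp
    qed
    have "int (mult \<delta>) * k \<delta> \<le> (\<Sum>\<delta>\<in>W - {\<gamma>}. int (mult \<delta>) * k \<delta>)"
      using fin dW ne nn by (intro member_le_sum) auto
    moreover have "int (mult \<delta>) * k \<delta> > 0" unfolding kd using mult_pos[OF d] j by simp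
    ultimately show False using split m by simp
  qed
qed

lemma root_space_line:
  assumes "\<gamma> \<in> \<Delta>" "e \<in> V \<gamma>" "e \<noteq> 0" "x \<in> V \<gamma>" shows "\<exists>c. x = scaleC c e"
proof -
  obtain B where B: "B \<subseteq> V \<gamma>" "complex_vector.independent B" "V \<gamma> \<subseteq> cspan B" "card B = cdim (V \<gamma>)"
    using complex_vector.basis_exists by blast
  then have "card B = 1" using mult_one[OF assms(1)] unfolding mult_def by simp
  then obtain b where "B = {b}" by (rule card_1_singletonE)
  then have b: "V \<gamma> \<subseteq> range (\<lambda>k. scaleC k b)" using B(3) by (simp add: complex_vector.span_singleton)
  obtain c where c: "e = scaleC c b" using b assms(2) by blast
  obtain c' where c': "x = scaleC c' b" using b assms(4) by blast
  have "c \<noteq> 0" using c assms(3) by auto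
  then have "x = scaleC (c' / c) e" using c c' by (simp add: scaleC_scaleC)
  then show ?thesis ..
qed

text \<open>A zero on the string would make \<delta> an integer multiple of \<alpha>. Along the
  string, being outside \<Delta> and being outside \<Gamma> are therefore the same.\<close>

lemma string_nonzero:
  assumes "\<alpha> \<in> \<Delta>" "\<delta> \<in> \<Delta>" "\<delta> \<noteq> \<alpha>" "\<delta> \<noteq> - \<alpha>"
  shows "\<delta> + of_int k * \<alpha> \<noteq> 0"
proof
  assume z: "\<delta> + of_int k * \<alpha> = 0"
  then have d: "\<delta> = of_int (- k) * \<alpha>" by (simp add: eq_neg_iff_add_eq_0)
  consider "- k \<ge> 2" | "- k = 1" | "k = 0" | "k = 1" | "k \<ge> 2" by linarith
  then show False
  proof cases
    case 1
    then show ?thesis using multiple_not_root[OF assms(1)] d assms(2) by blast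
  next
    case 2
    then show ?thesis using d assms(3) by simp
  next
    case 3
    then show ?thesis using d root_nonzero[OF assms(2)] by simp
  next
    case 4
    then show ?thesis using d assms(4) by simp
  next
    case 5
    have "of_int k * (- \<alpha>) \<in> \<Delta>" using d assms(2) by simp
    then show ?thesis using multiple_not_root[OF minus_root[OF assms(1)] 5] by blast
  qed
qed

lemma string_inj:
  assumes "\<alpha> \<in> \<Delta>" shows "inj (\<lambda>k::int. \<delta> + of_int k * \<alpha>)"
  using root_scale_inj[OF assms] by (intro injI) simp

lemma string_end:
  assumes "\<alpha> \<in> \<Delta>" "\<delta> \<in> \<Delta>"
  shows "\<exists>q::nat. (\<forall>j\<le>q. \<delta> + of_int (int j) * \<alpha> \<in> \<Delta>) \<and> \<delta> + of_int (int q + 1) * \<alpha> \<notin> \<Delta>"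
proof -
  have "\<exists>j::nat. \<delta> + of_int (int j) * \<alpha> \<notin> \<Delta>"
  proof (rule ccontr)
    assume "\<not> ?thesis"
    then have "range (\<lambda>j::nat. \<delta> + of_int (int j) * \<alpha>) \<subseteq> \<Delta>" by blast
    moreover have "inj (\<lambda>j::nat. \<delta> + of_int (int j) * \<alpha>)"
      using inj_compose[OF string_inj[OF assms(1), of \<delta>] inj_of_nat] unfolding o_def .
    ultimately show False using finite_roots finite_subset finite_imageD[of _ "UNIV :: nat set"] by blast
  qed
  define m where "m = (LEAST j::nat. \<delta> + of_int (int j) * \<alpha> \<notin> \<Delta>)"
  have m: "\<delta> + of_int (int m) * \<alpha> \<notin> \<Delta>"
    unfolding m_def by (rule LeastI_ex) fact
  have lt: "\<delta> + of_int (int j) * \<alpha> \<in> \<Delta>" if "j < m" for j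
    using not_less_Least[of j "\<lambda>j. \<delta> + of_int (int j) * \<alpha> \<notin> \<Delta>"] that unfolding m_def by blast
  have "m \<noteq> 0" using m assms(2) by (intro notI) simp
  then obtain q where q: "m = Suc q" using not0_implies_Suc by blast
  have "int m = int q + 1" using q by simp
  then show ?thesis using m lt q by (metis less_Suc_eq_le)
qed

text \<open>All multiplicities are 1, so the trace over the segment from -r to q is its length times
  \<delta>(h) plus the sum of the positions times \<alpha>(h). Invariance at the two ends is a
  hypothesis, so the segment may be shorter than the full string.\<close>

lemma string_segment:
  assumes a: "\<alpha> \<in> \<Delta>" and seg: "\<And>k::int. - int r \<le> k \<Longrightarrow> k \<le> int q \<Longrightarrow> \<delta> + of_int k * \<alpha> \<in> \<Delta>"
    and e: "e \<in> V \<alpha>" and f: "f \<in> V (- \<alpha>)" and ef: "bracket e f = tvec \<alpha>"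
    and top: "\<And>x. x \<in> V (\<delta> + of_int (int q) * \<alpha>) \<Longrightarrow> bracket e x = 0"
    and bot: "\<And>x. x \<in> V (\<delta> + of_int (- int r) * \<alpha>) \<Longrightarrow> bracket f x = 0"
  shows "2 * \<delta> (tvec \<alpha>) = of_int (int r - int q) * \<alpha> (tvec \<alpha>)"
proof -
  define I where "I = {- int r..int q}"
  define w where "w k = \<delta> + of_int k * \<alpha>" for k :: int
  define h where "h = tvec \<alpha>"
  have inj: "inj_on w I" using string_inj[OF a, of \<delta>] unfolding w_def by (rule inj_on_subset) simp
  have wI: "w k \<in> \<Delta>" if "k \<in> I" for k using seg that unfolding I_def w_def by simp
  have step: "w k + \<alpha> = w (k + 1)" "w k - \<alpha> = w (k - 1)" for k unfolding w_def by (simp_all add: algebra_simps)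
  have "(\<Sum>\<delta>\<in>w ` I. of_nat (mult \<delta>) * \<delta> (bracket e f)) = 0"
  proof (rule string_trace[OF _ e f root_dual[OF a]])
    show "w ` I \<subseteq> \<Gamma>" using wI by blast
  next
    fix \<epsilon> x assume "\<epsilon> \<in> w ` I" and x: "x \<in> V \<epsilon>"
    then obtain k where k: "k \<in> I" "\<epsilon> = w k" by blast
    show "\<epsilon> + \<alpha> \<in> w ` I \<or> bracket e x = 0"
    proof (cases "k = int q")
      case True
      then show ?thesis using top[of x] x k(2) unfolding w_def by blast
    next
      case False
      then have "k + 1 \<in> I" using k(1) unfolding I_def by simp
      then show ?thesis unfolding k(2) step by blast
    qed
    show "\<epsilon> - \<alpha> \<in> w ` I \<or> bracket f x = 0"
    proof (cases "k = - int r")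
      case True
      then show ?thesis using bot[of x] x k(2) unfolding w_def by blast
    next
      case False
      then have "k - 1 \<in> I" using k(1) unfolding I_def by simp
      then show ?thesis unfolding k(2) step by blast
    qed
  qed
  then have "(\<Sum>k\<in>I. of_nat (mult (w k)) * w k h) = 0" unfolding ef h_def sum.reindex[OF inj] o_def .
  moreover have "(\<Sum>k\<in>I. of_nat (mult (w k)) * w k h) = (\<Sum>k\<in>I. \<delta> h + of_int k * \<alpha> h)"
  proof (rule sum.cong[OF refl])
    fix k assume "k \<in> I"
    then have "mult (w k) = 1" by (rule mult_one[OF wI])
    then show "of_nat (mult (w k)) * w k h = \<delta> h + of_int k * \<alpha> h"
      unfolding w_def by (simp add: of_int_fun)
  qed
  moreover define s where "s = \<Sum>I"
  ultimately have 0: "of_nat (card I) * \<delta> h + of_int s * \<alpha> h = 0"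
    by (simp add: sum.distrib sum_distrib_right)
  \<comment> \<open>The arithmetic progression is summed by induction on its length, doubled to stay
    within the integers; the segment has q + r + 1 members.\<close>
  have S: "2 * s = (int q - int r) * int (card I)"
  proof -
    have "2 * \<Sum>{- int r..- int r + int n - 1} = (2 * (- int r) + int n - 1) * int n" for n
    proof (induction n)
      case (Suc n)
      have "{- int r..- int r + int (Suc n) - 1} = insert (- int r + int n) {- int r..- int r + int n - 1}" by auto
      then show ?case using Suc by (simp add: algebra_simps)
    qed simp
    from this[of "q + r + 1"] show ?thesis unfolding I_def s_def by (simp add: algebra_simps)
  qed
  have c: "card I > 0" unfolding I_def by simp
  have "of_nat (card I) * \<delta> h = - (of_int s * \<alpha> h)" using 0 by (simp only: eq_neg_iff_add_eq_0)
  then have "2 * (of_nat (card I) * \<delta> h) = 2 * - (of_int s * \<alpha> h)" by (rule arg_cong)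
  then have "of_nat (card I) * (2 * \<delta> h) = - (of_int (2 * s) * \<alpha> h)"
    by (simp only: mult.left_commute[of 2] of_int_mult of_int_numeral mult_minus_right mult.assoc)
  also have "\<dots> = of_nat (card I) * (of_int (int r - int q) * \<alpha> h)" unfolding S by (simp add: algebra_simps)
  finally show ?thesis using c unfolding h_def by simp
qed

lemma root_string_full:
  assumes a: "\<alpha> \<in> \<Delta>" and d: "\<delta> \<in> \<Delta>" and ne: "\<delta> \<noteq> \<alpha>" "\<delta> \<noteq> - \<alpha>"
  shows "\<exists>r q::nat. (\<forall>k::int. - int r \<le> k \<longrightarrow> k \<le> int q \<longrightarrow> \<delta> + of_int k * \<alpha> \<in> \<Delta>) \<and>
    \<delta> + of_int (int q + 1) * \<alpha> \<notin> \<Gamma> \<and> \<delta> + of_int (- int r - 1) * \<alpha> \<notin> \<Gamma>"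
proof -
  obtain q where q: "\<forall>j\<le>q. \<delta> + of_int (int j) * \<alpha> \<in> \<Delta>" "\<delta> + of_int (int q + 1) * \<alpha> \<notin> \<Delta>"
    using string_end[OF a d] by blast
  obtain r where r: "\<forall>j\<le>r. \<delta> + of_int (int j) * (- \<alpha>) \<in> \<Delta>" "\<delta> + of_int (int r + 1) * (- \<alpha>) \<notin> \<Delta>"
    using string_end[OF minus_root[OF a] d] by blast
  have "\<delta> + of_int k * \<alpha> \<in> \<Delta>" if k: "- int r \<le> k" "k \<le> int q" for k
  proof (cases "k \<ge> 0")
    case True
    then have "nat k \<le> q" "int (nat k) = k" using k by auto
    then show ?thesis using q(1) by metis
  next
    case False
    then have n: "nat (- k) \<le> r" "int (nat (- k)) = - k" using k by auto
    have "\<delta> + of_int (int (nat (- k))) * (- \<alpha>) \<in> \<Delta>" using r(1) n(1) by blast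
    then show ?thesis unfolding n(2) by simp
  qed
  moreover have "\<delta> + of_int (int q + 1) * \<alpha> \<notin> \<Gamma>" using q(2) string_nonzero[OF a d ne] by blast
  moreover have "of_int (int r + 1) * (- \<alpha>) = of_int (- int r - 1) * \<alpha>" by (simp add: algebra_simps)
  then have "\<delta> + of_int (- int r - 1) * \<alpha> \<notin> \<Gamma>" using r(2) string_nonzero[OF a d ne] by (metis insert_iff)
  ultimately show ?thesis by blast
qed

lemma bracket_string_end:
  assumes "x \<in> V (\<delta> + of_int k * \<alpha>)" "e \<in> V \<alpha>" "\<alpha> \<in> linear_dual t" "\<delta> \<in> linear_dual t"
    "\<delta> + of_int (k + 1) * \<alpha> \<notin> \<Gamma>"
  shows "bracket e x = 0"
proof (rule bracket_trivial[OF assms(2,1) _ assms(3)])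
  have "\<alpha> + (\<delta> + of_int k * \<alpha>) = \<delta> + of_int (k + 1) * \<alpha>" by (simp add: algebra_simps)
  then show "\<alpha> + (\<delta> + of_int k * \<alpha>) \<notin> \<Gamma>" using assms(5) by (simp only: not_False_eq_True)
qed (intro linear_dual_add linear_dual_scale assms)

lemma bracket_string_end':
  assumes "x \<in> V (\<delta> + of_int k * \<alpha>)" "f \<in> V (- \<alpha>)" "\<alpha> \<in> linear_dual t" "\<delta> \<in> linear_dual t"
    "\<delta> + of_int (k - 1) * \<alpha> \<notin> \<Gamma>"
  shows "bracket f x = 0"
proof (rule bracket_string_end[OF _ assms(2) linear_dual_minus[OF assms(3)] assms(4)])
  show "x \<in> V (\<delta> + of_int (- k) * (- \<alpha>))" using assms(1) by simp
  have "of_int (- k + 1) * (- \<alpha>) = of_int (k - 1) * \<alpha>" by (simp add: algebra_simps)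
  then show "\<delta> + of_int (- k + 1) * (- \<alpha>) \<notin> \<Gamma>" using assms(5) by (simp only: not_False_eq_True)
qed

lemma string_ends:
  assumes a: "\<alpha> \<in> \<Delta>" and d: "\<delta> \<in> \<Delta>" and ne: "\<delta> \<noteq> \<alpha>" "\<delta> \<noteq> - \<alpha>"
  shows "\<exists>r q::nat. 2 * \<delta> (tvec \<alpha>) = of_int (int r - int q) * \<alpha> (tvec \<alpha>) \<and>
    (\<forall>k::int. - int r \<le> k \<longrightarrow> k \<le> int q \<longrightarrow> \<delta> + of_int k * \<alpha> \<in> \<Delta>)"
proof -
  obtain r q :: nat where rq: "\<forall>k::int. - int r \<le> k \<longrightarrow> k \<le> int q \<longrightarrow> \<delta> + of_int k * \<alpha> \<in> \<Delta>"
    "\<delta> + of_int (int q + 1) * \<alpha> \<notin> \<Gamma>" "\<delta> + of_int (- int r - 1) * \<alpha> \<notin> \<Gamma>"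
    using root_string_full[OF assms] by blast
  obtain e f where ef: "e \<in> V \<alpha>" "f \<in> V (- \<alpha>)" "bracket e f = tvec \<alpha>"
    using sl2_triple[OF a] by metis
  have "2 * \<delta> (tvec \<alpha>) = of_int (int r - int q) * \<alpha> (tvec \<alpha>)"
  proof (rule string_segment[OF a _ ef])
    show "\<delta> + of_int k * \<alpha> \<in> \<Delta>" if "- int r \<le> k" "k \<le> int q" for k using rq(1) that by blast
    show "bracket e x = 0" if "x \<in> V (\<delta> + of_int (int q) * \<alpha>)" for x
      by (rule bracket_string_end[OF that ef(1) root_dual[OF a] root_dual[OF d] rq(2)])
    show "bracket f x = 0" if "x \<in> V (\<delta> + of_int (- int r) * \<alpha>)" for x
      by (rule bracket_string_end'[OF that ef(2) root_dual[OF a] root_dual[OF d] rq(3)])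
  qed
  then show ?thesis using rq(1) by blast
qed

text \<open>If the bracket vanished, the part of the string below \<open>\<delta>\<close> would be invariant as well as the
  whole string, and the two traces would contradict each other.\<close>

lemma bracket_nonzero:
  assumes a: "\<alpha> \<in> \<Delta>" and d: "\<delta> \<in> \<Delta>" and s: "\<alpha> + \<delta> \<in> \<Delta>"
    and e: "e \<in> V \<alpha>" "e \<noteq> 0" and x: "x \<in> V \<delta>" "x \<noteq> 0"
  shows "bracket e x \<noteq> 0"
proof
  assume z: "bracket e x = 0"
  have ne: "\<delta> \<noteq> \<alpha>" "\<delta> \<noteq> - \<alpha>"
  proof -
    have "of_int 2 * \<alpha> \<notin> \<Delta>" by (rule multiple_not_root[OF a]) simp
    moreover have "of_int 2 * \<alpha> = \<alpha> + \<alpha>" by (simp only: of_int_numeral mult_2)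
    ultimately have "\<alpha> + \<alpha> \<notin> \<Delta>" by (simp only: not_False_eq_True)
    then show "\<delta> \<noteq> \<alpha>" using s by blast
    show "\<delta> \<noteq> - \<alpha>"
    proof
      assume "\<delta> = - \<alpha>"
      then have "\<alpha> + \<delta> = 0" by (simp only: add.right_inverse)
      then show False using s zero_notin_roots by (simp only:)
    qed
  qed
  obtain r q :: nat where rq: "\<forall>k::int. - int r \<le> k \<longrightarrow> k \<le> int q \<longrightarrow> \<delta> + of_int k * \<alpha> \<in> \<Delta>"
    "\<delta> + of_int (int q + 1) * \<alpha> \<notin> \<Gamma>" "\<delta> + of_int (- int r - 1) * \<alpha> \<notin> \<Gamma>"
    using root_string_full[OF a d ne] by blast
  obtain f where f: "f \<in> V (- \<alpha>)" "killing_form e f = 1" using killing_partner[OF e root_dual[OF a]] by blast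
  have ef: "bracket e f = tvec \<alpha>" by (rule bracket_tvec[OF a e(1) f, symmetric])
  have bot: "bracket f y = 0" if "y \<in> V (\<delta> + of_int (- int r) * \<alpha>)" for y
    by (rule bracket_string_end'[OF that f(1) root_dual[OF a] root_dual[OF d] rq(3)])
  have full: "2 * \<delta> (tvec \<alpha>) = of_int (int r - int q) * \<alpha> (tvec \<alpha>)"
  proof (rule string_segment[OF a _ e(1) f(1) ef _ bot])
    show "\<delta> + of_int k * \<alpha> \<in> \<Delta>" if "- int r \<le> k" "k \<le> int q" for k using rq(1) that by blast
    show "bracket e x = 0" if "x \<in> V (\<delta> + of_int (int q) * \<alpha>)" for x
      by (rule bracket_string_end[OF that e(1) root_dual[OF a] root_dual[OF d] rq(2)])
  qed
  \<comment> \<open>The segment that ends at \<delta>, with 0 in the place of q: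
    \<open>V \<delta>\<close> is the line through x, so \<open>e\<close> kills it and the segment is
    invariant.\<close>
  have half: "2 * \<delta> (tvec \<alpha>) = of_int (int r - int 0) * \<alpha> (tvec \<alpha>)"
  proof (rule string_segment[OF a _ e(1) f(1) ef _ bot])
    show "\<delta> + of_int k * \<alpha> \<in> \<Delta>" if "- int r \<le> k" "k \<le> int 0" for k using rq(1) that by simp
    show "bracket e y = 0" if "y \<in> V (\<delta> + of_int (int 0) * \<alpha>)" for y
    proof -
      have "y \<in> V \<delta>" using that by simp
      then obtain c where "y = scaleC c x" using root_space_line[OF d x] by blast
      then show ?thesis using z by (simp add: bracket_scaleC_right)
    qed
  qed
  have "(of_int (int r - int q) :: complex) = of_int (int r - int 0)"
    using full half root_tvec_nonzero[OF a] by (metis mult_cancel_right)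
  then have "q = 0" by simp
  then have "\<delta> + \<alpha> \<notin> \<Gamma>" using rq(2) by simp
  then show False using s by (simp add: add.commute)
qed

section \<open>Reality and positivity of the form on the roots\<close>

lemma tvec_sym: "\<gamma> \<in> \<Delta> \<Longrightarrow> \<delta> \<in> \<Delta> \<Longrightarrow> \<gamma> (tvec \<delta>) = \<delta> (tvec \<gamma>)"
  using killing_form_tvec[of \<gamma> "tvec \<delta>"] killing_form_tvec[of \<delta> "tvec \<gamma>"] tvec_mem[of \<gamma>] tvec_mem[of \<delta>]
    killing_form_sym[OF finite_basis, of "tvec \<gamma>" "tvec \<delta>"] by simp

lemma killing_form_t_sum:
  assumes "h \<in> t" "h' \<in> t" shows "killing_form h h' = (\<Sum>\<gamma>\<in>\<Delta>. \<gamma> h * \<gamma> h')"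
  unfolding killing_form_t[OF assms] by (rule sum.cong[OF refl]) (simp add: mult_one)

lemma tvec_ratio: "\<gamma> \<in> \<Delta> \<Longrightarrow> \<delta> \<in> \<Delta> \<Longrightarrow> \<exists>n::int. 2 * \<gamma> (tvec \<delta>) = of_int n * \<delta> (tvec \<delta>)"
proof -
  assume g: "\<gamma> \<in> \<Delta>" and d: "\<delta> \<in> \<Delta>"
  consider "\<gamma> = \<delta>" | "\<gamma> = - \<delta>" | "\<gamma> \<noteq> \<delta>" "\<gamma> \<noteq> - \<delta>" by blast
  then show ?thesis
  proof cases
    case 1 then show ?thesis by (intro exI[of _ 2]) simp
  next
    case 2 then show ?thesis by (intro exI[of _ "-2"]) simp
  next
    case 3 then show ?thesis using string_ends[OF d g] by blast
  qed
qed

text \<open>With z = \<gamma>(\<open>tvec \<gamma>\<close>) and integral Cartan numbers n, the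
  expression of the Killing form as a sum over roots gives 4 z = s z^2 with s the sum of the n^2;
  since z is not zero, z = 4 / s.\<close>

lemma root_norm_real:
  assumes "\<gamma> \<in> \<Delta>" shows "\<exists>a::real. a > 0 \<and> \<gamma> (tvec \<gamma>) = of_real a"
proof -
  let ?h = "tvec \<gamma>"
  define z where "z = \<gamma> ?h"
  have "\<forall>\<delta>\<in>\<Delta>. \<exists>n::int. 2 * \<delta> ?h = of_int n * \<gamma> ?h" using tvec_ratio[OF _ assms] by blast
  then obtain n :: "('g \<Rightarrow> complex) \<Rightarrow> int" where n: "\<forall>\<delta>\<in>\<Delta>. 2 * \<delta> ?h = of_int (n \<delta>) * \<gamma> ?h"
    by (rule bchoice[THEN exE])
  define s where "s = (\<Sum>\<delta>\<in>\<Delta>. (real_of_int (n \<delta>))\<^sup>2)"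
  have "z = (\<Sum>\<delta>\<in>\<Delta>. \<delta> ?h * \<delta> ?h)"
    unfolding z_def using killing_form_t_sum[of ?h ?h] tvec_mem[OF assms] killing_form_tvec[OF assms, of ?h] by simp
  then have "4 * z = (\<Sum>\<delta>\<in>\<Delta>. (2 * \<delta> ?h) * (2 * \<delta> ?h))" by (simp add: sum_distrib_left)
  also have "\<dots> = (\<Sum>\<delta>\<in>\<Delta>. of_real ((real_of_int (n \<delta>))\<^sup>2) * z\<^sup>2)"
  proof (rule sum.cong[OF refl])
    fix \<delta> assume "\<delta> \<in> \<Delta>"
    then have "2 * \<delta> ?h = of_int (n \<delta>) * z" using n unfolding z_def by blast
    then show "(2 * \<delta> ?h) * (2 * \<delta> ?h) = of_real ((real_of_int (n \<delta>))\<^sup>2) * z\<^sup>2"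
      by (simp only:) (simp add: power2_eq_square)
  qed
  also have "\<dots> = of_real s * z\<^sup>2" unfolding s_def of_real_sum sum_distrib_right ..
  finally have eq: "4 * z = of_real s * z\<^sup>2" .
  have nz: "z \<noteq> 0" using root_tvec_nonzero[OF assms] unfolding z_def .
  then have "4 = of_real s * z" using eq by (simp add: power2_eq_square)
  moreover have "s \<noteq> 0" using calculation by auto
  ultimately have "z = of_real (4 / s)" by (simp add: field_simps)
  moreover have "s \<ge> 0" unfolding s_def by (intro sum_nonneg) auto
  then have "4 / s > 0" using \<open>s \<noteq> 0\<close> by simp
  ultimately show ?thesis unfolding z_def by blast
qed

lemma root_tvec_real: "\<gamma> \<in> \<Delta> \<Longrightarrow> \<delta> \<in> \<Delta> \<Longrightarrow> \<gamma> (tvec \<delta>) \<in> \<real>"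
proof -
  assume g: "\<gamma> \<in> \<Delta>" and d: "\<delta> \<in> \<Delta>"
  obtain n :: int where n: "2 * \<gamma> (tvec \<delta>) = of_int n * \<delta> (tvec \<delta>)" using tvec_ratio[OF g d] by blast
  obtain a where "\<delta> (tvec \<delta>) = of_real a" using root_norm_real[OF d] by blast
  then have "2 * \<gamma> (tvec \<delta>) / 2 = of_real (real_of_int n * a / 2)" unfolding n by simp
  then have "\<gamma> (tvec \<delta>) = of_real (real_of_int n * a / 2)" by simp
  then show ?thesis by (metis Reals_of_real)
qed

text \<open>On roots this is the form induced by the Killing form. Written as a sum over the roots
  it is additive, symmetric and real-valued on arbitrary functions, as the abstract locale
  requires.\<close>

definition ip :: "('g \<Rightarrow> complex) \<Rightarrow> ('g \<Rightarrow> complex) \<Rightarrow> real" where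
  "ip x y = Re (\<Sum>\<rho>\<in>\<Delta>. x (tvec \<rho>) * y (tvec \<rho>))"

lemma ip_roots:
  assumes "\<gamma> \<in> \<Delta>" "\<delta> \<in> \<Delta>" shows "\<gamma> (tvec \<delta>) = of_real (ip \<gamma> \<delta>)"
proof -
  have "\<gamma> (tvec \<delta>) = (\<Sum>\<rho>\<in>\<Delta>. \<rho> (tvec \<gamma>) * \<rho> (tvec \<delta>))"
    using killing_form_tvec[OF assms(1) tvec_mem[OF assms(2)]] killing_form_t_sum[OF tvec_mem[OF assms(1)] tvec_mem[OF assms(2)]]
    by simp
  also have "\<dots> = (\<Sum>\<rho>\<in>\<Delta>. \<gamma> (tvec \<rho>) * \<delta> (tvec \<rho>))"
  proof (rule sum.cong[OF refl])
    fix \<rho> assume "\<rho> \<in> \<Delta>"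
    then show "\<rho> (tvec \<gamma>) * \<rho> (tvec \<delta>) = \<gamma> (tvec \<rho>) * \<delta> (tvec \<rho>)"
      using tvec_sym[of \<rho> \<gamma>] tvec_sym[of \<rho> \<delta>] assms by simp
  qed
  finally have "\<gamma> (tvec \<delta>) = (\<Sum>\<rho>\<in>\<Delta>. \<gamma> (tvec \<rho>) * \<delta> (tvec \<rho>))" .
  then have "ip \<gamma> \<delta> = Re (\<gamma> (tvec \<delta>))" unfolding ip_def by simp
  then show ?thesis using root_tvec_real[OF assms] by (simp add: of_real_Re)
qed

lemma linear_dual_sum: "(\<And>i. i \<in> I \<Longrightarrow> f i \<in> linear_dual t) \<Longrightarrow> sum f I \<in> linear_dual t"
  by (induction I rule: infinite_finite_induct) (auto simp: linear_dual_zero linear_dual_add)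

lemma sum_fun_apply: "(sum f I) h = (\<Sum>i\<in>I. f i (h::'g) :: complex)"
  by (induction I rule: infinite_finite_induct) auto

text \<open>The square of a real combination x is the sum of the squares of its values on the
  \<open>tvec \<rho>\<close>, so these values vanish. The element of \<open>t\<close> dual to x is
  then killed by all roots and must be zero.\<close>

lemma ip_pos_def:
  assumes "ip (\<Sum>\<gamma>\<in>\<Delta>. of_int (c \<gamma>) * \<gamma>) (\<Sum>\<gamma>\<in>\<Delta>. of_int (c \<gamma>) * \<gamma>) \<le> 0"
  shows "(\<Sum>\<gamma>\<in>\<Delta>. of_int (c \<gamma>) * \<gamma>) = 0"
proof -
  define x where "x = (\<Sum>\<gamma>\<in>\<Delta>. of_int (c \<gamma>) * \<gamma>)"
  have xh: "x h = (\<Sum>\<gamma>\<in>\<Delta>. of_int (c \<gamma>) * \<gamma> h)" for h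
    unfolding x_def sum_fun_apply by (simp add: of_int_fun)
  define a where "a \<rho> = Re (x (tvec \<rho>))" for \<rho>
  have a: "x (tvec \<rho>) = of_real (a \<rho>)" if "\<rho> \<in> \<Delta>" for \<rho>
  proof -
    have "x (tvec \<rho>) \<in> \<real>" unfolding xh using root_tvec_real[OF _ that] by (intro sum_in_Reals Reals_mult) auto
    then show ?thesis unfolding a_def by (simp add: of_real_Re)
  qed
  have "(\<Sum>\<rho>\<in>\<Delta>. x (tvec \<rho>) * x (tvec \<rho>)) = of_real (\<Sum>\<rho>\<in>\<Delta>. (a \<rho>)\<^sup>2)"
    unfolding of_real_sum by (rule sum.cong[OF refl]) (simp add: a power2_eq_square)
  then have "ip x x = (\<Sum>\<rho>\<in>\<Delta>. (a \<rho>)\<^sup>2)" unfolding ip_def by simp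
  then have "(\<Sum>\<rho>\<in>\<Delta>. (a \<rho>)\<^sup>2) = 0"
    using assms sum_nonneg[of \<Delta> "\<lambda>\<rho>. (a \<rho>)\<^sup>2"] unfolding x_def[symmetric] by simp
  then have "a \<rho> = 0" if "\<rho> \<in> \<Delta>" for \<rho> using that finite_roots by (simp add: sum_nonneg_eq_0_iff)
  then have x0: "x (tvec \<rho>) = 0" if "\<rho> \<in> \<Delta>" for \<rho> using a that by simp
  \<comment> \<open>The element of \<open>t\<close> that represents x through the Killing
    form.\<close>
  define v where "v = (\<Sum>\<gamma>\<in>\<Delta>. scaleC (of_int (c \<gamma>)) (tvec \<gamma>))"
  have vt: "v \<in> t" unfolding v_def
    by (rule complex_vector.subspace_sum[OF t_subspace]) (intro t_scale tvec_mem)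
  have kv: "killing_form v h = x h" if "h \<in> t" for h
  proof -
    have "killing_form v h = killing_form h v" by (rule killing_form_sym[OF finite_basis])
    also have "\<dots> = (\<Sum>\<gamma>\<in>\<Delta>. of_int (c \<gamma>) * killing_form h (tvec \<gamma>))"
      unfolding v_def killing_form_sum_right killing_form_scale_right ..
    also have "\<dots> = x h"
      unfolding xh using killing_form_tvec[OF _ that] killing_form_sym[OF finite_basis, of h]
      by (intro sum.cong) auto
    finally show ?thesis .
  qed
  have "v = 0"
  proof (rule annihilated_zero[OF vt])
    fix \<rho> assume r: "\<rho> \<in> \<Delta>"
    have "\<rho> v = killing_form (tvec \<rho>) v" by (rule killing_form_tvec[OF r vt, symmetric])
    also have "\<dots> = killing_form v (tvec \<rho>)" by (rule killing_form_sym[OF finite_basis])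
    also have "\<dots> = 0" using kv[OF tvec_mem[OF r]] x0[OF r] by simp
    finally show "\<rho> v = 0" .
  qed
  then have xt: "x h = 0" if "h \<in> t" for h using kv[OF that] killing_form_scale_left[of 0 0 h] by simp
  have "x \<in> linear_dual t" unfolding x_def by (intro linear_dual_sum linear_dual_scale root_dual)
  then show ?thesis unfolding x_def[symmetric] by (rule linear_dual_eqI[OF _ linear_dual_zero]) (simp add: xt)
qed

sublocale positive_roots \<Delta> ip \<Delta>p
proof
  show "finite \<Delta>" by (rule finite_roots)
  show "0 \<notin> \<Delta>" by (rule zero_notin_roots)
  show "- \<gamma> \<in> \<Delta>" if "\<gamma> \<in> \<Delta>" for \<gamma> using minus_root that .
  show "ip x y = ip y x" for x y unfolding ip_def by (simp add: mult.commute)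
  show "ip (x + y) z = ip x z + ip y z" for x y z
    unfolding ip_def by (simp add: algebra_simps sum.distrib)
  show "(\<Sum>\<gamma>\<in>\<Delta>. of_int (c \<gamma>) * \<gamma>) = 0"
    if "ip (\<Sum>\<gamma>\<in>\<Delta>. of_int (c \<gamma>) * \<gamma>) (\<Sum>\<gamma>\<in>\<Delta>. of_int (c \<gamma>) * \<gamma>) \<le> 0" for c
    by (rule ip_pos_def[OF that])
  show "\<exists>r q::nat. 2 * ip \<delta> \<gamma> = (real r - real q) * ip \<gamma> \<gamma> \<and>
        (\<forall>k::int. - int r \<le> k \<longrightarrow> k \<le> int q \<longrightarrow> \<delta> + of_int k * \<gamma> \<in> \<Delta>)"
    if gd: "\<gamma> \<in> \<Delta>" "\<delta> \<in> \<Delta>" "\<delta> \<noteq> \<gamma>" "\<delta> \<noteq> - \<gamma>" for \<gamma> \<delta>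
  proof -
    obtain r q :: nat where rq: "2 * \<delta> (tvec \<gamma>) = of_int (int r - int q) * \<gamma> (tvec \<gamma>)"
      "\<forall>k::int. - int r \<le> k \<longrightarrow> k \<le> int q \<longrightarrow> \<delta> + of_int k * \<gamma> \<in> \<Delta>"
      using string_ends[OF gd] by blast
    have "complex_of_real (2 * ip \<delta> \<gamma>) = of_real ((real r - real q) * ip \<gamma> \<gamma>)"
      using rq(1) unfolding ip_roots[OF gd(2,1)] ip_roots[OF gd(1,1)] by simp
    then have "2 * ip \<delta> \<gamma> = (real r - real q) * ip \<gamma> \<gamma>" by (simp only: of_real_eq_iff)
    then show ?thesis using rq(2) by blast
  qed
  show "\<Delta>p \<subseteq> \<Delta>" by (rule positive_subset)
  show "- \<gamma> \<notin> \<Delta>p" if "\<gamma> \<in> \<Delta>p" for \<gamma>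
  proof
    assume "- \<gamma> \<in> \<Delta>p"
    then have "- (- \<gamma>) \<in> uminus ` \<Delta>p" by (rule imageI)
    then have "\<gamma> \<in> \<Delta>p \<inter> uminus ` \<Delta>p" using that by simp
    moreover have "\<Delta>p \<inter> uminus ` \<Delta>p = {}" using positive unfolding positive_system_def by (elim conjE)
    ultimately show False by (simp only: empty_iff)
  qed
  show "\<gamma> \<in> \<Delta>p \<or> - \<gamma> \<in> \<Delta>p" if "\<gamma> \<in> \<Delta>" for \<gamma> by (rule root_cases[OF that])
  show "\<gamma> + \<delta> \<in> \<Delta>p" if "\<gamma> \<in> \<Delta>p" "\<delta> \<in> \<Delta>p" "\<gamma> + \<delta> \<in> \<Delta>" for \<gamma> \<delta>
    using positive that unfolding positive_system_def by blast
qed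

lemma ip_zero_iff: "\<gamma> \<in> \<Delta> \<Longrightarrow> \<delta> \<in> \<Delta> \<Longrightarrow> ip \<gamma> \<delta> = 0 \<longleftrightarrow> \<gamma> (tvec \<delta>) = 0"
  by (simp add: ip_roots)

lemma opposite_bracket:
  assumes "\<delta> \<in> \<Delta>" "x \<in> V (- \<delta>)" "y \<in> V \<delta>" shows "\<exists>c. bracket x y = scaleC c (tvec \<delta>)"
proof -
  obtain e f where ef: "e \<in> V \<delta>" "f \<in> V (- \<delta>)" "killing_form e f = 1" "bracket e f = tvec \<delta>" "e \<noteq> 0"
    using sl2_triple[OF assms(1)] by metis
  have f0: "f \<noteq> 0" using ef(3) killing_form_scale_right[of e 0 0] by auto
  obtain a where a: "y = scaleC a e" using root_space_line[OF assms(1) ef(1,5) assms(3)] by blast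
  obtain b where b: "x = scaleC b f" using root_space_line[OF minus_root[OF assms(1)] ef(2) f0 assms(2)] by blast
  have "bracket x y = scaleC (- (b * a)) (tvec \<delta>)"
    unfolding a b bracket_scaleC_left bracket_scaleC_right scaleC_scaleC
    using bracket_skew[of f e] ef(4) by (simp add: complex_vector.scale_minus_left)
  then show ?thesis ..
qed

text \<open>An orthogonal decomposition \<open>\<Delta> = A \<union> B\<close> gives the ideal formed by the \<open>V \<gamma>\<close> with \<open>\<gamma> \<in> A\<close>
  and the common kernel of \<open>B\<close> in \<open>t\<close>.\<close>

lemma irreducible_roots_simple: "irreducible \<Delta>"
  unfolding irreducible_def
proof (intro conjI notI)
  assume e: "\<Delta> = {}"
  have "x = pr 0 x" for x using pr_sum[of x] e by simp
  then have "x \<in> t" for x using pr_mem[of 0 x] V0 by simp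
  then show False using nonabelian t_abelian by blast
next
  assume "\<exists>A B. A \<noteq> {} \<and> B \<noteq> {} \<and> A \<inter> B = {} \<and> \<Delta> = A \<union> B \<and> (\<forall>\<gamma>\<in>A. \<forall>\<delta>\<in>B. ip \<gamma> \<delta> = 0)"
  then obtain A B where A: "A \<noteq> {}" and B: "B \<noteq> {}" and disj: "A \<inter> B = {}" and AB: "\<Delta> = A \<union> B"
    and orth: "\<And>\<gamma> \<delta>. \<gamma> \<in> A \<Longrightarrow> \<delta> \<in> B \<Longrightarrow> ip \<gamma> \<delta> = 0" by metis
  have BR: "\<beta> \<in> \<Delta>" if "\<beta> \<in> B" for \<beta> using AB that by (simp only: UnI2)
  have AR: "\<beta> \<in> \<Delta>" if "\<beta> \<in> A" for \<beta> using AB that by (simp only: UnI1)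
  have case_AB: "\<gamma> \<in> A \<or> \<gamma> \<in> B" if "\<gamma> \<in> \<Delta>" for \<gamma> using that unfolding AB by (rule UnE) blast+
  \<comment> \<open>Otherwise \<beta> or \<beta> - \<delta> would be orthogonal to itself.\<close>
  have noA: False if b: "\<beta> \<in> B" and d: "\<delta> \<in> \<Delta>" and g: "\<beta> - \<delta> \<in> A" for \<beta> \<delta>
  proof -
    have 1: "ip (\<beta> - \<delta>) \<beta> = 0" by (rule orth[OF g b])
    from case_AB[OF d] show False
    proof
      assume "\<delta> \<in> A"
      then have "ip \<delta> \<beta> = 0" by (rule orth[OF _ b])
      then have "ip \<beta> \<beta> = 0" using 1 by (simp add: ip_diff_left)
      then show False using ip_root_pos[OF BR[OF b]] by simp
    next
      assume "\<delta> \<in> B"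
      then have "ip (\<beta> - \<delta>) \<delta> = 0" by (rule orth[OF g])
      then have "ip (\<beta> - \<delta>) (\<beta> - \<delta>) = 0" using 1 by (simp only: ip_diff_right)
      then show False using ip_root_pos[OF AR[OF g]] by simp
    qed
  qed
  have negB: "- \<beta> \<in> B" if "\<beta> \<in> B" for \<beta>
  proof (rule ccontr)
    assume "- \<beta> \<notin> B"
    then have "- \<beta> \<in> A" using case_AB[OF minus_root[OF BR[OF that]]] by blast
    from orth[OF this that] show False using ip_root_pos[OF BR[OF that]] by simp
  qed
  define J where "J = {x. (\<forall>\<gamma>\<in>B. pr \<gamma> x = 0) \<and> (\<forall>\<beta>\<in>B. \<beta> (pr 0 x) = 0)}"
  have J2: "\<beta> (pr 0 x) = 0" if "x \<in> J" "\<beta> \<in> B" for \<beta> x using that unfolding J_def by blast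
  have pt: "pr 0 x \<in> t" for x using pr_mem[of 0 x] V0 by simp
  have sub: "csubspace J"
    unfolding complex_vector.subspace_def
  proof (intro conjI ballI allI)
    have "\<beta> 0 = 0" if "\<beta> \<in> B" for \<beta> by (rule dual_zero[OF root_dual[OF BR[OF that]]])
    then show "0 \<in> J" unfolding J_def by (simp add: endo_zero[OF endo_pr])
  next
    fix x y assume xy: "x \<in> J" "y \<in> J"
    show "x + y \<in> J"
      unfolding J_def mem_Collect_eq
    proof (intro conjI ballI)
      show "pr \<gamma> (x + y) = 0" if "\<gamma> \<in> B" for \<gamma>
        using xy that unfolding J_def by (simp add: endo_add[OF endo_pr])
      show "\<beta> (pr 0 (x + y)) = 0" if "\<beta> \<in> B" for \<beta>
        using dual_add[OF root_dual[OF BR[OF that]] pt pt, of x y] J2[OF xy(1) that] J2[OF xy(2) that]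
        by (simp add: endo_add[OF endo_pr])
    qed
  next
    fix c x assume x: "x \<in> J"
    show "scaleC c x \<in> J"
      unfolding J_def mem_Collect_eq
    proof (intro conjI ballI)
      show "pr \<gamma> (scaleC c x) = 0" if "\<gamma> \<in> B" for \<gamma>
        using x that unfolding J_def by (simp add: endo_scale[OF endo_pr])
      show "\<beta> (pr 0 (scaleC c x)) = 0" if "\<beta> \<in> B" for \<beta>
        using dual_scale[OF root_dual[OF BR[OF that]] pt, of c x] J2[OF x that] by (simp add: endo_scale[OF endo_pr])
    qed
  qed
  have br: "bracket x y \<in> J" if x: "x \<in> J" and d: "\<delta> \<in> \<Gamma>" and y: "y \<in> V \<delta>" for x y \<delta>
  proof -
    have P: "pr \<epsilon> (bracket x y) = bracket (pr (\<epsilon> - \<delta>) x) y" if "\<epsilon> \<in> linear_dual t" for \<epsilon>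
      by (rule pr_bracket[OF y \<Gamma>_dual[OF d] that])
    have xB: "pr \<gamma> x = 0" if "\<gamma> \<in> B" for \<gamma> using x that unfolding J_def by blast
    have x0: "\<gamma> (pr 0 x) = 0" if "\<gamma> \<in> B" for \<gamma> by (rule J2[OF x that])
    have "pr \<beta> (bracket x y) = 0" if b: "\<beta> \<in> B" for \<beta>
    proof -
      have eq: "pr \<beta> (bracket x y) = bracket (pr (\<beta> - \<delta>) x) y" by (rule P[OF root_dual[OF BR[OF b]]])
      \<comment> \<open>The \<beta>-component of [x, y] comes from the component of x of weight
        \<beta> - \<delta>. That weight is zero, or in \<open>B\<close>, or not a weight at all; it
        cannot lie in \<open>A\<close> when \<delta> is a root.\<close>
      consider "\<delta> = \<beta>" | "\<delta> = 0" | "\<delta> \<in> \<Delta>" "\<beta> - \<delta> \<in> A" | "\<beta> - \<delta> \<in> B" | "\<beta> - \<delta> \<notin> \<Gamma>"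
        using d case_AB[of "\<beta> - \<delta>"] by fastforce
      then show ?thesis
      proof cases
        case 1
        then have "pr \<beta> (bracket x y) = bracket (pr 0 x) y" using eq by simp
        also have "\<dots> = scaleC (\<delta> (pr 0 x)) y" by (rule root_space_act[OF y pt])
        also have "\<dots> = 0" using x0[of \<delta>] b 1 by simp
        finally show ?thesis .
      next
        case 2
        then show ?thesis using eq xB[OF b] by simp
      next
        case 3
        then show ?thesis using noA[OF b] by blast
      next
        case 4
        then show ?thesis using eq xB by simp
      next
        case 5
        then show ?thesis using eq pr_outside[OF 5] by simp
      qed
    qed
    moreover have "\<beta> (pr 0 (bracket x y)) = 0" if b: "\<beta> \<in> B" for \<beta>
    proof -
      have \<beta>0: "\<beta> 0 = 0" by (rule dual_zero[OF root_dual[OF BR[OF b]]])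
      have eq: "pr 0 (bracket x y) = bracket (pr (- \<delta>) x) y" using P[OF linear_dual_zero] by simp
      consider "\<delta> = 0" | "\<delta> \<in> A" | "\<delta> \<in> B" using d case_AB[of \<delta>] by fastforce
      then show ?thesis
      proof cases
        case 1
        then have "bracket (pr (- \<delta>) x) y = 0" using t_abelian[OF pt, of y x] y V0 by simp
        then show ?thesis using eq \<beta>0 by simp
      next
        case 2
        obtain c where c: "bracket (pr (- \<delta>) x) y = scaleC c (tvec \<delta>)"
          using opposite_bracket[OF AR[OF 2] pr_mem y] by blast
        have "\<beta> (tvec \<delta>) = 0"
          using ip_zero_iff[OF BR[OF b] AR[OF 2]] orth[OF 2 b] ip_sym[of \<beta> \<delta>] by simp
        then have "\<beta> (scaleC c (tvec \<delta>)) = 0"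
          using dual_scale[OF root_dual[OF BR[OF b]] tvec_mem[OF AR[OF 2]], of c] by simp
        then show ?thesis unfolding eq c .
      next
        case 3
        then show ?thesis using eq \<beta>0 xB[OF negB[OF 3]] by simp
      qed
    qed
    ultimately show ?thesis unfolding J_def by blast
  qed
  have "lie_ideal J"
    unfolding lie_ideal_def
  proof (intro conjI allI ballI sub)
    fix z x assume x: "x \<in> J"
    have "bracket x z = (\<Sum>\<gamma>\<in>\<Gamma>. bracket x (pr \<gamma> z))"
      by (simp only: bracket_sum_right[symmetric] pr_sum)
    also have "\<dots> \<in> J" by (rule complex_vector.subspace_sum[OF sub]) (rule br[OF x _ pr_mem])
    finally show "bracket z x \<in> J"
      using complex_vector.subspace_neg[OF sub] bracket_skew[of z x] by simp
  qed
  then consider "J = {0}" | "J = UNIV" using ideal_trivial by blast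
  then show False
  \<comment> \<open>A root vector for a member of \<open>A\<close> lies in \<open>J\<close>, and one
    for a member of \<open>B\<close> does not, so \<open>J\<close> is neither zero nor
    everything.\<close>
  proof cases
    case 1
    obtain \<alpha> where a: "\<alpha> \<in> A" using A by blast
    obtain e where e: "e \<in> V \<alpha>" "e \<noteq> 0" using root_vector_exists[OF AR[OF a]] by blast
    have pe: "pr \<gamma> e = (if \<gamma> = \<alpha> then e else 0)" for \<gamma> by (rule pr_V[OF e(1) root_dual[OF AR[OF a]]])
    have "pr \<gamma> e = 0" if "\<gamma> \<in> B" for \<gamma> using pe[of \<gamma>] disj a that by auto
    moreover have "\<beta> (pr 0 e) = 0" if "\<beta> \<in> B" for \<beta>
      using pe[of 0] root_nonzero[OF AR[OF a]] dual_zero[OF root_dual[OF BR[OF that]]] by simp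
    ultimately have "e \<in> J" unfolding J_def by blast
    then show ?thesis using 1 e(2) by blast
  next
    case 2
    obtain \<beta> where b: "\<beta> \<in> B" using B by blast
    obtain e where e: "e \<in> V \<beta>" "e \<noteq> 0" using root_vector_exists[OF BR[OF b]] by blast
    have "pr \<beta> e = e" using pr_V[OF e(1) root_dual[OF BR[OF b]], of \<beta>] by simp
    moreover have "pr \<beta> e = 0" using 2 b unfolding J_def by blast
    ultimately show ?thesis using e(2) by simp
  qed
qed

sublocale irreducible_positive_roots \<Delta> ip \<Delta>p
  by unfold_locales (rule irreducible_roots_simple)

section \<open>Agreement of the Lie theoretic notions with the abstract ones\<close>

lemma simple_roots_eq: "simple_roots t u = simple"
  unfolding simple_roots_def simple_def ..

lemma root_coeffs_eq: "root_coeffs t u \<gamma> = coef \<gamma>"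
proof -
  have "(\<lambda>h. \<Sum>\<alpha>\<in>simple. of_int (c \<alpha>) * \<alpha> h) = (\<Sum>\<alpha>\<in>simple. of_int (c \<alpha>) * \<alpha>)" for c
    by (rule ext) (simp add: sum_fun_apply of_int_fun)
  then show ?thesis unfolding root_coeffs_def coef_def simple_roots_eq by simp
qed

lemma highest_root_eq: "highest_root t u \<Phi> = highest \<Phi>"
proof -
  have fin: "finite (\<Phi> \<inter> \<Delta>p)" using finite_P by blast
  have nat: "(of_nat n :: 'g \<Rightarrow> complex) h = of_nat n" for n h using of_int_fun[of "int n" h] by simp
  have "(\<lambda>h. \<Sum>\<delta>\<in>\<Phi> \<inter> \<Delta>p. of_nat (c \<delta>) * \<delta> h) = (\<Sum>\<delta>\<in>\<Phi> \<inter> \<Delta>p. of_nat (c \<delta>) * \<delta>)" for c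
    by (rule ext) (simp add: sum_fun_apply nat)
  then show ?thesis unfolding highest_root_def highest_def cone_iff_coeffs[OF fin] by simp
qed

text \<open>Components and descendants depend only on which roots are orthogonal, so comparing zeros
  is enough for the cascade.\<close>

lemma root_form_zero_iff: "\<gamma> \<in> \<Delta> \<Longrightarrow> \<delta> \<in> \<Delta> \<Longrightarrow> root_form t \<gamma> \<delta> = 0 \<longleftrightarrow> ip \<gamma> \<delta> = 0"
  by (simp add: root_form_eq ip_roots)

lemma irreducible_roots_eq:
  assumes "\<Phi> \<subseteq> \<Delta>" shows "irreducible_roots t \<Phi> \<longleftrightarrow> irreducible \<Phi>"
proof -
  have "(\<Phi> = A \<union> B \<and> (\<forall>\<gamma>\<in>A. \<forall>\<delta>\<in>B. root_form t \<gamma> \<delta> = 0)) \<longleftrightarrow>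
      (\<Phi> = A \<union> B \<and> (\<forall>\<gamma>\<in>A. \<forall>\<delta>\<in>B. ip \<gamma> \<delta> = 0))" for A B
    using assms root_form_zero_iff by (intro conj_cong refl ball_cong) auto
  then show ?thesis unfolding irreducible_roots_def irreducible_def by simp
qed

lemma irreducible_component_eq:
  assumes "\<Psi> \<subseteq> \<Delta>" shows "irreducible_component t \<Psi> C \<longleftrightarrow> component \<Psi> C"
proof (cases "C \<subseteq> \<Psi>")
  case True
  then have "(\<forall>\<gamma>\<in>C. \<forall>\<delta>\<in>\<Psi> - C. root_form t \<gamma> \<delta> = 0) \<longleftrightarrow> (\<forall>\<gamma>\<in>C. \<forall>\<delta>\<in>\<Psi> - C. ip \<gamma> \<delta> = 0)"
    using root_form_zero_iff[OF subsetD[OF assms] subsetD[OF assms]] by (intro ball_cong refl) blast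
  then show ?thesis
    unfolding irreducible_component_def component_def using irreducible_roots_eq[of C] True assms by auto
qed (auto simp: irreducible_component_def component_def)

lemma perp_eq:
  assumes "\<Phi> \<in> cascade" shows "{\<gamma> \<in> \<Phi>. root_form t \<gamma> (highest_root t u \<Phi>) = 0} = perp \<Phi>"
  unfolding perp_def highest_root_eq
  using cascade_subset[OF assms] cascade_highest(1)[OF assms assms] root_form_zero_iff[of _ "highest \<Phi>"] by blast

lemma perp_subset: "\<Phi> \<in> cascade \<Longrightarrow> perp \<Phi> \<subseteq> \<Delta>"
  using cascade_subset unfolding perp_def by blast

lemma cascade_systems_eq: "cascade_systems t u = cascade"
proof
  show "cascade_systems t u \<subseteq> cascade"
  proof
    fix \<Phi> assume "\<Phi> \<in> cascade_systems t u"
    then show "\<Phi> \<in> cascade"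
    proof induction
      case top then show ?case by (rule cascade.top)
    next
      case (descendant \<Phi> C)
      then have "component (perp \<Phi>) C" using perp_eq irreducible_component_eq[OF perp_subset] by simp
      then show ?case using cascade.descendant descendant by blast
    qed
  qed
  show "cascade \<subseteq> cascade_systems t u"
  proof
    fix \<Phi> assume "\<Phi> \<in> cascade"
    then show "\<Phi> \<in> cascade_systems t u"
    proof induction
      case top then show ?case by (rule cascade_systems.top)
    next
      case (descendant \<Phi> C)
      then have "irreducible_component t {\<gamma> \<in> \<Phi>. root_form t \<gamma> (highest_root t u \<Phi>) = 0} C"
        using perp_eq irreducible_component_eq[OF perp_subset] by simp
      then show ?case using cascade_systems.descendant descendant by blast
    qed
  qed
qed

lemma kostant_cascade_eq: "kostant_cascade t u = kcascade"
  unfolding kostant_cascade_def kcascade_def cascade_systems_eq using highest_root_eq by simp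

end

section \<open>Stabilisers and nilradicals\<close>

lemma centre_subspace: "csubspace q \<Longrightarrow> csubspace (centre q)"
  unfolding complex_vector.subspace_def centre_def by (auto simp: bracket_add_left bracket_scaleC_left)

lemma linear_dual_add_apply: "\<xi> \<in> linear_dual q \<Longrightarrow> x \<in> q \<Longrightarrow> y \<in> q \<Longrightarrow> \<xi> (x + y) = \<xi> x + \<xi> y"
  and linear_dual_scale_apply: "\<xi> \<in> linear_dual q \<Longrightarrow> x \<in> q \<Longrightarrow> \<xi> (scaleC c x) = c * \<xi> x"
  unfolding linear_dual_def by auto

lemma linear_dual_sum_apply:
  assumes \<xi>: "\<xi> \<in> linear_dual q" and q: "csubspace q" and "\<And>i. i \<in> I \<Longrightarrow> f i \<in> q"
  shows "\<xi> (sum f I) = (\<Sum>i\<in>I. \<xi> (f i))"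
proof -
  have z: "0 \<in> q" using q by (rule complex_vector.subspace_0)
  have 0: "\<xi> 0 = 0" using linear_dual_scale_apply[OF \<xi> z, of 0] by simp
  show ?thesis
    using assms(3)
  proof (induction I rule: infinite_finite_induct)
    case (insert i I)
    have "sum f I \<in> q" using insert.prems by (intro complex_vector.subspace_sum[OF q]) auto
    then have "\<xi> (f i + sum f I) = \<xi> (f i) + \<xi> (sum f I)" using insert.prems by (intro linear_dual_add_apply[OF \<xi>]) auto
    then show ?case using insert by simp
  qed (simp_all add: 0)
qed

lemma linear_dual_diff_apply:
  assumes \<xi>: "\<xi> \<in> linear_dual q" and q: "csubspace q" and "x \<in> q" "y \<in> q"
  shows "\<xi> (x - y) = \<xi> x - \<xi> y"
  using linear_dual_add_apply[OF \<xi> complex_vector.subspace_diff[OF q assms(3,4)] assms(4)] by simp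

lemma coadjoint_stabiliser_iff:
  "x \<in> coadjoint_stabiliser q \<xi> \<longleftrightarrow> x \<in> q \<and> (\<forall>y\<in>q. \<xi> (bracket x y) = 0)"
  unfolding coadjoint_stabiliser_def coadjoint_def by (auto simp: fun_eq_iff)

lemma centre_subset_stabiliser:
  assumes "csubspace q" "\<xi> \<in> linear_dual q" shows "centre q \<subseteq> coadjoint_stabiliser q \<xi>"
proof
  fix x assume x: "x \<in> centre q"
  have z: "0 \<in> q" using assms(1) by (rule complex_vector.subspace_0)
  have "\<xi> 0 = 0" using linear_dual_scale_apply[OF assms(2) z, of 0] by simp
  then show "x \<in> coadjoint_stabiliser q \<xi>" using x unfolding coadjoint_stabiliser_iff centre_def by simp
qed

lemma subspace_cdim:
  fixes S S' :: "'a::complex_lie_algebra set"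
  assumes fin: "finite (cextend_basis {} :: 'a set)" and S: "csubspace S" and sub: "S \<subseteq> S'"
  shows subspace_cdim_le: "cdim S \<le> cdim S'" and subspace_cdim_eq: "cdim S = cdim S' \<Longrightarrow> S = S'"
proof -
  obtain B where B: "B \<subseteq> S" "complex_vector.independent B" "S \<subseteq> cspan B" "card B = cdim S"
    using complex_vector.basis_exists by blast
  obtain B' where B': "B' \<subseteq> S'" "complex_vector.independent B'" "S' \<subseteq> cspan B'" "card B' = cdim S'"
    using complex_vector.basis_exists by blast
  have finB: "finite A" if "complex_vector.independent A" for A :: "'a set"
    using complex_vector.independent_span_bound[OF fin that]
    by (simp add: complex_vector.span_extend_basis complex_vector.independent_empty)
  have le: "card A \<le> card B'" if "complex_vector.independent A" "A \<subseteq> S'" for A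
  proof -
    have "A \<subseteq> cspan B'" using that(2) B'(3) by (rule order_trans)
    then show ?thesis using complex_vector.independent_span_bound[OF finB[OF B'(2)] that(1)] by blast
  qed
  have BS': "B \<subseteq> S'" using B(1) sub by (rule order_trans)
  show "cdim S \<le> cdim S'" using le[OF B(2) BS'] B(4) B'(4) by simp
  assume eq: "cdim S = cdim S'"
  have spanB: "cspan B \<subseteq> S" using B(1) S by (rule complex_vector.span_minimal)
  have "x \<in> S" if x: "x \<in> S'" for x
  proof (rule ccontr)
    assume "x \<notin> S"
    then have nx: "x \<notin> cspan B" "x \<notin> B" using spanB B(1) by auto
    have "complex_vector.independent (insert x B)"
      using complex_vector.independent_insertI[OF nx(1) B(2)] .
    moreover have "insert x B \<subseteq> S'" using x BS' by simp
    ultimately have "card (insert x B) \<le> card B'" by (rule le)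
    then show False using finB[OF B(2)] nx(2) B(4) B'(4) eq by simp
  qed
  then show "S = S'" using sub by blast
qed

text \<open>The centre lies in every stabiliser, so its dimension bounds the index from below, and a
  stabiliser of that dimension coincides with the centre.\<close>

lemma square_integrable_iff:
  fixes q :: "'a::complex_lie_algebra set"
  assumes fin: "finite (cextend_basis {} :: 'a set)" and q: "lie_subalgebra q"
  shows "square_integrable q \<longleftrightarrow> (\<exists>\<xi>\<in>linear_dual q. coadjoint_stabiliser q \<xi> = centre q)"
proof -
  have sq: "csubspace q" using q unfolding lie_subalgebra_def by blast
  let ?P = "\<lambda>k. \<exists>\<xi>\<in>linear_dual q. k = cdim (coadjoint_stabiliser q \<xi>)"
  have "?P (cdim (coadjoint_stabiliser q 0))" using linear_dual_zero by blast
  then have attained: "?P (lie_index q)" unfolding lie_index_def by (rule LeastI)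
  have ge: "cdim (centre q) \<le> cdim (coadjoint_stabiliser q \<xi>)" if "\<xi> \<in> linear_dual q" for \<xi>
    by (rule subspace_cdim_le[OF fin centre_subspace[OF sq] centre_subset_stabiliser[OF sq that]])
  show ?thesis
  proof
    assume "square_integrable q"
    then obtain \<xi> where \<xi>: "\<xi> \<in> linear_dual q" "cdim (centre q) = cdim (coadjoint_stabiliser q \<xi>)"
      using attained unfolding square_integrable_def by auto
    have "centre q = coadjoint_stabiliser q \<xi>"
      by (rule subspace_cdim_eq[OF fin centre_subspace[OF sq] centre_subset_stabiliser[OF sq \<xi>(1)] \<xi>(2)])
    then show "\<exists>\<xi>\<in>linear_dual q. coadjoint_stabiliser q \<xi> = centre q" using \<xi>(1) by blast
  next
    assume "\<exists>\<xi>\<in>linear_dual q. coadjoint_stabiliser q \<xi> = centre q"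
    then obtain \<xi> where \<xi>: "\<xi> \<in> linear_dual q" "coadjoint_stabiliser q \<xi> = centre q" by blast
    have "?P (cdim (centre q))" using \<xi> by (intro bexI[of _ \<xi>]) auto
    then have "lie_index q \<le> cdim (centre q)" unfolding lie_index_def by (rule Least_le)
    moreover have "cdim (centre q) \<le> lie_index q" using attained ge by auto
    ultimately show "square_integrable q" unfolding square_integrable_def by simp
  qed
qed

text \<open>The coefficients of the formal solution of \<open>dx/ds = [z(s), x(s)]\<close> with \<open>z(s) = \<Sum>z\<^sub>k s\<^sup>k\<close>.\<close>

fun formal_flow :: "(nat \<Rightarrow> 'a::complex_lie_algebra) \<Rightarrow> 'a \<Rightarrow> nat \<Rightarrow> 'a" where
  "formal_flow z a 0 = a"
| "formal_flow z a (Suc k) =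
    scaleC (inverse (of_nat (Suc k))) (\<Sum>i<Suc k. bracket (z i) (formal_flow z a (k - i)))"

text \<open>The recursion with its denominator cleared; at k = 0 both sides are zero, which lets the
  index k - 1 - i be used uniformly.\<close>

lemma formal_flow_sum:
  "(\<Sum>i<k. bracket (z i) (formal_flow z a (k - 1 - i))) = scaleC (of_nat k) (formal_flow z a k)"
proof (cases k)
  case (Suc j)
  have "complex_of_nat (Suc j) * inverse (of_nat (Suc j)) = 1" by (simp del: of_nat_Suc)
  then show ?thesis unfolding Suc formal_flow.simps scaleC_scaleC by (simp only: scaleC_one diff_Suc_1)
qed simp

text \<open>If \<open>z(s)\<close> carries \<open>\<xi>\<close> along the line \<open>\<xi> + s \<eta>\<close>, then a vector of the stabiliser of \<open>\<xi>\<close> extends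
  to a formal vector in the stabiliser of \<open>\<xi> + s \<eta>\<close>.\<close>

lemma formal_flow_stabilises:
  fixes n :: "'a::complex_lie_algebra set"
  assumes n: "csubspace n" and n_br: "\<And>x y. x \<in> n \<Longrightarrow> y \<in> n \<Longrightarrow> bracket x y \<in> n"
    and \<xi>: "\<xi> \<in> linear_dual n" and \<eta>: "\<eta> \<in> linear_dual n"
    and z_n: "\<And>k y. y \<in> n \<Longrightarrow> bracket (z k) y \<in> n"
    and z0: "\<And>w. w \<in> n \<Longrightarrow> \<xi> (bracket (z 0) w) = - \<eta> w"
    and zS: "\<And>k w. w \<in> n \<Longrightarrow> \<xi> (bracket (z (Suc k)) w) = - \<eta> (bracket (z k) w)"
    and a: "a \<in> n" and a0: "\<And>y. y \<in> n \<Longrightarrow> \<xi> (bracket a y) = 0"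
  defines "x \<equiv> formal_flow z a"
  shows "x k \<in> n \<and> (\<forall>y\<in>n. \<xi> (bracket (x (Suc k)) y) = - \<eta> (bracket (x k) y))"
proof -
  have xn: "x k \<in> n" for k
  proof (induction k rule: less_induct)
    case (less k)
    show ?case
    proof (cases k)
      case 0
      then show ?thesis using a unfolding x_def by simp
    next
      case (Suc j)
      then show ?thesis using less unfolding x_def
        by (auto simp del: sum.lessThan_Suc
            intro!: complex_vector.subspace_scale[OF n] complex_vector.subspace_sum[OF n] z_n)
    qed
  qed
  have "\<forall>y\<in>n. \<xi> (bracket (x (Suc k)) y) = - \<eta> (bracket (x k) y)" for k
  proof (induction k rule: less_induct)
    case (less k)
    \<comment> \<open>The right-hand side of the equation for \<open>x j\<close> is the \<eta>-term
      of the preceding coefficient, taken to be 0 at j = 0 where \<open>a\<close> stabilises \<xi>.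
      This treats all j up to k alike.\<close>
    define pre where "pre j y = (case j of 0 \<Rightarrow> 0 | Suc i \<Rightarrow> \<eta> (bracket (x i) y))" for j y
    have pre: "\<xi> (bracket (x j) y) = - pre j y" if "j \<le> k" "y \<in> n" for j y
    proof (cases j)
      case 0
      then show ?thesis using a0[OF that(2)] unfolding pre_def x_def by simp
    next
      case (Suc i)
      then show ?thesis using less[of i] that unfolding pre_def by simp
    qed
    show ?case
    proof
      fix y assume y: "y \<in> n"
      have b: "bracket (x i) y \<in> n" "bracket (z i) y \<in> n" for i using n_br[OF xn y] z_n[OF y] by auto
      \<comment> \<open>The summand i = 0 uses the equation for \<open>z 0\<close> and produces the
        wanted - \<eta> [x_k, y]; the other summands pass from \<xi> to \<eta> with the index of z
        lowered by one.\<close>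
      have term1: "(\<Sum>i<Suc k. \<xi> (bracket (z i) (bracket (x (k - i)) y))) =
          - \<eta> (bracket (x k) y) - (\<Sum>i<k. \<eta> (bracket (z i) (bracket (x (k - 1 - i)) y)))"
        unfolding sum.lessThan_Suc_shift by (simp add: z0[OF b(1)] zS[OF b(1)] sum_negf)
      have "(\<Sum>i<Suc k. \<xi> (bracket (x (k - i)) (bracket (z i) y))) = - (\<Sum>i<Suc k. pre (k - i) (bracket (z i) y))"
        unfolding sum_negf[symmetric] by (rule sum.cong[OF refl]) (rule pre[OF diff_le_self b(2)])
      also have "(\<Sum>i<Suc k. pre (k - i) (bracket (z i) y)) = (\<Sum>i<k. \<eta> (bracket (x (k - 1 - i)) (bracket (z i) y)))"
      proof -
        have "pre (k - i) (bracket (z i) y) = \<eta> (bracket (x (k - 1 - i)) (bracket (z i) y))" if "i < k" for i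
        proof -
          have "k - i = Suc (k - 1 - i)" using that by simp
          then show ?thesis unfolding pre_def by simp
        qed
        moreover have "pre (k - k) (bracket (z k) y) = 0" unfolding pre_def by simp
        ultimately show ?thesis by (simp add: sum.lessThan_Suc)
      qed
      finally have term2: "(\<Sum>i<Suc k. \<xi> (bracket (x (k - i)) (bracket (z i) y))) =
          - (\<Sum>i<k. \<eta> (bracket (x (k - 1 - i)) (bracket (z i) y)))" .
      have split: "\<zeta> (bracket (bracket (z i) (x j)) y) =
          \<zeta> (bracket (z i) (bracket (x j) y)) - \<zeta> (bracket (x j) (bracket (z i) y))"
        if "\<zeta> \<in> linear_dual n" for \<zeta> i j
        unfolding bracket_bracket by (rule linear_dual_diff_apply[OF that n z_n[OF b(1)] n_br[OF xn b(2)]])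
      have brsum: "\<zeta> (bracket (\<Sum>i\<in>I. bracket (z i) (x (j i))) y) = (\<Sum>i\<in>I. \<zeta> (bracket (bracket (z i) (x (j i))) y))"
        if "\<zeta> \<in> linear_dual n" for \<zeta> j and I :: "nat set"
        unfolding bracket_sum_left by (rule linear_dual_sum_apply[OF that n]) (rule n_br[OF z_n[OF xn] y])
      have scale: "\<zeta> (bracket (scaleC c (x j)) y) = c * \<zeta> (bracket (x j) y)" if "\<zeta> \<in> linear_dual n" for \<zeta> c j
        unfolding bracket_scaleC_left by (rule linear_dual_scale_apply[OF that b(1)])
      have "of_nat (Suc k) * \<xi> (bracket (x (Suc k)) y) = \<xi> (bracket (scaleC (of_nat (Suc k)) (x (Suc k))) y)"
        by (rule scale[OF \<xi>, symmetric])
      also have "\<dots> = (\<Sum>i<Suc k. \<xi> (bracket (bracket (z i) (x (k - i))) y))"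
        using brsum[OF \<xi>, of "\<lambda>i. k - i" "{..<Suc k}"] formal_flow_sum[of z a "Suc k"]
        unfolding x_def by (simp only: diff_Suc_1)
      also have "\<dots> = (\<Sum>i<Suc k. \<xi> (bracket (z i) (bracket (x (k - i)) y))) -
          (\<Sum>i<Suc k. \<xi> (bracket (x (k - i)) (bracket (z i) y)))"
        unfolding split[OF \<xi>] sum_subtractf ..
      also have "\<dots> = - \<eta> (bracket (x k) y) - (\<Sum>i<k. \<eta> (bracket (bracket (z i) (x (k - 1 - i))) y))"
        unfolding term1 term2 split[OF \<eta>] sum_subtractf by simp
      \<comment> \<open>The remaining sum is the recursion for \<open>x k\<close> and contributes k
        times the same value; together with the single term this is the factor k + 1 on both
        sides.\<close>
      also have "(\<Sum>i<k. \<eta> (bracket (bracket (z i) (x (k - 1 - i))) y)) = of_nat k * \<eta> (bracket (x k) y)"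
        using brsum[OF \<eta>, of "\<lambda>i. k - 1 - i" "{..<k}"] formal_flow_sum[of z a k] scale[OF \<eta>, of "of_nat k" k]
        unfolding x_def by simp
      finally have "of_nat (Suc k) * \<xi> (bracket (x (Suc k)) y) = of_nat (Suc k) * - \<eta> (bracket (x k) y)"
        by (simp add: algebra_simps)
      then show "\<xi> (bracket (x (Suc k)) y) = - \<eta> (bracket (x k) y)"
        by (simp only: mult_cancel_left of_nat_eq_0_iff) simp
    qed
  qed
  then show ?thesis using xn by blast
qed

text \<open>Modulo the stabiliser of \<open>\<eta>\<close> the form of \<open>\<eta>\<close> is nondegenerate, so the sequence is an infinite
  Jordan chain unless its first term is central.\<close>

lemma jordan_chain_start:
  fixes n :: "'a::complex_lie_algebra set"
  assumes fin: "finite (cextend_basis {} :: 'a set)" and n: "csubspace n"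
    and n_br: "\<And>x y. x \<in> n \<Longrightarrow> y \<in> n \<Longrightarrow> bracket x y \<in> n"
    and \<xi>: "\<xi> \<in> linear_dual n" and \<eta>: "\<eta> \<in> linear_dual n" and stab: "coadjoint_stabiliser n \<eta> = centre n"
    and x_n: "\<And>k. x k \<in> n" and x0: "\<And>y. y \<in> n \<Longrightarrow> \<xi> (bracket (x 0) y) = 0"
    and xS: "\<And>k y. y \<in> n \<Longrightarrow> \<xi> (bracket (x (Suc k)) y) = - \<eta> (bracket (x k) y)"
  shows "x 0 \<in> centre n"
proof (rule ccontr)
  assume x0c: "x 0 \<notin> centre n"
  have cs: "csubspace (centre n)" by (rule centre_subspace[OF n])
  have xin0: "\<xi> 0 = 0"
    using linear_dual_scale_apply[OF \<xi> complex_vector.subspace_0[OF n], of 0] by simp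
  \<comment> \<open>Pairing a central combination with \<xi> removes the term of \<open>x 0\<close>
    and shifts the others down to \<eta>. The shifted combination lies in the stabiliser of \<eta>,
    which is the centre, and keeps the leading coefficient; after m shifts only a multiple of
    \<open>x 0\<close> is left.\<close>
  have coeff: "c m = 0" if "(\<Sum>k\<le>m. scaleC (c k) (x k)) \<in> centre n" for c :: "nat \<Rightarrow> complex" and m
    using that
  proof (induction m arbitrary: c)
    case 0
    then have in_c: "scaleC (c 0) (x 0) \<in> centre n" by simp
    show ?case
    proof (rule ccontr)
      assume "c 0 \<noteq> 0"
      then have "x 0 = scaleC (inverse (c 0)) (scaleC (c 0) (x 0))" by (simp add: scaleC_scaleC scaleC_one)
      then have "x 0 \<in> centre n" using complex_vector.subspace_scale[OF cs in_c] by metis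
      then show False using x0c by blast
    qed
  next
    case (Suc m)
    let ?w = "\<Sum>k\<le>m. scaleC (c (Suc k)) (x k)"
    have wn: "?w \<in> n" by (intro complex_vector.subspace_sum[OF n] complex_vector.subspace_scale[OF n] x_n)
    have "\<eta> (bracket ?w y) = 0" if y: "y \<in> n" for y
    proof -
      have ex: "\<zeta> (bracket (\<Sum>k\<in>I. scaleC (b k) (v k)) y) = (\<Sum>k\<in>I. b k * \<zeta> (bracket (v k) y))"
        if "\<zeta> \<in> linear_dual n" "\<And>k. v k \<in> n" for \<zeta> b v and I :: "nat set"
      proof -
        have "\<zeta> (bracket (\<Sum>k\<in>I. scaleC (b k) (v k)) y) = (\<Sum>k\<in>I. \<zeta> (scaleC (b k) (bracket (v k) y)))"
          unfolding bracket_sum_left bracket_scaleC_left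
          by (rule linear_dual_sum_apply[OF that(1) n]) (rule complex_vector.subspace_scale[OF n n_br[OF that(2) y]])
        also have "\<dots> = (\<Sum>k\<in>I. b k * \<zeta> (bracket (v k) y))"
          by (rule sum.cong[OF refl]) (rule linear_dual_scale_apply[OF that(1) n_br[OF that(2) y]])
        finally show ?thesis .
      qed
      have "bracket (\<Sum>k\<le>Suc m. scaleC (c k) (x k)) y = 0"
        using Suc.prems y unfolding centre_def by blast
      then have "0 = (\<Sum>k\<le>Suc m. c k * \<xi> (bracket (x k) y))"
        using ex[where v = x and b = c and I = "{..Suc m}", OF \<xi> x_n] xin0 by simp
      also have "\<dots> = - (\<Sum>k\<le>m. c (Suc k) * \<eta> (bracket (x k) y))"
        unfolding sum.atMost_Suc_shift by (simp add: x0[OF y] xS[OF y] sum_negf)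
      also have "\<dots> = - \<eta> (bracket ?w y)" using ex[where v = x and b = "\<lambda>k. c (Suc k)" and I = "{..m}", OF \<eta> x_n] by simp
      finally show ?thesis by simp
    qed
    then have "?w \<in> centre n" using wn stab coadjoint_stabiliser_iff by blast
    then show ?case by (rule Suc.IH)
  qed
  have indep: "complex_vector.independent (x ` {..<m}) \<and> inj_on x {..<m}" for m
  proof (induction m)
    case (Suc m)
    have notin: "x m \<notin> cspan (x ` {..<m})"
    proof
      assume "x m \<in> cspan (x ` {..<m})"
      then obtain c where "x m = (\<Sum>v\<in>x ` {..<m}. scaleC (c v) v)"
        by (auto simp: complex_vector.span_finite)
      then have eq: "x m = (\<Sum>k<m. scaleC (c (x k)) (x k))" using Suc by (simp add: sum.reindex)
      \<comment> \<open>The coefficient -1 at m turns membership in the span into a zero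
        combination, which is central although its leading coefficient is not zero.\<close>
      let ?b = "\<lambda>k. if k = m then - 1 else c (x k)"
      have "(\<Sum>k<m. scaleC (?b k) (x k)) = (\<Sum>k<m. scaleC (c (x k)) (x k))" by (rule sum.cong) auto
      then have "(\<Sum>k\<le>m. scaleC (?b k) (x k)) = x m + scaleC (- 1) (x m)"
        unfolding lessThan_Suc_atMost[symmetric] sum.lessThan_Suc using eq by simp
      also have "\<dots> = 0" by (simp add: complex_vector.scale_minus_left scaleC_one)
      finally have "(\<Sum>k\<le>m. scaleC (?b k) (x k)) \<in> centre n" using complex_vector.subspace_0[OF cs] by simp
      then have "?b m = 0" by (rule coeff)
      then show False by simp
    qed
    have "x m \<notin> x ` {..<m}" using notin complex_vector.span_base[of "x m" "x ` {..<m}"] by blast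
    then have "inj_on x {..<Suc m}" using Suc by (auto simp: lessThan_Suc)
    moreover have "complex_vector.independent (insert (x m) (x ` {..<m}))"
      using complex_vector.independent_insertI[OF notin] Suc by blast
    ultimately show ?case by (simp add: lessThan_Suc)
  qed (simp add: complex_vector.independent_empty)
  let ?B = "cextend_basis {} :: 'a set"
  have "card (x ` {..<Suc (card ?B)}) \<le> card ?B"
    using complex_vector.independent_span_bound[OF fin conjunct1[OF indep]]
    by (simp add: complex_vector.span_extend_basis complex_vector.independent_empty)
  then show False using card_image[OF conjunct2[OF indep]] by (metis card_lessThan Suc_n_not_le_n)
qed

section \<open>The nilradical and its normaliser\<close>

locale standard_nilradical = simple_triangular u t u' for u t u' :: "'g::complex_lie_algebra set" +
  fixes T :: "('g \<Rightarrow> complex) set"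
  assumes T_nonempty: "T \<noteq> {}" and T_simple: "T \<subseteq> simple"
begin

abbreviation "n \<equiv> nilradical t u T"
abbreviation "d \<equiv> deg T (highest \<Delta>)"

definition D :: "('g \<Rightarrow> complex) set" where
  "D = {\<gamma>\<in>\<Delta>p. deg T \<gamma> > 0}"

lemma D_pos: "\<gamma> \<in> D \<Longrightarrow> \<gamma> \<in> \<Delta>p" and D_deg: "\<gamma> \<in> D \<Longrightarrow> deg T \<gamma> > 0"
  and D_root: "\<gamma> \<in> D \<Longrightarrow> \<gamma> \<in> \<Delta>" and D_dual: "\<gamma> \<in> D \<Longrightarrow> \<gamma> \<in> linear_dual t"
  using positive_subset root_dual unfolding D_def by auto

lemma finite_D: "finite D"
  using finite_P unfolding D_def by simp

lemma D_sum: "\<gamma> \<in> D \<Longrightarrow> \<delta> \<in> \<Delta>p \<Longrightarrow> \<gamma> + \<delta> \<in> \<Delta> \<Longrightarrow> \<gamma> + \<delta> \<in> D"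
  using P_closed deg_add[OF T_simple] positive_lattice deg_cone_nonneg[OF T_simple cone_base, of \<delta>]
  unfolding D_def by fastforce

lemma pos_sum_nonzero: "\<gamma> \<in> \<Delta>p \<Longrightarrow> \<delta> \<in> \<Delta>p \<Longrightarrow> \<gamma> + \<delta> \<noteq> 0"
  using cone_add_root_nonzero[OF cone_base] by blast

lemma nilradical_eq: "n = cspan (\<Union>\<gamma>\<in>D. V \<gamma>)"
proof -
  have "{\<gamma> \<in> \<Delta>p. \<exists>\<alpha>\<in>T. root_coeffs t u \<gamma> \<alpha> > 0} = D"
    unfolding D_def root_coeffs_eq using deg_pos_iff[OF T_simple] by blast
  then show ?thesis unfolding nilradical_def by simp
qed

lemma n_subspace: "csubspace n"
  unfolding nilradical_eq by (rule complex_vector.subspace_span)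

lemma V_in_n: "\<gamma> \<in> D \<Longrightarrow> x \<in> V \<gamma> \<Longrightarrow> x \<in> n"
  unfolding nilradical_eq by (intro complex_vector.span_base UN_I)

lemma pr_n:
  assumes "x \<in> n" "\<gamma> \<notin> D" shows "pr \<gamma> x = 0"
proof -
  obtain f where f: "\<forall>\<delta>\<in>D. f \<delta> \<in> V \<delta>" "x = (\<Sum>\<delta>\<in>D. f \<delta>)"
    using span_Union_weight_spaces[OF _ finite_D] assms(1) unfolding nilradical_eq by blast
  have "pr \<gamma> x = (\<Sum>\<delta>\<in>D. pr \<gamma> (f \<delta>))" unfolding f(2) by (rule endo_sum[OF endo_pr])
  also have "\<dots> = 0"
  proof (intro sum.neutral ballI)
    fix \<delta> assume d: "\<delta> \<in> D"
    then have "pr \<gamma> (f \<delta>) = (if \<gamma> = \<delta> then f \<delta> else 0)" using f(1) by (intro pr_V D_dual) auto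
    then show "pr \<gamma> (f \<delta>) = 0" using d assms(2) by auto
  qed
  finally show ?thesis .
qed

lemma n_sum: assumes "x \<in> n" shows "x = (\<Sum>\<gamma>\<in>D. pr \<gamma> x)"
proof -
  have "(\<Sum>\<gamma>\<in>D. pr \<gamma> x) = (\<Sum>\<gamma>\<in>\<Gamma>. pr \<gamma> x)"
    using finite_\<Gamma> D_root pr_n[OF assms] by (intro sum.mono_neutral_left) auto
  then show ?thesis unfolding pr_sum by (rule sym)
qed

text \<open>It plays the part of the Borel subalgebra, whose weight spaces it contains by
  \<open>normaliser_V\<close>. Acting by \<open>n\<close> alone would not reach all functionals:
  elements of \<open>t\<close> and root vectors of degree 0 are needed.\<close>

definition normaliser :: "'g set" where
  "normaliser = {z. \<forall>y\<in>n. bracket z y \<in> n}"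

lemma normaliser_subspace: "csubspace normaliser"
  unfolding complex_vector.subspace_def normaliser_def
  using complex_vector.subspace_0[OF n_subspace] complex_vector.subspace_add[OF n_subspace]
    complex_vector.subspace_scale[OF n_subspace]
  by (auto simp: bracket_add_left bracket_scaleC_left)

lemma normaliser_V:
  assumes "\<gamma> = 0 \<or> \<gamma> \<in> \<Delta>p" "z \<in> V \<gamma>" shows "z \<in> normaliser"
  unfolding normaliser_def
proof (intro CollectI ballI)
  fix y assume "y \<in> n"
  have gd: "\<gamma> \<in> linear_dual t" using assms(1) linear_dual_zero root_dual positive_subset by blast
  have "bracket z (pr \<delta> y) \<in> n" if d: "\<delta> \<in> D" for \<delta>
  proof (cases "\<gamma> + \<delta> \<in> \<Gamma>")
    case True
    have "\<gamma> + \<delta> \<in> D"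
    proof (cases "\<gamma> = 0")
      case False
      then have g: "\<gamma> \<in> \<Delta>p" using assms(1) by blast
      then have "\<delta> + \<gamma> \<in> \<Delta>" using True pos_sum_nonzero[OF g D_pos[OF d]] by (simp add: add.commute)
      then have "\<delta> + \<gamma> \<in> D" by (rule D_sum[OF d g])
      then show ?thesis by (simp only: add.commute)
    qed (use d in simp)
    then show ?thesis by (rule V_in_n[OF _ root_space_bracket[OF assms(2) pr_mem]])
  next
    case False
    then have "bracket z (pr \<delta> y) = 0" by (rule bracket_trivial[OF assms(2) pr_mem _ gd D_dual[OF d]])
    then show ?thesis using complex_vector.subspace_0[OF n_subspace] by simp
  qed
  then have "(\<Sum>\<delta>\<in>D. bracket z (pr \<delta> y)) \<in> n" by (rule complex_vector.subspace_sum[OF n_subspace])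
  then show "bracket z y \<in> n" unfolding bracket_sum_right[symmetric] n_sum[OF \<open>y \<in> n\<close>, symmetric] .
qed

lemma n_subset_normaliser: "n \<subseteq> normaliser"
  using normaliser_V D_pos unfolding nilradical_eq
  by (intro complex_vector.span_minimal normaliser_subspace) blast

lemma n_bracket: "x \<in> n \<Longrightarrow> y \<in> n \<Longrightarrow> bracket x y \<in> n"
  using n_subset_normaliser unfolding normaliser_def by blast

lemma n_subalgebra: "lie_subalgebra n"
  unfolding lie_subalgebra_def using n_subspace n_bracket by blast

section \<open>Coordinates and the functional of the cascade\<close>

definition E :: "('g \<Rightarrow> complex) \<Rightarrow> 'g" where
  "E \<gamma> = (SOME e. e \<in> V \<gamma> \<and> e \<noteq> 0)"

lemma E: "\<gamma> \<in> \<Delta> \<Longrightarrow> E \<gamma> \<in> V \<gamma>" "\<gamma> \<in> \<Delta> \<Longrightarrow> E \<gamma> \<noteq> 0"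
proof -
  assume "\<gamma> \<in> \<Delta>"
  then have "\<exists>e. e \<in> V \<gamma> \<and> e \<noteq> 0" using root_vector_exists by blast
  then have "E \<gamma> \<in> V \<gamma> \<and> E \<gamma> \<noteq> 0" unfolding E_def by (rule someI_ex)
  then show "E \<gamma> \<in> V \<gamma>" "E \<gamma> \<noteq> 0" by auto
qed

definition coord :: "('g \<Rightarrow> complex) \<Rightarrow> 'g \<Rightarrow> complex" where
  "coord \<gamma> x = (THE c. pr \<gamma> x = scaleC c (E \<gamma>))"

lemma coord_eqI: "\<gamma> \<in> \<Delta> \<Longrightarrow> pr \<gamma> x = scaleC c (E \<gamma>) \<Longrightarrow> coord \<gamma> x = c"
  unfolding coord_def using E(2)[of \<gamma>] by (intro the_equality) auto

lemma pr_coord: "\<gamma> \<in> \<Delta> \<Longrightarrow> pr \<gamma> x = scaleC (coord \<gamma> x) (E \<gamma>)"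
  using root_space_line[OF _ E(1) E(2) pr_mem, of \<gamma> x] coord_eqI by metis

lemma coord_add: "\<gamma> \<in> \<Delta> \<Longrightarrow> coord \<gamma> (x + y) = coord \<gamma> x + coord \<gamma> y"
  by (intro coord_eqI) (simp_all add: endo_add[OF endo_pr] scaleC_add_left pr_coord[symmetric])

lemma coord_scale: "\<gamma> \<in> \<Delta> \<Longrightarrow> coord \<gamma> (scaleC c x) = c * coord \<gamma> x"
  by (intro coord_eqI) (simp_all add: endo_scale[OF endo_pr] pr_coord scaleC_scaleC)

lemma coord_V: "\<gamma> \<in> \<Delta> \<Longrightarrow> x \<in> V \<delta> \<Longrightarrow> \<delta> \<in> linear_dual t \<Longrightarrow> \<delta> \<noteq> \<gamma> \<Longrightarrow> coord \<gamma> x = 0"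
  by (rule coord_eqI) (simp_all add: pr_V)

lemma coord_nonzero: "\<gamma> \<in> \<Delta> \<Longrightarrow> x \<in> V \<gamma> \<Longrightarrow> x \<noteq> 0 \<Longrightarrow> coord \<gamma> x \<noteq> 0"
  using pr_coord[of \<gamma> x] pr_V[of x \<gamma> \<gamma>] root_dual[of \<gamma>] by auto

definition KT :: "('g \<Rightarrow> complex) set" where "KT = kcascade \<inter> D"

lemma finite_KT: "finite KT" and KT_root: "\<beta> \<in> KT \<Longrightarrow> \<beta> \<in> \<Delta>"
  using finite_D D_root unfolding KT_def by auto

definition \<xi>0 :: "'g \<Rightarrow> complex" where
  "\<xi>0 x = (if x \<in> n then \<Sum>\<beta>\<in>KT. coord \<beta> x else 0)"

lemma \<xi>0_dual: "\<xi>0 \<in> linear_dual n"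
  unfolding linear_dual_def \<xi>0_def
  using complex_vector.subspace_add[OF n_subspace] complex_vector.subspace_scale[OF n_subspace] KT_root
  by (auto simp: coord_add coord_scale sum.distrib sum_distrib_left)

lemma \<xi>0_V:
  assumes "\<gamma> \<in> D" "x \<in> V \<gamma>" shows "\<xi>0 x = (if \<gamma> \<in> kcascade then coord \<gamma> x else 0)"
proof -
  have "\<xi>0 x = (\<Sum>\<beta>\<in>KT. if \<beta> = \<gamma> then coord \<gamma> x else 0)"
    unfolding \<xi>0_def if_P[OF V_in_n[OF assms]]
    using coord_V[OF KT_root assms(2) D_dual[OF assms(1)]] by (intro sum.cong refl) auto
  then show ?thesis using finite_KT assms(1) unfolding KT_def by simp
qed

lemma \<xi>0_zero: "\<xi>0 0 = 0"
  using linear_dual_scale_apply[OF \<xi>0_dual complex_vector.subspace_0[OF n_subspace], of 0] by simp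

text \<open>The root \<mu> is only required to be positive, because the partner of a root of
  \<open>n\<close> may have degree 0.\<close>

lemma \<xi>0_bracket_zero:
  assumes "\<mu> \<in> \<Delta>p" "\<delta> \<in> D" "x \<in> V \<mu>" "y \<in> V \<delta>" "\<mu> + \<delta> \<notin> kcascade"
  shows "\<xi>0 (bracket x y) = 0"
proof (cases "\<mu> + \<delta> \<in> \<Delta>")
  case True
  then have "\<delta> + \<mu> \<in> D" using D_sum[OF assms(2,1)] by (simp add: add.commute)
  then have "\<mu> + \<delta> \<in> D" by (simp only: add.commute)
  then show ?thesis using \<xi>0_V[OF _ root_space_bracket[OF assms(3,4)]] assms(5) by simp
next
  case False
  then have "\<mu> + \<delta> \<notin> \<Gamma>" using pos_sum_nonzero[OF assms(1) D_pos[OF assms(2)]] by blast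
  then have "bracket x y = 0"
    using bracket_trivial[OF assms(3,4) _ root_dual D_dual[OF assms(2)]] assms(1) positive_subset by blast
  then show ?thesis using \<xi>0_zero by simp
qed

lemma \<xi>0_bracket_nonzero:
  assumes "\<mu> \<in> \<Delta>p" "\<delta> \<in> D" "x \<in> V \<mu>" "x \<noteq> 0" "y \<in> V \<delta>" "y \<noteq> 0" "\<mu> + \<delta> \<in> kcascade"
  shows "\<xi>0 (bracket x y) \<noteq> 0"
proof -
  have R: "\<mu> + \<delta> \<in> \<Delta>" "\<mu> \<in> \<Delta>" using assms(1,7) kcascade_subset positive_subset by auto
  then have "\<delta> + \<mu> \<in> D" using D_sum[OF assms(2,1)] by (simp add: add.commute)
  then have "\<mu> + \<delta> \<in> D" by (simp only: add.commute)
  then have "\<xi>0 (bracket x y) = coord (\<mu> + \<delta>) (bracket x y)"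
    using \<xi>0_V[OF _ root_space_bracket[OF assms(3,5)]] assms(7) by simp
  moreover have "bracket x y \<noteq> 0" by (rule bracket_nonzero[OF R(2) D_root[OF assms(2)] R(1) assms(3-6)])
  ultimately show ?thesis using coord_nonzero[OF R(1) root_space_bracket[OF assms(3,5)]] by simp
qed

lemma \<xi>0_expand:
  assumes z: "z \<in> normaliser" and w: "w \<in> n"
  shows "\<xi>0 (bracket z w) = (\<Sum>\<delta>\<in>D. coord \<delta> w * \<xi>0 (bracket z (E \<delta>)))"
proof -
  have zE: "bracket z (E \<delta>) \<in> n" if "\<delta> \<in> D" for \<delta>
    using z V_in_n[OF that E(1)[OF D_root[OF that]]] unfolding normaliser_def by blast
  have "w = (\<Sum>\<delta>\<in>D. scaleC (coord \<delta> w) (E \<delta>))"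
    by (rule trans[OF n_sum[OF w]]) (rule sum.cong[OF refl], rule pr_coord[OF D_root])
  then have "bracket z w = (\<Sum>\<delta>\<in>D. scaleC (coord \<delta> w) (bracket z (E \<delta>)))"
    using bracket_sum_right[of z "\<lambda>\<delta>. scaleC (coord \<delta> w) (E \<delta>)" D] by (simp add: bracket_scaleC_right)
  then have "\<xi>0 (bracket z w) = (\<Sum>\<delta>\<in>D. \<xi>0 (scaleC (coord \<delta> w) (bracket z (E \<delta>))))"
    using linear_dual_sum_apply[OF \<xi>0_dual n_subspace, of D "\<lambda>\<delta>. scaleC (coord \<delta> w) (bracket z (E \<delta>))"]
      complex_vector.subspace_scale[OF n_subspace zE] by simp
  also have "\<dots> = (\<Sum>\<delta>\<in>D. coord \<delta> w * \<xi>0 (bracket z (E \<delta>)))"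
    using linear_dual_scale_apply[OF \<xi>0_dual zE] by (intro sum.cong refl) auto
  finally show ?thesis .
qed

text \<open>For a cascade root the element \<open>tvec \<gamma>\<close> works: \<open>\<xi>0\<close>
  sees only cascade roots, and the others are orthogonal to \<gamma>. For any other root the root
  vector of \<beta> - \<gamma> works, with \<beta> a cascade root above \<gamma>: by uniqueness of
  partners it pairs with no other root of \<open>n\<close>. Rescaling makes the value exact.\<close>

lemma coordinate_functional:
  assumes g: "\<gamma> \<in> D"
  shows "\<exists>z\<in>normaliser. \<forall>w\<in>n. \<xi>0 (bracket z w) = coord \<gamma> w"
proof -
  have "\<exists>z\<in>normaliser. \<xi>0 (bracket z (E \<gamma>)) \<noteq> 0 \<and> (\<forall>\<delta>\<in>D. \<delta> \<noteq> \<gamma> \<longrightarrow> \<xi>0 (bracket z (E \<delta>)) = 0)"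
  proof (cases "\<gamma> \<in> kcascade")
    case True
    let ?h = "tvec \<gamma>"
    have h: "?h \<in> t" by (rule tvec_mem[OF D_root[OF g]])
    have act: "bracket ?h (E \<delta>) = scaleC (\<delta> ?h) (E \<delta>)" if "\<delta> \<in> D" for \<delta>
      by (rule root_space_act[OF E(1)[OF D_root[OF that]] h])
    have val: "\<xi>0 (bracket ?h (E \<delta>)) = \<delta> ?h * \<xi>0 (E \<delta>)" if "\<delta> \<in> D" for \<delta>
      unfolding act[OF that] by (rule linear_dual_scale_apply[OF \<xi>0_dual V_in_n[OF that E(1)[OF D_root[OF that]]]])
    have "\<xi>0 (E \<gamma>) \<noteq> 0"
      using \<xi>0_V[OF g E(1)[OF D_root[OF g]]] True coord_nonzero[OF D_root[OF g] E(1)[OF D_root[OF g]] E(2)[OF D_root[OF g]]]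
      by simp
    then have "\<xi>0 (bracket ?h (E \<gamma>)) \<noteq> 0" using val[OF g] root_tvec_nonzero[OF D_root[OF g]] by simp
    moreover have "\<xi>0 (bracket ?h (E \<delta>)) = 0" if d: "\<delta> \<in> D" "\<delta> \<noteq> \<gamma>" for \<delta>
    proof (cases "\<delta> \<in> kcascade")
      case dk: True
      have "ip \<delta> \<gamma> = 0" by (rule kcascade_orthogonal[OF dk True d(2)])
      then have "\<delta> ?h = 0" using ip_zero_iff[OF D_root[OF d(1)] D_root[OF g]] by simp
      then show ?thesis using val[OF d(1)] by simp
    next
      case False
      then have "\<xi>0 (E \<delta>) = 0" using \<xi>0_V[OF d(1) E(1)[OF D_root[OF d(1)]]] by simp
      then show ?thesis using val[OF d(1)] by simp
    qed
    moreover have "?h \<in> normaliser" using normaliser_V[of 0 ?h] h V0 by simp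
    ultimately show ?thesis by blast
  next
    case False
    then obtain \<beta> where b: "\<beta> \<in> kcascade" "\<beta> - \<gamma> \<in> \<Delta>p" using exists_kcascade_above[OF D_pos[OF g]] by blast
    let ?\<mu> = "\<beta> - \<gamma>"
    have mR: "?\<mu> \<in> \<Delta>" using b(2) positive_subset by blast
    have eq: "?\<mu> + \<gamma> = \<beta>" by simp
    have "\<xi>0 (bracket (E ?\<mu>) (E \<gamma>)) \<noteq> 0"
    proof (rule \<xi>0_bracket_nonzero[OF b(2) g E(1)[OF mR] E(2)[OF mR] E(1)[OF D_root[OF g]] E(2)[OF D_root[OF g]]])
      show "?\<mu> + \<gamma> \<in> kcascade" unfolding eq by (rule b(1))
    qed
    moreover have "\<xi>0 (bracket (E ?\<mu>) (E \<delta>)) = 0" if d: "\<delta> \<in> D" "\<delta> \<noteq> \<gamma>" for \<delta>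
    proof (rule \<xi>0_bracket_zero[OF b(2) d(1) E(1)[OF mR] E(1)[OF D_root[OF d(1)]]])
      show "?\<mu> + \<delta> \<notin> kcascade"
      proof
        assume "?\<mu> + \<delta> \<in> kcascade"
        moreover have "?\<mu> + \<gamma> \<in> kcascade" unfolding eq by (rule b(1))
        ultimately have "\<delta> = \<gamma>" by (rule kcascade_partner_unique[OF b(2) D_pos[OF d(1)] D_pos[OF g]])
        then show False using d(2) by blast
      qed
    qed
    moreover have "E ?\<mu> \<in> normaliser" using normaliser_V[of ?\<mu>, OF _ E(1)[OF mR]] b(2) by blast
    ultimately show ?thesis by blast
  qed
  then obtain z where z: "z \<in> normaliser" "\<xi>0 (bracket z (E \<gamma>)) \<noteq> 0"
    "\<And>\<delta>. \<delta> \<in> D \<Longrightarrow> \<delta> \<noteq> \<gamma> \<Longrightarrow> \<xi>0 (bracket z (E \<delta>)) = 0" by blast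
  define c where "c = \<xi>0 (bracket z (E \<gamma>))"
  have val: "\<xi>0 (bracket z w) = coord \<gamma> w * c" if w: "w \<in> n" for w
  proof -
    have "\<xi>0 (bracket z w) = (\<Sum>\<delta>\<in>D. if \<delta> = \<gamma> then coord \<gamma> w * c else 0)"
      unfolding \<xi>0_expand[OF z(1) w] c_def using z(3) by (intro sum.cong refl) auto
    then show ?thesis using finite_D g by simp
  qed
  let ?z = "scaleC (inverse c) z"
  have "?z \<in> normaliser" by (rule complex_vector.subspace_scale[OF normaliser_subspace z(1)])
  moreover have "\<xi>0 (bracket ?z w) = coord \<gamma> w" if w: "w \<in> n" for w
  proof -
    have "bracket z w \<in> n" using z(1) w unfolding normaliser_def by blast
    then have "\<xi>0 (bracket ?z w) = inverse c * \<xi>0 (bracket z w)"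
      unfolding bracket_scaleC_left by (rule linear_dual_scale_apply[OF \<xi>0_dual])
    then show ?thesis using val[OF w] z(2) unfolding c_def by simp
  qed
  ultimately show ?thesis by blast
qed

text \<open>The infinitesimal form of the fact that the Borel subgroup has an open orbit through \<open>\<xi>0\<close>.\<close>

lemma functional_realised:
  assumes add: "\<And>x y. x \<in> n \<Longrightarrow> y \<in> n \<Longrightarrow> \<zeta> (x + y) = \<zeta> x + \<zeta> y"
    and scale: "\<And>c x. x \<in> n \<Longrightarrow> \<zeta> (scaleC c x) = c * \<zeta> x"
  shows "\<exists>z\<in>normaliser. \<forall>w\<in>n. \<xi>0 (bracket z w) = \<zeta> w"
proof -
  have "\<forall>\<gamma>\<in>D. \<exists>z. z \<in> normaliser \<and> (\<forall>w\<in>n. \<xi>0 (bracket z w) = coord \<gamma> w)"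
    using coordinate_functional by blast
  then obtain Z where Z: "\<forall>\<gamma>\<in>D. Z \<gamma> \<in> normaliser \<and> (\<forall>w\<in>n. \<xi>0 (bracket (Z \<gamma>) w) = coord \<gamma> w)"
    by (rule bchoice[THEN exE])
  \<comment> \<open>Linearity of \<zeta> is assumed on \<open>n\<close> only; extension by 0 gives a
    member of \<open>linear_dual n\<close>.\<close>
  define \<zeta>' where "\<zeta>' x = (if x \<in> n then \<zeta> x else 0)" for x
  have \<zeta>': "\<zeta>' \<in> linear_dual n"
    unfolding linear_dual_def \<zeta>'_def
    using add scale complex_vector.subspace_add[OF n_subspace] complex_vector.subspace_scale[OF n_subspace]
    by auto
  have EN: "E \<gamma> \<in> n" if "\<gamma> \<in> D" for \<gamma> by (rule V_in_n[OF that E(1)[OF D_root[OF that]]])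
  let ?z = "\<Sum>\<gamma>\<in>D. scaleC (\<zeta> (E \<gamma>)) (Z \<gamma>)"
  have "?z \<in> normaliser"
    using Z by (intro complex_vector.subspace_sum[OF normaliser_subspace] complex_vector.subspace_scale[OF normaliser_subspace]) blast
  moreover have "\<xi>0 (bracket ?z w) = \<zeta> w" if w: "w \<in> n" for w
  proof -
    have ZN: "bracket (Z \<gamma>) w \<in> n" if "\<gamma> \<in> D" for \<gamma> using Z that w unfolding normaliser_def by blast
    have "\<xi>0 (bracket ?z w) = (\<Sum>\<gamma>\<in>D. \<xi>0 (scaleC (\<zeta> (E \<gamma>)) (bracket (Z \<gamma>) w)))"
      unfolding bracket_sum_left bracket_scaleC_left
      by (rule linear_dual_sum_apply[OF \<xi>0_dual n_subspace]) (rule complex_vector.subspace_scale[OF n_subspace ZN])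
    also have "\<dots> = (\<Sum>\<gamma>\<in>D. \<zeta>' (scaleC (coord \<gamma> w) (E \<gamma>)))"
    proof (rule sum.cong[OF refl])
      fix \<gamma> assume g: "\<gamma> \<in> D"
      have "\<xi>0 (scaleC (\<zeta> (E \<gamma>)) (bracket (Z \<gamma>) w)) = \<zeta> (E \<gamma>) * coord \<gamma> w"
        using linear_dual_scale_apply[OF \<xi>0_dual ZN[OF g]] Z g w by auto
      also have "\<dots> = \<zeta>' (scaleC (coord \<gamma> w) (E \<gamma>))"
        using linear_dual_scale_apply[OF \<zeta>' EN[OF g]] EN[OF g] unfolding \<zeta>'_def by simp
      finally show "\<xi>0 (scaleC (\<zeta> (E \<gamma>)) (bracket (Z \<gamma>) w)) = \<zeta>' (scaleC (coord \<gamma> w) (E \<gamma>))" .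
    qed
    also have "\<dots> = \<zeta>' (\<Sum>\<gamma>\<in>D. scaleC (coord \<gamma> w) (E \<gamma>))"
      by (rule linear_dual_sum_apply[OF \<zeta>' n_subspace, symmetric]) (rule complex_vector.subspace_scale[OF n_subspace EN])
    also have "(\<Sum>\<gamma>\<in>D. scaleC (coord \<gamma> w) (E \<gamma>)) = w"
      by (rule trans[OF _ n_sum[OF w, symmetric]]) (rule sum.cong[OF refl], rule pr_coord[OF D_root, symmetric])
    finally show ?thesis unfolding \<zeta>'_def using w by simp
  qed
  ultimately show ?thesis by blast
qed

text \<open>The coefficients \<open>z k\<close> are chosen so that z(s) carries
  \<open>\<xi>0\<close> + s\<eta> by the coadjoint action to \<eta>, the direction of the line.
  Comparing powers of s, each coefficient solves a realisation problem for \<open>\<xi>0\<close>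
  whose right-hand side involves only the preceding one.\<close>

lemma stabiliser_central:
  assumes \<eta>: "\<eta> \<in> linear_dual n" "coadjoint_stabiliser n \<eta> = centre n"
    and a: "a \<in> n" "\<And>y. y \<in> n \<Longrightarrow> \<xi>0 (bracket a y) = 0"
  shows "a \<in> centre n"
proof -
  define Z where "Z \<zeta> = (SOME z. z \<in> normaliser \<and> (\<forall>w\<in>n. \<xi>0 (bracket z w) = \<zeta> w))" for \<zeta>
  have Z: "Z \<zeta> \<in> normaliser \<and> (\<forall>w\<in>n. \<xi>0 (bracket (Z \<zeta>) w) = \<zeta> w)"
    if "\<And>x y. x \<in> n \<Longrightarrow> y \<in> n \<Longrightarrow> \<zeta> (x + y) = \<zeta> x + \<zeta> y" "\<And>c x. x \<in> n \<Longrightarrow> \<zeta> (scaleC c x) = c * \<zeta> x" for \<zeta>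
    unfolding Z_def by (rule someI_ex) (use functional_realised[OF that] in blast)
  define z where "z = rec_nat (Z (\<lambda>w. - \<eta> w)) (\<lambda>_ v. Z (\<lambda>w. - \<eta> (bracket v w)))"
  have zz: "z 0 = Z (\<lambda>w. - \<eta> w)" "z (Suc k) = Z (\<lambda>w. - \<eta> (bracket (z k) w))" for k unfolding z_def by simp_all
  have Z0: "z 0 \<in> normaliser \<and> (\<forall>w\<in>n. \<xi>0 (bracket (z 0) w) = - \<eta> w)"
    unfolding zz(1) by (rule Z) (simp_all add: linear_dual_add_apply[OF \<eta>(1)] linear_dual_scale_apply[OF \<eta>(1)])
  have ZS: "z (Suc k) \<in> normaliser \<and> (\<forall>w\<in>n. \<xi>0 (bracket (z (Suc k)) w) = - \<eta> (bracket (z k) w))"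
    if "z k \<in> normaliser" for k
  proof -
    have zn: "bracket (z k) w \<in> n" if "w \<in> n" for w using \<open>z k \<in> normaliser\<close> that unfolding normaliser_def by blast
    show ?thesis
      unfolding zz(2)
      by (rule Z) (simp_all add: zn bracket_add_right bracket_scaleC_right linear_dual_add_apply[OF \<eta>(1)]
          linear_dual_scale_apply[OF \<eta>(1)])
  qed
  have zN: "z k \<in> normaliser" for k by (induction k) (use Z0 ZS in blast)+
  have flow: "formal_flow z a k \<in> n \<and>
      (\<forall>y\<in>n. \<xi>0 (bracket (formal_flow z a (Suc k)) y) = - \<eta> (bracket (formal_flow z a k) y))" for k
  proof (rule formal_flow_stabilises[OF n_subspace n_bracket \<xi>0_dual \<eta>(1) _ _ _ a])
    show "bracket (z k) y \<in> n" if "y \<in> n" for k y using zN that unfolding normaliser_def by blast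
    show "\<xi>0 (bracket (z 0) w) = - \<eta> w" if "w \<in> n" for w using Z0 that by blast
    show "\<xi>0 (bracket (z (Suc k)) w) = - \<eta> (bracket (z k) w)" if "w \<in> n" for k w using ZS[OF zN] that by blast
  qed
  have "formal_flow z a 0 \<in> centre n"
  proof (rule jordan_chain_start[OF finite_basis n_subspace n_bracket \<xi>0_dual \<eta>])
    show "formal_flow z a k \<in> n" for k using flow by blast
    show "\<xi>0 (bracket (formal_flow z a 0) y) = 0" if "y \<in> n" for y unfolding formal_flow.simps(1) by (rule a(2)[OF that])
    show "\<xi>0 (bracket (formal_flow z a (Suc k)) y) = - \<eta> (bracket (formal_flow z a k) y)" if "y \<in> n" for k y
      using flow that by blast
  qed
  then show ?thesis by simp
qed

section \<open>The centre and its roots\<close>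

lemma d_pos: "d > 0"
proof -
  obtain \<alpha> where a: "\<alpha> \<in> T" using T_nonempty by blast
  then have s: "\<alpha> \<in> simple" using T_simple by blast
  then have "\<alpha> \<in> \<Delta>" using simple_subset P_subset by blast
  then have "deg T \<alpha> \<le> d" by (rule deg_le_highest[OF T_simple])
  then show ?thesis using deg_simple[OF T_simple s] a by simp
qed

text \<open>A root of lower degree can be raised by some \<delta> in \<open>D\<close>, and
  bracketing with \<open>E \<delta>\<close> detects the component of x because brackets onto roots
  do not vanish. Conversely, adding a root of positive degree to one of top degree exceeds the
  degree of the highest root.\<close>

lemma centre_iff:
  assumes x: "x \<in> n"
  shows "x \<in> centre n \<longleftrightarrow> (\<forall>\<gamma>\<in>D. deg T \<gamma> < d \<longrightarrow> pr \<gamma> x = 0)"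
proof
  assume c: "x \<in> centre n"
  show "\<forall>\<gamma>\<in>D. deg T \<gamma> < d \<longrightarrow> pr \<gamma> x = 0"
  proof (intro ballI impI)
    fix \<gamma> assume g: "\<gamma> \<in> D" "deg T \<gamma> < d"
    obtain \<delta> where d: "\<delta> \<in> \<Delta>p" "deg T \<delta> > 0" "\<gamma> + \<delta> \<in> \<Delta>"
      using extend_to_top_degree[OF T_simple D_pos[OF g(1)] D_deg[OF g(1)] g(2)] by blast
    have dD: "\<delta> \<in> D" using d unfolding D_def by blast
    note dR = D_root[OF dD]
    have "bracket x (E \<delta>) = 0" using c V_in_n[OF dD E(1)[OF dR]] unfolding centre_def by blast
    then have "pr (\<gamma> + \<delta>) (bracket x (E \<delta>)) = 0" using endo_zero[OF endo_pr] by simp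
    then have "bracket (pr \<gamma> x) (E \<delta>) = 0"
      using pr_bracket[OF E(1)[OF dR] root_dual[OF dR] root_dual[OF d(3)], of x] by simp
    then show "pr \<gamma> x = 0"
      using bracket_nonzero[OF D_root[OF g(1)] dR d(3) pr_mem _ E(1)[OF dR] E(2)[OF dR]] by blast
  qed
next
  assume low: "\<forall>\<gamma>\<in>D. deg T \<gamma> < d \<longrightarrow> pr \<gamma> x = 0"
  have "bracket x y = 0" if y: "y \<in> n" for y
  proof -
    have "bracket (pr \<gamma> x) (pr \<delta> y) = 0" if g: "\<gamma> \<in> D" and d: "\<delta> \<in> D" for \<gamma> \<delta>
    proof (cases "deg T \<gamma> < d")
      case True
      then show ?thesis using low g by simp
    next
      case False
      have "deg T (\<gamma> + \<delta>) > d"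
        using deg_add[OF T_simple positive_lattice[OF D_pos[OF g]] positive_lattice[OF D_pos[OF d]]] False D_deg[OF d] by simp
      then have "\<gamma> + \<delta> \<notin> \<Delta>" using deg_le_highest[OF T_simple, of "\<gamma> + \<delta>"] by auto
      then have "\<gamma> + \<delta> \<notin> \<Gamma>" using pos_sum_nonzero[OF D_pos[OF g] D_pos[OF d]] by blast
      then show ?thesis by (rule bracket_trivial[OF pr_mem pr_mem _ D_dual[OF g] D_dual[OF d]])
    qed
    then have "(\<Sum>\<gamma>\<in>D. \<Sum>\<delta>\<in>D. bracket (pr \<gamma> x) (pr \<delta> y)) = 0" by (intro sum.neutral ballI)
    moreover have "(\<Sum>\<gamma>\<in>D. \<Sum>\<delta>\<in>D. bracket (pr \<gamma> x) (pr \<delta> y)) = bracket x y"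
      unfolding bracket_sum_right[symmetric] bracket_sum_left[symmetric] n_sum[OF x, symmetric] n_sum[OF y, symmetric] ..
    ultimately show ?thesis by simp
  qed
  then show "x \<in> centre n" using x unfolding centre_def by blast
qed

lemma nilradical_depth_eq: "nilradical_depth t u T = d"
  unfolding nilradical_depth_def root_coeffs_eq highest_root_eq deg_def ..

lemma graded_roots_eq: "graded_roots t u T i = {\<gamma> \<in> \<Delta>p. deg T \<gamma> = i}"
  unfolding graded_roots_def root_coeffs_eq deg_def ..

lemma E_pr:
  assumes "\<gamma> \<in> \<Delta>" shows "pr \<gamma> (E \<gamma>) \<noteq> 0"
  using pr_V[OF E(1)[OF assms] root_dual[OF assms], of \<gamma>] E(2)[OF assms] by simp

lemma roots_of_n: "roots_of t n = D"
proof
  show "roots_of t n \<subseteq> D"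
  proof
    fix \<gamma> assume "\<gamma> \<in> roots_of t n"
    then have g: "\<gamma> \<in> \<Delta>" "V \<gamma> \<subseteq> n" unfolding roots_of_def by auto
    then have "E \<gamma> \<in> n" using E(1) by blast
    then show "\<gamma> \<in> D" using pr_n[of "E \<gamma>" \<gamma>] E_pr[OF g(1)] by blast
  qed
  show "D \<subseteq> roots_of t n" unfolding roots_of_def using V_in_n D_root by blast
qed

lemma roots_of_centre: "roots_of t (centre n) = graded_roots t u T d"
proof
  show "roots_of t (centre n) \<subseteq> graded_roots t u T d"
  proof
    fix \<gamma> assume "\<gamma> \<in> roots_of t (centre n)"
    then have g: "\<gamma> \<in> \<Delta>" "V \<gamma> \<subseteq> centre n" unfolding roots_of_def by auto
    have Ec: "E \<gamma> \<in> centre n" using E(1)[OF g(1)] g(2) by blast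
    then have En: "E \<gamma> \<in> n" unfolding centre_def by blast
    have gD: "\<gamma> \<in> D" using pr_n[OF En, of \<gamma>] E_pr[OF g(1)] by blast
    have "\<not> deg T \<gamma> < d" using centre_iff[OF En] Ec gD E_pr[OF g(1)] by blast
    then have "deg T \<gamma> = d" using deg_le_highest[OF T_simple g(1)] by simp
    then show "\<gamma> \<in> graded_roots t u T d" unfolding graded_roots_eq using D_pos[OF gD] by blast
  qed
  show "graded_roots t u T d \<subseteq> roots_of t (centre n)"
  proof
    fix \<gamma> assume "\<gamma> \<in> graded_roots t u T d"
    then have g: "\<gamma> \<in> \<Delta>p" "deg T \<gamma> = d" unfolding graded_roots_eq by auto
    have gD: "\<gamma> \<in> D" using g d_pos unfolding D_def by simp
    have "x \<in> centre n" if x: "x \<in> V \<gamma>" for x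
    proof -
      have "pr \<delta> x = 0" if "deg T \<delta> < d" for \<delta>
        using pr_V[OF x D_dual[OF gD], of \<delta>] that g(2) by auto
      then show ?thesis using centre_iff[OF V_in_n[OF gD x]] by blast
    qed
    then show "\<gamma> \<in> roots_of t (centre n)" unfolding roots_of_def using D_root[OF gD] by blast
  qed
qed

lemma nilradical_cascade_eq: "nilradical_cascade t u T = KT"
  unfolding nilradical_cascade_def kostant_cascade_eq roots_of_n KT_def ..

section \<open>The two implications\<close>

lemma square_integrable_imp_cascade_top:
  assumes "square_integrable n" "\<beta> \<in> KT" shows "deg T \<beta> = d"
proof -
  obtain \<eta> where \<eta>: "\<eta> \<in> linear_dual n" "coadjoint_stabiliser n \<eta> = centre n"
    using assms(1) square_integrable_iff[OF finite_basis n_subalgebra] by blast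
  have bD: "\<beta> \<in> D" and bK: "\<beta> \<in> kcascade" using assms(2) unfolding KT_def by auto
  note bR = D_root[OF bD]
  have En: "E \<beta> \<in> n" by (rule V_in_n[OF bD E(1)[OF bR]])
  have "E \<beta> \<in> centre n"
  proof (rule stabiliser_central[OF \<eta> En])
    fix y assume y: "y \<in> n"
    have "\<xi>0 (bracket (E \<beta>) (E \<delta>)) = 0" if "\<delta> \<in> D" for \<delta>
      by (rule \<xi>0_bracket_zero[OF D_pos[OF bD] that E(1)[OF bR] E(1)[OF D_root[OF that]]
            kcascade_not_summand[OF bK D_pos[OF that]]])
    then show "\<xi>0 (bracket (E \<beta>) y) = 0"
      using \<xi>0_expand[OF _ y, of "E \<beta>"] n_subset_normaliser En by (simp add: subset_iff)
  qed
  then have "\<not> deg T \<beta> < d" using centre_iff[OF En] bD E_pr[OF bR] by blast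
  then show ?thesis using deg_le_highest[OF T_simple bR] by simp
qed

text \<open>An element of the stabiliser of \<open>\<xi>0\<close> is tested against the root vector
  of the partner of \<gamma>; uniqueness of partners leaves only its coordinate at \<gamma>, with a
  nonzero factor.\<close>

lemma cascade_top_imp_square_integrable:
  assumes top: "\<And>\<beta>. \<beta> \<in> KT \<Longrightarrow> deg T \<beta> = d" shows "square_integrable n"
proof -
  have "x \<in> centre n" if x: "x \<in> coadjoint_stabiliser n \<xi>0" for x
  proof -
    have xn: "x \<in> n" and x0: "\<And>y. y \<in> n \<Longrightarrow> \<xi>0 (bracket x y) = 0"
      using x unfolding coadjoint_stabiliser_iff by auto
    have "pr \<gamma> x = 0" if g: "\<gamma> \<in> D" and low: "deg T \<gamma> < d" for \<gamma>
    proof -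
      obtain \<beta> where b: "\<beta> \<in> kcascade" "\<gamma> = \<beta> \<or> \<beta> - \<gamma> \<in> \<Delta>p" using exists_kcascade_above[OF D_pos[OF g]] by blast
      have "\<gamma> \<noteq> \<beta>"
      proof
        assume "\<gamma> = \<beta>"
        then have "deg T \<gamma> = d" using top g b(1) unfolding KT_def by blast
        then show False using low by simp
      qed
      then have m: "\<beta> - \<gamma> \<in> \<Delta>p" using b(2) by blast
      define \<delta> where "\<delta> = \<beta> - \<gamma>"
      have dP: "\<delta> \<in> \<Delta>p" using m unfolding \<delta>_def .
      have sum: "\<delta> + \<gamma> = \<beta>" "\<gamma> + \<delta> = \<beta>" unfolding \<delta>_def by simp_all
      have deg_sum: "deg T \<beta> = deg T \<gamma> + deg T \<delta>"
        using deg_add[OF T_simple positive_lattice[OF D_pos[OF g]] positive_lattice[OF dP]] unfolding sum .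
      have bP: "\<beta> \<in> \<Delta>p" using b(1) kcascade_subset by blast
      have "deg T \<beta> > 0" using deg_sum D_deg[OF g] deg_cone_nonneg[OF T_simple cone_base[OF dP]] by simp
      then have "deg T \<beta> = d" using top[of \<beta>] b(1) bP unfolding KT_def D_def by blast
      \<comment> \<open>The assumption on the cascade enters here: \<beta> has degree
        \<open>d\<close> and \<gamma> less, so the partner has positive degree and its root vector
        belongs to \<open>n\<close>.\<close>
      then have dD: "\<delta> \<in> D" using deg_sum low dP unfolding D_def by simp
      note dR = D_root[OF dD]
      have En: "E \<delta> \<in> n" by (rule V_in_n[OF dD E(1)[OF dR]])
      \<comment> \<open>The arguments are exchanged because \<open>\<xi>0_expand\<close> expands the
        second one.\<close>
      have "bracket x (E \<delta>) = - bracket (E \<delta>) x" by (rule bracket_skew)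
      then have "\<xi>0 (bracket (E \<delta>) x) = - \<xi>0 (bracket x (E \<delta>))"
        using linear_dual_scale_apply[OF \<xi>0_dual n_bracket[OF xn En], of "- 1"]
        by (simp add: complex_vector.scale_minus_left scaleC_one)
      then have "\<xi>0 (bracket (E \<delta>) x) = 0" using x0[OF En] by simp
      moreover have "\<xi>0 (bracket (E \<delta>) x) = (\<Sum>\<epsilon>\<in>D. coord \<epsilon> x * \<xi>0 (bracket (E \<delta>) (E \<epsilon>)))"
        using \<xi>0_expand[OF _ xn] n_subset_normaliser En by blast
      moreover have "\<xi>0 (bracket (E \<delta>) (E \<epsilon>)) = 0" if e: "\<epsilon> \<in> D" "\<epsilon> \<noteq> \<gamma>" for \<epsilon>
      proof (rule \<xi>0_bracket_zero[OF dP e(1) E(1)[OF dR] E(1)[OF D_root[OF e(1)]]])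
        show "\<delta> + \<epsilon> \<notin> kcascade"
        proof
          assume "\<delta> + \<epsilon> \<in> kcascade"
          moreover have "\<delta> + \<gamma> \<in> kcascade" unfolding sum by (rule b(1))
          ultimately have "\<epsilon> = \<gamma>" by (rule kcascade_partner_unique[OF dP D_pos[OF e(1)] D_pos[OF g]])
          then show False using e(2) by blast
        qed
      qed
      then have "(\<Sum>\<epsilon>\<in>D. coord \<epsilon> x * \<xi>0 (bracket (E \<delta>) (E \<epsilon>))) =
          (\<Sum>\<epsilon>\<in>D. if \<epsilon> = \<gamma> then coord \<gamma> x * \<xi>0 (bracket (E \<delta>) (E \<gamma>)) else 0)"
        by (intro sum.cong refl) auto
      ultimately have "coord \<gamma> x * \<xi>0 (bracket (E \<delta>) (E \<gamma>)) = 0" using finite_D g by simp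
      moreover have "\<xi>0 (bracket (E \<delta>) (E \<gamma>)) \<noteq> 0"
      proof (rule \<xi>0_bracket_nonzero[OF dP g E(1)[OF dR] E(2)[OF dR] E(1)[OF D_root[OF g]] E(2)[OF D_root[OF g]]])
        show "\<delta> + \<gamma> \<in> kcascade" unfolding sum by (rule b(1))
      qed
      ultimately have "coord \<gamma> x = 0" by simp
      then show ?thesis using pr_coord[OF D_root[OF g], of x] by simp
    qed
    then show ?thesis using centre_iff[OF xn] by blast
  qed
  then have "coadjoint_stabiliser n \<xi>0 = centre n"
    using centre_subset_stabiliser[OF n_subspace \<xi>0_dual] by blast
  then show ?thesis using square_integrable_iff[OF finite_basis n_subalgebra] \<xi>0_dual by blast
qed

lemma square_integrable_nilradical_iff: "square_integrable n \<longleftrightarrow> d \<le> 2 \<and> KT \<subseteq> graded_roots t u T d"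
proof -
  have top_iff: "KT \<subseteq> graded_roots t u T d \<longleftrightarrow> (\<forall>\<beta>\<in>KT. deg T \<beta> = d)"
    unfolding graded_roots_eq KT_def using D_pos by blast
  show ?thesis
  proof
    assume sq: "square_integrable n"
    then have top: "\<forall>\<beta>\<in>KT. deg T \<beta> = d" using square_integrable_imp_cascade_top by blast
    have "d \<le> 2"
    proof (rule kcascade_degree_le_2[OF T_nonempty T_simple])
      fix \<beta> assume "\<beta> \<in> kcascade" "deg T \<beta> > 0"
      then show "deg T \<beta> = d" using top kcascade_subset unfolding KT_def D_def by blast
    qed
    then show "d \<le> 2 \<and> KT \<subseteq> graded_roots t u T d" using top top_iff by blast
  next
    assume "d \<le> 2 \<and> KT \<subseteq> graded_roots t u T d"
    then show "square_integrable n" using top_iff cascade_top_imp_square_integrable by blast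
  qed
qed

end

theorem theorem7p2:
  fixes u t u' :: "'g::complex_lie_algebra set"
    and T :: "('g \<Rightarrow> complex) set"
  assumes "simple_lie_algebra TYPE('g)"
    and "triangular_decomposition u t u'"
    and "T \<noteq> {}" and "T \<subseteq> simple_roots t u"
  shows "(square_integrable (nilradical t u T) \<longleftrightarrow>
            nilradical_depth t u T \<le> 2 \<and>
            nilradical_cascade t u T \<subseteq> graded_roots t u T (nilradical_depth t u T)) \<and>
         graded_roots t u T (nilradical_depth t u T) = roots_of t (centre (nilradical t u T))"
proof -
  interpret simple_triangular u t u' by unfold_locales (rule assms)+
  interpret standard_nilradical u t u' T
  proof
    show "T \<noteq> {}" by (rule assms)
    show "T \<subseteq> simple" using assms(4) unfolding simple_roots_eq .
  qed
  show ?thesis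
    unfolding nilradical_depth_eq nilradical_cascade_eq
    using square_integrable_nilradical_iff roots_of_centre by blast
qed

end
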